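(* Let $\beta>0$ and let $F,G$ be the analytic functions on $\{r\in\mathbb C^3:|r_i|<1/10,\ i=1,2,3\}$ given by $F(r)=\sum_{n\in\mathbb N_0^3}A_nr^n$, $G(r)=\sum_{n\in\mathbb N_0^3}B_nr^n$, with $A,B$ the neighbor arrays defined in the context. Then $F$ and $G$ extend analytically to a domain in $\mathbb C^3$ containing $[0,1)^3$. Moreover, in this domain, for all $\{j,k,\ell\}=\{1,2,3\}$, $$\big(r_\ell(1-r_\ell)\partial_{r_\ell}^2+(2\beta-2r_\ell)\partial_{r_\ell}-\beta(1-\beta)\big)F=(1-r_j)(1-r_k)G,$$ $$\big(2r_jr_k\partial_{r_j}\partial_{r_k}+\beta r_j\partial_{r_j}+\beta r_k\partial_{r_k}+\beta r_\ell\partial_{r_\ell}+\beta^2\big)F=\big(r_\ell(r_j+r_k)-(1+r_jr_k)\big)G.$$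
   Context: $\mathbb N_0=\{0,1,2,\dots\}$, $r^n=r_1^{n_1}r_2^{n_2}r_3^{n_3}$, $e_j$ is the $j$-th unit vector of $\mathbb Z^3$. The neighbor arrays: for $\beta>0$, $A,B:\mathbb N_0^3\to\mathbb R$, extended by $0$ to $\mathbb Z^3$, are the unique pair with $A_{(0,0,0)}=1$ such that for all $n\in\mathbb Z^3$ and all $\{j,k,\ell\}=\{1,2,3\}$, $$(n_\ell+1)(n_\ell+2\beta)A_{n+e_\ell}-(n_\ell+\beta)(n_\ell+1-\beta)A_n=B_n-B_{n-e_j}-B_{n-e_k}+B_{n-e_j-e_k},$$ $$(2n_jn_k+\beta n_j+\beta n_k+\beta n_\ell+\beta^2)A_n=B_{n-e_\ell-e_j}+B_{n-e_\ell-e_k}-B_n-B_{n-e_j-e_k}.$$ Both power series converge absolutely on the polydisc $\{|r_i|<1/10\}$. *)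

theory Defs
  imports "HOL-Analysis.Analysis"
begin

text \<open>
  The coordinates 1, 2, 3 are the elements of the three-element type \<^typ>\<open>3\<close> (in which the
  numeral 3 denotes the same element as 0), and the unit vector $e_j$ is \<open>axis j 1\<close>.
\<close>

definition ext0 :: "(nat ^ 3 \<Rightarrow> real) \<Rightarrow> int ^ 3 \<Rightarrow> real" where
  "ext0 A n = (if \<forall>i. 0 \<le> n $ i then A (\<chi> i. nat (n $ i)) else 0)"

definition neighbor_arrays ::
    "real \<Rightarrow> (nat ^ 3 \<Rightarrow> real) \<Rightarrow> (nat ^ 3 \<Rightarrow> real) \<Rightarrow> bool" where
  "neighbor_arrays \<beta> A0 B0 \<longleftrightarrow>
    (let A = ext0 A0; B = ext0 B0; e = (\<lambda>j :: 3. axis j (1 :: int)) in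
      A 0 = 1 \<and>
      (\<forall>n j k l. {j, k, l} = {1, 2, 3 :: 3} \<longrightarrow>
        (of_int (n $ l) + 1) * (of_int (n $ l) + 2 * \<beta>) * A (n + e l)
          - (of_int (n $ l) + \<beta>) * (of_int (n $ l) + 1 - \<beta>) * A n
        = B n - B (n - e j) - B (n - e k) + B (n - e j - e k)) \<and>
      (\<forall>n j k l. {j, k, l} = {1, 2, 3 :: 3} \<longrightarrow>
        (2 * of_int (n $ j) * of_int (n $ k) + \<beta> * of_int (n $ j) + \<beta> * of_int (n $ k)
          + \<beta> * of_int (n $ l) + \<beta>\<^sup>2) * A n
        = B (n - e l - e j) + B (n - e l - e k) - B n - B (n - e j - e k)))"

definition mpow :: "complex ^ 3 \<Rightarrow> nat ^ 3 \<Rightarrow> complex" where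
  "mpow r n = (\<Prod>i\<in>UNIV. (r $ i) ^ (n $ i))"

definition polydisc :: "complex ^ 3 \<Rightarrow> real \<Rightarrow> (complex ^ 3) set" where
  "polydisc a \<rho> = {r. \<forall>i. cmod (r $ i - a $ i) < \<rho>}"

text \<open>
  Analyticity in three complex variables: local representability by power series.
  \<open>has_sum\<close> is unconditional, hence absolute, convergence here.
\<close>

definition analytic3_on :: "(complex ^ 3 \<Rightarrow> complex) \<Rightarrow> (complex ^ 3) set \<Rightarrow> bool" where
  "analytic3_on F D \<longleftrightarrow>
    (\<forall>a\<in>D. \<exists>\<rho>>0. \<exists>c :: nat ^ 3 \<Rightarrow> complex.
      \<forall>r\<in>polydisc a \<rho>. ((\<lambda>n. c n * mpow (r - a) n) has_sum F r) UNIV)"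

definition partial3 :: "3 \<Rightarrow> (complex ^ 3 \<Rightarrow> complex) \<Rightarrow> complex ^ 3 \<Rightarrow> complex" where
  "partial3 l F r = deriv (\<lambda>z. F (\<chi> i. if i = l then z else r $ i)) (r $ l)"

definition half_open_cube :: "(complex ^ 3) set" where
  "half_open_cube = {r. \<forall>i. r $ i \<in> complex_of_real ` {0..<1}}"

end

theory Submission
  imports Defs "HOL-Complex_Analysis.Conformal_Mappings" "HOL-Real_Asymp.Real_Asymp"
begin

text \<open>
  Expand in powers of the third variable: the function F is the sum of \<open>f_n(r1, r2) r3^n\<close>, and
  likewise G of \<open>g_n(r1, r2) r3^n\<close>. The arrays grow subexponentially on each plane n3 = n, so all
  \<open>f_n\<close> and \<open>g_n\<close> converge on the unit bidisc, where the two families of relations turn into a recurrence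
  in n: it determines \<open>f_{n+1}\<close>, \<open>g_{n+1}\<close> from \<open>f_n\<close>, \<open>g_n\<close>, \<open>g_{n-1}\<close>. After scaling \<open>g_n\<close> by
  \<open>n^(-2)\<close> the coefficients of this recurrence converge, and the characteristic roots of the limit are
  1 and \<open>tanh(u + v)^2\<close>, \<open>tanh(u - v)^2\<close> with \<open>r1 = tanh(u)^2\<close>, \<open>r2 = tanh(v)^2\<close>. The latter
  two have modulus less than 1 as long as u and v lie in the strip \<open>\<bar>Im\<bar> < \<pi> / 8\<close>, which corresponds to a
  lens-shaped neighbourhood of [0,1) containing the disc of radius 1/8. There \<open>f_n\<close> and \<open>g_n\<close> are
  \<open>O((1 + \<epsilon>)^n)\<close> locally uniformly, so F and G extend to the product of two lenses and the unit disc.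
  The differential equations hold near 0 by comparing coefficients, and on the whole product by the
  identity theorem.
\<close>

section \<open>Power series in three variables\<close>

text \<open>The relations do not form a recurrence in n by themselves. Let D1, D2 be the Euler
  operators r1 d/dr1, r2 d/dr2. The first relation with l = 3 gives f_{n+1} from f_n and g_n, but
  g_{n+1} is known only through f_{n+1} and (D1 + D2) f_{n+1}. Therefore D1 + D2 is applied to that
  relation too; this brings in (D1 + D2) g_n, hence second-order Euler derivatives of f_n, and the
  remaining relations express all of these algebraically through f_n, g_n, g_{n-1}. The factor
  n^(-2) comes from the same relation: to leading order n^2 (f_{n+1} - f_n) is (1 - r1)(1 - r2) g_n.
  In the limit the system is triangular: g obeys a recurrence of its own with the two tanh roots and
  feeds f, which contributes the root 1. The tanh roots may coincide, so stability is read off an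
  adapted norm and not off eigenvectors. Absolute convergence of the two series on the polydisc of
  radius 1/10 is derived: Cauchy estimates on discs of radius 1/8 dominate the triple
  series.\<close>

lemma vec3_eq_iff: "x = y \<longleftrightarrow> x $ 1 = y $ 1 \<and> x $ 2 = y $ 2 \<and> x $ 3 = y $ 3" for x y :: "'a ^ 3"
  by (simp add: vec_eq_iff forall_3)

lemma vector3_collapse [simp]: "vector [x $ 1, x $ 2, x $ 3] = x" for x :: "'a :: zero ^ 3"
  by (simp add: vec3_eq_iff)

lemma mpow_3: "mpow r n = (r $ 1) ^ (n $ 1) * (r $ 2) ^ (n $ 2) * (r $ 3) ^ (n $ 3)"
  unfolding mpow_def UNIV_3 by simp

text \<open>Indexing by all of Z^3, with value 0 off the octant, makes every index shift a bijection
  of the index set. The relations can then be used at every n without boundary cases.\<close>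

definition arr_pow :: "complex ^ 3 \<Rightarrow> int ^ 3 \<Rightarrow> complex" where
  "arr_pow r n = (if \<forall>i. 0 \<le> n $ i then mpow r (\<chi> i. nat (n $ i)) else 0)"

definition arr_series :: "(int ^ 3 \<Rightarrow> complex) \<Rightarrow> complex ^ 3 \<Rightarrow> complex \<Rightarrow> bool" where
  "arr_series a r s \<longleftrightarrow> ((\<lambda>n. a n * arr_pow r n) has_sum s) UNIV"

definition nonneg_supp :: "(int ^ 3 \<Rightarrow> 'a :: zero) \<Rightarrow> bool" where
  "nonneg_supp a \<longleftrightarrow> (\<forall>n. (\<exists>i. n $ i < 0) \<longrightarrow> a n = 0)"

abbreviation ev :: "3 \<Rightarrow> int ^ 3" where "ev j \<equiv> axis j 1"

definition upd :: "complex ^ 3 \<Rightarrow> 3 \<Rightarrow> complex \<Rightarrow> complex ^ 3" where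
  "upd r l z = (\<chi> i. if i = l then z else r $ i)"

lemma upd_nth [simp]: "upd r l z $ i = (if i = l then z else r $ i)"
  by (simp add: upd_def)

lemma upd_self [simp]: "upd r l (r $ l) = r"
  by (simp add: vec_eq_iff)

lemma axis_3 [simp]:
  "axis 1 (x :: int) $ (1::3) = x" "axis 1 (x :: int) $ (2::3) = 0" "axis 1 (x :: int) $ (3::3) = 0"
  "axis 2 (x :: int) $ (1::3) = 0" "axis 2 (x :: int) $ (2::3) = x" "axis 2 (x :: int) $ (3::3) = 0"
  "axis 3 (x :: int) $ (1::3) = 0" "axis 3 (x :: int) $ (2::3) = 0" "axis 3 (x :: int) $ (3::3) = x"
  by (simp_all add: axis_def)

lemma partial3_upd: "partial3 l F r = deriv (\<lambda>z. F (upd r l z)) (r $ l)"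
  by (simp add: partial3_def upd_def)

lemma arr_pow_add_axis:
  assumes "\<forall>i. 0 \<le> n $ i"
  shows "arr_pow r (n + ev j) = r $ j * arr_pow r n"
proof -
  have n: "0 \<le> n $ 1" "0 \<le> n $ 2" "0 \<le> n $ 3" using assms by blast+
  have m: "nat (m + 1) = Suc (nat m)" if "0 \<le> m" for m using that by simp
  show ?thesis
    using exhaust_3[of j] n by (elim disjE) (simp_all add: arr_pow_def forall_3 mpow_3 m)
qed

lemma arr_series_unique: "arr_series a r s \<Longrightarrow> arr_series a r t \<Longrightarrow> s = t"
  unfolding arr_series_def by (rule has_sum_unique)

lemma arr_series_add: "arr_series a r s \<Longrightarrow> arr_series b r t \<Longrightarrow> arr_series (\<lambda>n. a n + b n) r (s + t)"
  unfolding arr_series_def by (drule (1) has_sum_add) (simp add: ring_distribs)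

lemma arr_series_cmult: "arr_series a r s \<Longrightarrow> arr_series (\<lambda>n. c * a n) r (c * s)"
  unfolding arr_series_def by (drule has_sum_cmult_right[where c = c]) (simp add: mult.assoc)

lemma arr_series_diff: "arr_series a r s \<Longrightarrow> arr_series b r t \<Longrightarrow> arr_series (\<lambda>n. a n - b n) r (s - t)"
  using arr_series_add[of a r s "\<lambda>n. -1 * b n" "-1 * t"] arr_series_cmult[of b r t "-1"] by simp

text \<open>Translating the index by e_j multiplies the monomial by r_j wherever n lies in the
  octant. Elsewhere this can fail (at n_j = -1), and there the support hypothesis makes the
  coefficient vanish.\<close>

lemma arr_series_shift:
  assumes "nonneg_supp a" "arr_series a r s"
  shows "arr_series (\<lambda>n. a (n - ev j)) r (r $ j * s)"
proof -
  have "((\<lambda>n. r $ j * (a n * arr_pow r n)) has_sum r $ j * s) UNIV"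
    using assms by (auto simp: arr_series_def intro: has_sum_cmult_right)
  also have "(\<lambda>n. r $ j * (a n * arr_pow r n)) = (\<lambda>n. a (n + ev j - ev j) * arr_pow r (n + ev j))"
  proof
    fix n
    show "r $ j * (a n * arr_pow r n) = a (n + ev j - ev j) * arr_pow r (n + ev j)"
    proof (cases "\<forall>i. 0 \<le> n $ i")
      case True
      then show ?thesis by (simp add: arr_pow_add_axis)
    next
      case False
      then have "a n = 0" using assms(1) by (auto simp: nonneg_supp_def not_le)
      then show ?thesis by simp
    qed
  qed
  also have "((\<lambda>n. a (n + ev j - ev j) * arr_pow r (n + ev j)) has_sum r $ j * s) UNIV \<longleftrightarrow> ((\<lambda>n. a (n - ev j) * arr_pow r n) has_sum r $ j * s) UNIV"
    by (rule has_sum_reindex_bij_betw[where f = "\<lambda>n. a (n - ev j) * arr_pow r n"])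
       (rule bij_betwI[of _ _ _ "\<lambda>n. n - ev j"]; simp)
  finally show ?thesis by (simp add: arr_series_def)
qed

lemma nonneg_supp_shift: "nonneg_supp a \<Longrightarrow> nonneg_supp (\<lambda>n. a (n - ev j))" for a :: "int ^ 3 \<Rightarrow> 'a :: zero"
  unfolding nonneg_supp_def
proof (intro allI impI)
  fix n :: "int ^ 3"
  assume a: "\<forall>n. (\<exists>i. n $ i < 0) \<longrightarrow> a n = 0" and "\<exists>i. n $ i < 0"
  then obtain i where "n $ i < 0" by blast
  then have "(n - ev j) $ i < 0" by (auto simp: axis_def)
  with a show "a (n - ev j) = 0" by blast
qed

text \<open>The factor q collects the other two variables, so each term is a one-variable monomial
  in z and the second expression is its derivative. At n_l = 0 the shifted index leaves the octant,
  but the factor n_l is 0 as well.\<close>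

lemma arr_pow_upd:
  "\<exists>q. \<forall>z. arr_pow (upd r l z) n = q * z ^ nat (n $ l) \<and>
     of_int (n $ l) * arr_pow (upd r l z) (n - ev l) = q * (of_nat (nat (n $ l)) * z ^ (nat (n $ l) - 1))"
proof (cases "0 \<le> n $ 1 \<and> 0 \<le> n $ 2 \<and> 0 \<le> n $ 3")
  case True
  define q where "q = (\<Prod>i\<in>UNIV - {l}. r $ i ^ nat (n $ i))"
  have q: "q = (if l = 1 then 1 else r $ 1 ^ nat (n $ 1)) * (if l = 2 then 1 else r $ 2 ^ nat (n $ 2))
      * (if l = 3 then 1 else r $ 3 ^ nat (n $ 3))"
    using exhaust_3[of l] unfolding q_def UNIV_3 by (auto simp: insert_Diff_if)
  have m: "nat (m - 1) = nat m - 1" for m :: int by simp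
  have "arr_pow (upd r l z) n = q * z ^ nat (n $ l)" for z
    using exhaust_3[of l] True by (auto simp: arr_pow_def forall_3 mpow_3 q)
  moreover have "of_int (n $ l) * arr_pow (upd r l z) (n - ev l) = q * (of_nat (nat (n $ l)) * z ^ (nat (n $ l) - 1))" for z
    using exhaust_3[of l] True by (cases "n $ l = 0") (auto simp: arr_pow_def forall_3 mpow_3 q m)
  ultimately show ?thesis by blast
next
  case False
  have "arr_pow (upd r l z) n = 0" "arr_pow (upd r l z) (n - ev l) = 0" for z
    using False exhaust_3[of l] by (auto simp: arr_pow_def forall_3)
  then show ?thesis by (intro exI[of _ 0]) simp
qed

text \<open>
  Differentiation of the partial sums along the filter of finite index sets: by Weierstrass'
  theorem the termwise derivatives converge, unconditionally, to the derivative of the sum.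
\<close>

lemma arr_series_deriv:
  assumes ser: "\<And>z. norm z < R \<Longrightarrow> arr_series a (upd r l z) (\<Phi> z)" and z: "norm z < R"
  obtains d where "(\<Phi> has_field_derivative d) (at z)"
    "arr_series (\<lambda>n. (of_int (n $ l) + 1) * a (n + ev l)) (upd r l z) d"
proof -
  define u where "u n z = a n * arr_pow (upd r l z) n" for n z
  define u' where "u' n z = a n * (of_int (n $ l) * arr_pow (upd r l z) (n - ev l))" for n z
  obtain q where q: "arr_pow (upd r l z) n = q n * z ^ nat (n $ l)"
      "of_int (n $ l) * arr_pow (upd r l z) (n - ev l) = q n * (of_nat (nat (n $ l)) * z ^ (nat (n $ l) - 1))" for n z
    using arr_pow_upd[of r l] by metis
  have u: "u n z = a n * q n * z ^ nat (n $ l)" for n z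
    by (simp add: u_def q)
  have der: "(u n has_field_derivative u' n z) (at z)" for n z
    unfolding u[abs_def] u'_def q(2) by (auto intro!: derivative_eq_intros)
  obtain R' where R': "norm z < R'" "R' < R" using dense[OF z] by blast
  define \<rho> where "\<rho> = R' - norm z"
  have "0 < \<rho>" using R' by (simp add: \<rho>_def)
  have "0 < R'" using R' norm_ge_zero[of z] by linarith
  have cb: "norm w \<le> R'" if "w \<in> cball z \<rho>" for w
    using that norm_triangle_ineq2[of w z] by (simp add: \<rho>_def dist_norm norm_minus_commute)
  \<comment> \<open>On a disc about 0 a monomial is largest at the real point \<open>R'\<close>, so
    convergence at that single point supplies the majorant for the M-test on
    \<open>cball z \<rho>\<close>.\<close>
  have bd: "norm (u n w) \<le> norm (u n (of_real R'))" if "w \<in> cball z \<rho>" for n w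
    using cb[OF that] \<open>0 < R'\<close>
    by (auto simp: u norm_mult norm_power intro!: mult_left_mono power_mono)
  have "(\<lambda>n. u n (of_real R')) summable_on UNIV"
    using ser[of "of_real R'"] \<open>0 < R'\<close> R' by (auto simp: arr_series_def u_def summable_on_def)
  then have summ: "(\<lambda>n. norm (u n (of_real R'))) summable_on UNIV"
    by (simp add: summable_on_iff_abs_summable_on_complex)
  have ul: "uniform_limit (cball z \<rho>) (\<lambda>X y. \<Sum>n\<in>X. u n y) \<Phi> (finite_subsets_at_top UNIV)"
  proof (rule Weierstrass_m_test_general'[OF bd _ summ])
    fix w assume "w \<in> cball z \<rho>"
    with cb[OF this] R' ser[of w] show "((\<lambda>n. u n w) has_sum \<Phi> w) UNIV"
      by (simp add: arr_series_def u_def)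
  qed
  have ev: "\<forall>\<^sub>F X in finite_subsets_at_top UNIV. continuous_on (cball z \<rho>) (\<lambda>y. \<Sum>n\<in>X. u n y) \<and>
      (\<forall>w\<in>ball z \<rho>. ((\<lambda>y. \<Sum>n\<in>X. u n y) has_field_derivative (\<Sum>n\<in>X. u' n w)) (at w))"
    by (intro always_eventually allI conjI ballI DERIV_sum continuous_on_sum der
        DERIV_continuous_on[OF DERIV_subset[OF der subset_UNIV]])
  obtain g' where g': "\<And>w. w \<in> ball z \<rho> \<Longrightarrow> (\<Phi> has_field_derivative g' w) (at w) \<and>
      ((\<lambda>X. \<Sum>n\<in>X. u' n w) \<longlongrightarrow> g' w) (finite_subsets_at_top UNIV)"
    using has_complex_derivative_uniform_limit[OF ev ul _ \<open>0 < \<rho>\<close>] by auto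
  have z': "z \<in> ball z \<rho>" using \<open>0 < \<rho>\<close> by simp
  have "((\<lambda>n. u' n z) has_sum g' z) UNIV"
    using g'[OF z'] by (simp add: has_sum_def)
  also have "?this \<longleftrightarrow> ((\<lambda>n. u' (n + ev l) z) has_sum g' z) UNIV"
    by (rule has_sum_reindex_bij_betw[where f = "\<lambda>n. u' n z", symmetric])
       (rule bij_betwI[of _ _ _ "\<lambda>n. n - ev l"]; simp)
  also have "(\<lambda>n. u' (n + ev l) z) = (\<lambda>n. (of_int (n $ l) + 1) * a (n + ev l) * arr_pow (upd r l z) n)"
    by (simp add: u'_def algebra_simps axis_def)
  finally show ?thesis using g'[OF z'] by (intro that[of "g' z"]) (simp_all add: arr_series_def)
qed

text \<open>The shift by e_l can move an index into the octant only from n_l = -1, and there the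
  factor n_l + 1 vanishes.\<close>

lemma nonneg_supp_deriv: "nonneg_supp a \<Longrightarrow> nonneg_supp (\<lambda>n. (of_int (n $ l) + 1) * a (n + ev l))" for a :: "int ^ 3 \<Rightarrow> complex"
  unfolding nonneg_supp_def
proof (intro allI impI)
  fix n :: "int ^ 3"
  assume a: "\<forall>n. (\<exists>i. n $ i < 0) \<longrightarrow> a n = 0" and "\<exists>i. n $ i < 0"
  then obtain i where i: "n $ i < 0" by blast
  show "(of_int (n $ l) + 1) * a (n + ev l) = 0"
  proof (cases "n $ l = -1")
    case False
    with i have "(n + ev l) $ i < 0" by (auto simp: axis_def)
    with a show ?thesis by (metis mult_zero_right)
  qed simp
qed

lemma mpow_eq_arr_pow: "mpow r n = arr_pow r (\<chi> i. int (n $ i))"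
  by (simp add: arr_pow_def mpow_def)

lemma arr_series_iff_nat:
  "arr_series a r s \<longleftrightarrow> ((\<lambda>n :: nat ^ 3. a (\<chi> i. int (n $ i)) * mpow r n) has_sum s) UNIV"
proof -
  have inj: "inj (\<lambda>n :: nat ^ 3. (\<chi> i. int (n $ i)))"
    by (auto simp: inj_def vec_eq_iff)
  have "((\<lambda>n :: nat ^ 3. a (\<chi> i. int (n $ i)) * mpow r n) has_sum s) UNIV \<longleftrightarrow>
     ((\<lambda>n. a n * arr_pow r n) has_sum s) (range (\<lambda>n :: nat ^ 3. (\<chi> i. int (n $ i))))"
    by (simp add: has_sum_reindex[OF inj] o_def mpow_eq_arr_pow)
  also have "\<dots> \<longleftrightarrow> arr_series a r s"
    unfolding arr_series_def
  proof (rule has_sum_cong_neutral)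
    fix n :: "int ^ 3"
    assume "n \<in> UNIV - range (\<lambda>n :: nat ^ 3. (\<chi> i. int (n $ i)))"
    then have "n \<noteq> (\<chi> i. int ((\<chi> i. nat (n $ i)) $ i))" by blast
    then show "a n * arr_pow r n = 0"
      by (auto simp: arr_pow_def vec_eq_iff)
  qed auto
  finally show ?thesis by simp
qed

section \<open>Subexponential growth of the slices\<close>

text \<open>For an array supported on the octant this amounts to convergence of the slice n3 = k on
  the whole open unit bidisc. The constant may depend on k; uniformity in k is a separate matter,
  settled in \<open>slice_growth\<close>.\<close>

definition subexp :: "(int ^ 3 \<Rightarrow> real) \<Rightarrow> int \<Rightarrow> bool" where
  "subexp a k \<longleftrightarrow> (\<forall>\<rho>>1. \<exists>C. \<forall>n. n $ 3 = k \<longrightarrow> \<bar>a n\<bar> \<le> C * \<rho> ^ (nat (n $ 1) + nat (n $ 2)))"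

lemma slice_subE:
  assumes "subexp a k" "\<rho> > 1"
  obtains C where "C \<ge> 0" "\<And>n. n $ 3 = k \<Longrightarrow> \<bar>a n\<bar> \<le> C * \<rho> ^ (nat (n $ 1) + nat (n $ 2))"
proof -
  obtain C where C: "\<And>n. n $ 3 = k \<Longrightarrow> \<bar>a n\<bar> \<le> C * \<rho> ^ (nat (n $ 1) + nat (n $ 2))"
    using assms by (auto simp: subexp_def)
  show ?thesis
  proof (rule that[of "\<bar>C\<bar>"])
    fix n :: "int ^ 3" assume "n $ 3 = k"
    note C[OF this]
    also have "C * \<rho> ^ (nat (n $ 1) + nat (n $ 2)) \<le> \<bar>C\<bar> * \<rho> ^ (nat (n $ 1) + nat (n $ 2))"
      using assms(2) by (intro mult_right_mono) auto
    finally show "\<bar>a n\<bar> \<le> \<bar>C\<bar> * \<rho> ^ (nat (n $ 1) + nat (n $ 2))" .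
  qed simp
qed

lemma subexp_cong: "(\<And>n. n $ 3 = k \<Longrightarrow> a n = b n) \<Longrightarrow> subexp a k = subexp b k"
  by (simp add: subexp_def)

lemma subexp_add: "subexp a k \<Longrightarrow> subexp b k \<Longrightarrow> subexp (\<lambda>n. a n + b n) k"
  unfolding subexp_def
proof (intro allI impI, goal_cases)
  case (1 \<rho>)
  then obtain C D where "\<forall>n. n $ 3 = k \<longrightarrow> \<bar>a n\<bar> \<le> C * \<rho> ^ (nat (n $ 1) + nat (n $ 2))"
    "\<forall>n. n $ 3 = k \<longrightarrow> \<bar>b n\<bar> \<le> D * \<rho> ^ (nat (n $ 1) + nat (n $ 2))" by meson
  then show ?case
    by (intro exI[of _ "C + D"]) (force simp: ring_distribs intro: order_trans[OF abs_triangle_ineq])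
qed

lemma subexp_cmult: "subexp a k \<Longrightarrow> subexp (\<lambda>n. c * a n) k"
  unfolding subexp_def
proof (intro allI impI, goal_cases)
  case (1 \<rho>)
  then obtain C where "\<forall>n. n $ 3 = k \<longrightarrow> \<bar>a n\<bar> \<le> C * \<rho> ^ (nat (n $ 1) + nat (n $ 2))" by meson
  then show ?case
    by (intro exI[of _ "\<bar>c\<bar> * C"]) (simp add: abs_mult mult.assoc mult_left_mono)
qed

lemma subexp_diff: "subexp a k \<Longrightarrow> subexp b k \<Longrightarrow> subexp (\<lambda>n. a n - b n) k"
  using subexp_add[of a k "\<lambda>n. (-1) * b n"] subexp_cmult[of b k "-1"] by simp

lemma subexp_shift12:
  assumes "subexp a k" "j = 1 \<or> j = 2"
  shows "subexp (\<lambda>n. a (n - ev j)) k"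
  unfolding subexp_def
proof (intro allI impI)
  fix \<rho> :: real assume \<rho>: "\<rho> > 1"
  obtain C where C: "C \<ge> 0" "\<And>n. n $ 3 = k \<Longrightarrow> \<bar>a n\<bar> \<le> C * \<rho> ^ (nat (n $ 1) + nat (n $ 2))"
    using slice_subE[OF assms(1) \<rho>] by blast
  have "\<bar>a (n - ev j)\<bar> \<le> C * \<rho> ^ (nat (n $ 1) + nat (n $ 2))" if "n $ 3 = k" for n
  proof -
    have "\<bar>a (n - ev j)\<bar> \<le> C * \<rho> ^ (nat ((n - ev j) $ 1) + nat ((n - ev j) $ 2))"
      by (rule C(2)) (use that assms(2) in auto)
    also have "\<dots> \<le> C * \<rho> ^ (nat (n $ 1) + nat (n $ 2))"
      using assms(2) \<rho> C(1) by (intro mult_left_mono power_increasing) auto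
    finally show ?thesis .
  qed
  then show "\<exists>C. \<forall>n. n $ 3 = k \<longrightarrow> \<bar>a (n - ev j)\<bar> \<le> C * \<rho> ^ (nat (n $ 1) + nat (n $ 2))" by blast
qed

lemma subexp_shift3:
  assumes "subexp a (k - 1)"
  shows "subexp (\<lambda>n. a (n - ev 3)) k"
  unfolding subexp_def
proof (intro allI impI)
  fix \<rho> :: real assume \<rho>: "\<rho> > 1"
  obtain C where C: "C \<ge> 0" "\<And>n. n $ 3 = k - 1 \<Longrightarrow> \<bar>a n\<bar> \<le> C * \<rho> ^ (nat (n $ 1) + nat (n $ 2))"
    using slice_subE[OF assms(1) \<rho>] by blast
  show "\<exists>C. \<forall>n. n $ 3 = k \<longrightarrow> \<bar>a (n - ev 3)\<bar> \<le> C * \<rho> ^ (nat (n $ 1) + nat (n $ 2))"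
    using C(2)[of "_ - ev 3"] by (intro exI[of _ C]) auto
qed

text \<open>With \<rho> = \<sigma> \<sigma>, one factor \<sigma>^N carries the array and Bernoulli's
  inequality lets the other absorb the linear factor.\<close>

lemma subexp_mult_index:
  assumes "subexp a k" "nonneg_supp a" "j = 1 \<or> j = 2"
  shows "subexp (\<lambda>n. of_int (n $ j) * a n) k"
  unfolding subexp_def
proof (intro allI impI)
  fix \<rho> :: real assume "\<rho> > 1"
  define \<sigma> where "\<sigma> = sqrt \<rho>"
  have \<sigma>: "\<sigma> > 1" "\<sigma> * \<sigma> = \<rho>" using \<open>\<rho> > 1\<close> by (auto simp: \<sigma>_def)
  obtain C where C: "C \<ge> 0" "\<And>n. n $ 3 = k \<Longrightarrow> \<bar>a n\<bar> \<le> C * \<sigma> ^ (nat (n $ 1) + nat (n $ 2))"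
    using slice_subE[OF assms(1) \<sigma>(1)] by blast
  have "\<bar>of_int (n $ j) * a n\<bar> \<le> C / (\<sigma> - 1) * \<rho> ^ (nat (n $ 1) + nat (n $ 2))" if n: "n $ 3 = k" for n
  proof (cases "n $ 1 < 0 \<or> n $ 2 < 0")
    case True
    then have "a n = 0" using assms(2) by (auto simp: nonneg_supp_def)
    then show ?thesis using C \<sigma> \<open>\<rho> > 1\<close> by simp
  next
    case False
    define N where "N = nat (n $ 1) + nat (n $ 2)"
    have "1 + real N * (\<sigma> - 1) \<le> (1 + (\<sigma> - 1)) ^ N"
      using \<sigma> by (intro Bernoulli_inequality) auto
    then have "real N * (\<sigma> - 1) \<le> \<sigma> ^ N" by simp
    then have "real N \<le> \<sigma> ^ N / (\<sigma> - 1)" using \<sigma> by (simp add: field_simps)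
    moreover have "\<bar>of_int (n $ j) :: real\<bar> \<le> real N"
      using False assms(3) by (auto simp: N_def)
    ultimately have "\<bar>of_int (n $ j) * a n\<bar> \<le> (\<sigma> ^ N / (\<sigma> - 1)) * (C * \<sigma> ^ N)"
      unfolding abs_mult using C(2)[OF n] by (intro mult_mono) (auto simp: N_def)
    also have "\<dots> = C / (\<sigma> - 1) * \<rho> ^ N"
      unfolding \<sigma>(2)[symmetric] power_mult_distrib by simp
    finally show ?thesis by (simp add: N_def)
  qed
  then show "\<exists>C. \<forall>n. n $ 3 = k \<longrightarrow> \<bar>of_int (n $ j) * a n\<bar> \<le> C * \<rho> ^ (nat (n $ 1) + nat (n $ 2))" by blast
qed

text \<open>In terms of series, b is c divided by 1 - r1 r2, whose zeros lie outside the open unit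
  bidisc. On coefficients this is a sum of c along a diagonal, dominated by a geometric series of
  ratio 1 / \<rho>^2.\<close>

lemma subexp_diagonal:
  assumes "subexp c k" "nonneg_supp b" "\<And>n. n $ 3 = k \<Longrightarrow> b n = b (n - ev 1 - ev 2) + c n"
  shows "subexp b k"
  unfolding subexp_def
proof (intro allI impI)
  fix \<rho> :: real assume \<rho>: "\<rho> > 1"
  obtain C where C: "C \<ge> 0" "\<And>n. n $ 3 = k \<Longrightarrow> \<bar>c n\<bar> \<le> C * \<rho> ^ (nat (n $ 1) + nat (n $ 2))"
    using slice_subE[OF assms(1) \<rho>] by blast
  \<comment> \<open>The fixed point of D / \<rho>^2 + C = D: a step back along the diagonal lowers
    the exponent by 2, so this D reproduces itself in the induction.\<close>
  define D where "D = C * \<rho>\<^sup>2 / (\<rho>\<^sup>2 - 1)"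
  have \<rho>2: "\<rho>\<^sup>2 > 1" using \<rho> by (simp add: one_less_power)
  have D: "D \<ge> 0" "D + C * \<rho>\<^sup>2 = D * \<rho>\<^sup>2"
    using C \<rho>2 by (auto simp: D_def divide_simps) (auto simp: algebra_simps)
  have "\<bar>b n\<bar> \<le> D * \<rho> ^ (nat (n $ 1) + nat (n $ 2))" if "n $ 3 = k" "nat (n $ 1) = N" for n N
    using that
  proof (induction N arbitrary: n rule: less_induct)
    case (less N)
    show ?case
    proof (cases "n $ 1 < 0 \<or> n $ 2 < 0")
      case True
      then have "b n = 0" using assms(2) by (auto simp: nonneg_supp_def)
      then show ?thesis using D \<rho> by simp
    next
      case False
      define M where "M = nat (n $ 1) + nat (n $ 2)"
      define m where "m = n - ev 1 - ev 2"
      have "\<bar>b m\<bar> * \<rho>\<^sup>2 \<le> D * \<rho> ^ M"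
      proof (cases "n $ 1 = 0 \<or> n $ 2 = 0")
        case True
        then have "m $ 1 < 0 \<or> m $ 2 < 0" by (auto simp: m_def)
        then have "b m = 0" using assms(2) by (auto simp: nonneg_supp_def)
        then show ?thesis using D \<rho> by simp
      next
        case F2: False
        have "nat (m $ 1) + nat (m $ 2) + 2 = M"
          using False F2 by (simp add: m_def M_def; arith)
        moreover have "\<bar>b m\<bar> \<le> D * \<rho> ^ (nat (m $ 1) + nat (m $ 2))"
          using less.prems False F2 by (intro less.IH[of "nat (m $ 1)"]) (auto simp: m_def)
        then have "\<bar>b m\<bar> * \<rho>\<^sup>2 \<le> D * \<rho> ^ (nat (m $ 1) + nat (m $ 2)) * \<rho>\<^sup>2"
          using \<rho> by (intro mult_right_mono) auto
        ultimately show ?thesis by (metis mult.assoc power_add)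
      qed
      moreover have "\<bar>b n\<bar> \<le> \<bar>b m\<bar> + \<bar>c n\<bar>"
        using assms(3)[OF less.prems(1)] by (simp add: m_def)
      moreover have "\<bar>c n\<bar> \<le> C * \<rho> ^ M" using C(2)[OF less.prems(1)] by (simp add: M_def)
      ultimately have "\<bar>b n\<bar> * \<rho>\<^sup>2 \<le> D * \<rho> ^ M + C * \<rho> ^ M * \<rho>\<^sup>2"
        using \<rho>2 by (smt (verit) distrib_right mult_right_mono)
      also have "\<dots> = (D + C * \<rho>\<^sup>2) * \<rho> ^ M" by (simp add: algebra_simps)
      also have "\<dots> = (D * \<rho> ^ M) * \<rho>\<^sup>2" by (simp add: D(2))
      finally have "\<bar>b n\<bar> \<le> D * \<rho> ^ M"
        by (rule mult_right_le_imp_le) (use \<rho>2 in linarith)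
      then show ?thesis by (simp add: M_def)
    qed
  qed
  then show "\<exists>C. \<forall>n. n $ 3 = k \<longrightarrow> \<bar>b n\<bar> \<le> C * \<rho> ^ (nat (n $ 1) + nat (n $ 2))" by blast
qed

lemma ratio_subexponential:
  fixes u q :: "nat \<Rightarrow> real"
  assumes u: "\<And>k. u (Suc k) = q k * u k" and q: "q \<longlonglongrightarrow> 1" and \<rho>: "\<rho> > 1"
  obtains C where "C \<ge> 0" "\<And>k. \<bar>u k\<bar> \<le> C * \<rho> ^ k"
proof -
  have "(\<lambda>k. \<bar>q k\<bar>) \<longlonglongrightarrow> \<bar>1\<bar>" using q by (rule tendsto_rabs)
  then have "eventually (\<lambda>k. \<bar>q k\<bar> < \<rho>) sequentially"
    using \<rho> order_tendstoD(2) by fastforce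
  then obtain N where N: "\<And>k. k \<ge> N \<Longrightarrow> \<bar>q k\<bar> < \<rho>" by (auto simp: eventually_sequentially)
  \<comment> \<open>Up to the index N, beyond which the ratios stay below \<rho>, the sequence is
    bounded by this sum; every later step costs at most a factor \<rho>.\<close>
  define C where "C = (\<Sum>i\<le>N. \<bar>u i\<bar>)"
  have "C \<ge> 0" by (auto simp: C_def intro: sum_nonneg)
  moreover have "\<bar>u k\<bar> \<le> C * \<rho> ^ k" for k
  proof (induction k)
    case 0
    have "\<bar>u 0\<bar> \<le> C" unfolding C_def by (rule member_le_sum) auto
    then show ?case by simp
  next
    case (Suc k)
    show ?case
    proof (cases "k \<ge> N")
      case True
      have "\<bar>u (Suc k)\<bar> \<le> \<rho> * (C * \<rho> ^ k)"
        unfolding u abs_mult using N[OF True] Suc \<rho> by (intro mult_mono) auto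
      then show ?thesis by (simp add: algebra_simps)
    next
      case False
      then have "\<bar>u (Suc k)\<bar> \<le> C" unfolding C_def by (intro member_le_sum) auto
      also have "\<dots> \<le> C * \<rho> ^ Suc k"
        using \<open>C \<ge> 0\<close> \<rho> one_le_power[of \<rho> "Suc k"] mult_left_mono[of 1 "\<rho> ^ Suc k" C] by auto
      finally show ?thesis .
    qed
  qed
  ultimately show ?thesis by (rule that)
qed

section \<open>The arrays on the plane n3 = 0, and growth on all planes\<close>

locale neighbor =
  fixes \<beta> :: real and a b :: "int ^ 3 \<Rightarrow> real"
  assumes beta: "\<beta> > 0" and suppa: "nonneg_supp a" and suppb: "nonneg_supp b"
    and eqL: "\<And>n j k l. {j, k, l} = {1, 2, 3} \<Longrightarrow>
        (of_int (n $ l) + 1) * (of_int (n $ l) + 2 * \<beta>) * a (n + ev l)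
          - (of_int (n $ l) + \<beta>) * (of_int (n $ l) + 1 - \<beta>) * a n
        = b n - b (n - ev j) - b (n - ev k) + b (n - ev j - ev k)"
    and eqJ: "\<And>n j k l. {j, k, l} = {1, 2, 3} \<Longrightarrow>
        (2 * of_int (n $ j) * of_int (n $ k) + \<beta> * of_int (n $ j) + \<beta> * of_int (n $ k)
          + \<beta> * of_int (n $ l) + \<beta>\<^sup>2) * a n
        = b (n - ev l - ev j) + b (n - ev l - ev k) - b n - b (n - ev j - ev k)"
begin

lemma zero_a: "n $ 1 < 0 \<or> n $ 2 < 0 \<or> n $ 3 < 0 \<Longrightarrow> a n = 0"
  using suppa by (auto simp: nonneg_supp_def)

lemma zero_b: "n $ 1 < 0 \<or> n $ 2 < 0 \<or> n $ 3 < 0 \<Longrightarrow> b n = 0"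
  using suppb by (auto simp: nonneg_supp_def)

lemma perms: "{2, 3, 1} = {1, 2, 3 :: 3}" "{1, 3, 2} = {1, 2, 3 :: 3}" "{1, 2, 3} = {1, 2, 3 :: 3}"
  by auto

text \<open>Half the sum, and in \<open>J_diff\<close> half the difference, of the second relation
  for l = 1 and l = 2. The quadratic terms combine so that only first powers of n1 and n2 remain;
  this makes the first-order Euler derivatives of a slice expressible through B and the slice
  itself.\<close>

lemma J_sum: "(of_int (n $ 3) + \<beta>) * (of_int (n $ 1) + of_int (n $ 2) + \<beta>) * a n = b (n - ev 1 - ev 2) - b n"
  using eqJ[OF perms(1), of n] eqJ[OF perms(2), of n]
  by (simp add: algebra_simps power2_eq_square)

lemma J_diff: "of_int (n $ 3) * (of_int (n $ 1) - of_int (n $ 2)) * a n = b (n - ev 2 - ev 3) - b (n - ev 1 - ev 3)"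
  using eqJ[OF perms(1), of n] eqJ[OF perms(2), of n]
  by (simp add: algebra_simps power2_eq_square)

text \<open>At n3 = 0 the terms shifted by e_3 vanish. The second relation with l = 3 then gives
  b(n) + b(n - e_1 - e_2), and \<open>J_sum\<close> gives the difference of the same two
  values.\<close>

lemma base_b:
  assumes "n $ 3 = 0"
  shows "b (n - ev 1 - ev 2) = - of_int (n $ 1) * of_int (n $ 2) * a n"
    "b n = - (of_int (n $ 1) + \<beta>) * (of_int (n $ 2) + \<beta>) * a n"
proof -
  have "b (n - ev 3 - ev 1) = 0" "b (n - ev 3 - ev 2) = 0"
    using assms by (auto intro!: zero_b)
  then show "b (n - ev 1 - ev 2) = - of_int (n $ 1) * of_int (n $ 2) * a n"
    "b n = - (of_int (n $ 1) + \<beta>) * (of_int (n $ 2) + \<beta>) * a n"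
    using eqJ[OF perms(3), of n] J_sum[of n] assms by (simp_all add: algebra_simps power2_eq_square)
qed

text \<open>Both formulas of \<open>base_b\<close> evaluate the same value b(n), one at n and the
  other at n + e_1 + e_2.\<close>

lemma diag_a:
  assumes "n $ 3 = 0"
  shows "(of_int (n $ 1) + 1) * (of_int (n $ 2) + 1) * a (n + ev 1 + ev 2)
    = (of_int (n $ 1) + \<beta>) * (of_int (n $ 2) + \<beta>) * a n"
proof -
  have "n + ev 1 + ev 2 - ev 1 - ev 2 = n" by simp
  then show ?thesis
    using base_b(2)[OF assms] base_b(1)[of "n + ev 1 + ev 2"] assms by (simp add: algebra_simps)
qed

text \<open>On the axis three of the four B-terms of the first relation with l = 1 fall outside the
  support, and \<open>base_b\<close> rewrites the fourth in terms of A. This gives a hypergeometric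
  two-term recurrence.\<close>

lemma axis1_a:
  assumes "n $ 2 = 0" "n $ 3 = 0"
  shows "(of_int (n $ 1) + 1) * (of_int (n $ 1) + 2 * \<beta>) * a (n + ev 1)
    = (of_int (n $ 1) + \<beta>) * (of_int (n $ 1) + 1 - 2 * \<beta>) * a n"
proof -
  have "b (n - ev 2) = 0" "b (n - ev 3) = 0" "b (n - ev 2 - ev 3) = 0"
    using assms by (auto intro!: zero_b)
  then show ?thesis
    using eqL[OF perms(1), of n] base_b(2)[of n] assms by (simp add: algebra_simps)
qed

lemma axis2_a:
  assumes "n $ 1 = 0" "n $ 3 = 0"
  shows "(of_int (n $ 2) + 1) * (of_int (n $ 2) + 2 * \<beta>) * a (n + ev 2)
    = (of_int (n $ 2) + \<beta>) * (of_int (n $ 2) + 1 - 2 * \<beta>) * a n"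
proof -
  have "b (n - ev 1) = 0" "b (n - ev 3) = 0" "b (n - ev 1 - ev 3) = 0"
    using assms by (auto intro!: zero_b)
  then show ?thesis
    using eqL[OF perms(2), of n] base_b(2)[of n] assms by (simp add: algebra_simps)
qed

text \<open>
  On the plane n3 = 0 the arrays are explicit: along diagonals the ratio of A is that of the
  product of two quotients poch_ratio, so only the two axes remain.
\<close>

definition poch_ratio :: "nat \<Rightarrow> real" where
  "poch_ratio k = (\<Prod>i<k. (real i + \<beta>) / (real i + 1))"

lemma poch_ratio_pos: "poch_ratio k > 0"
  using beta by (auto simp: poch_ratio_def intro!: prod_pos divide_pos_pos)

lemma poch_ratio_Suc: "poch_ratio (Suc k) = (real k + \<beta>) / (real k + 1) * poch_ratio k"
  by (simp add: poch_ratio_def)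

text \<open>Dividing by \<open>poch_ratio\<close> makes \<open>axis_a\<close> an exact product
  formula. What is left still has successive ratios tending to 1, by
  \<open>axis_ratio_Suc\<close>.\<close>

definition axis_ratio :: "3 \<Rightarrow> nat \<Rightarrow> real" where
  "axis_ratio j k = a (axis j (int k)) / poch_ratio k"

lemma axis_ratio_Suc:
  assumes "j = 1 \<or> j = 2"
  shows "axis_ratio j (Suc k) = (real k + 1 - 2 * \<beta>) / (real k + 2 * \<beta>) * axis_ratio j k"
proof -
  have n: "axis j (int k) + ev j = axis j (int (Suc k))"
    by (simp add: vec_eq_iff axis_def)
  have "(real k + 1) * (real k + 2 * \<beta>) * a (axis j (int (Suc k)))
      = (real k + \<beta>) * (real k + 1 - 2 * \<beta>) * a (axis j (int k))"
    using assms axis1_a[of "axis 1 (int k)"] axis2_a[of "axis 2 (int k)"] n by auto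
  then have "a (axis j (int (Suc k)))
      = (real k + \<beta>) * (real k + 1 - 2 * \<beta>) * a (axis j (int k)) / ((real k + 1) * (real k + 2 * \<beta>))"
    using beta by (subst nonzero_eq_divide_eq) (auto simp: mult.commute add_eq_0_iff)
  then show ?thesis
    using beta poch_ratio_pos[of k] by (simp add: axis_ratio_def poch_ratio_Suc divide_simps add_eq_0_iff)
qed

lemma axis_a:
  assumes "j = 1 \<or> j = 2"
  shows "a (axis j (int i) + axis 1 (int k) + axis 2 (int k)) = axis_ratio j i * poch_ratio (i + k) * poch_ratio k"
proof (induction k)
  case 0
  then show ?case using poch_ratio_pos[of i] by (simp add: axis_ratio_def poch_ratio_def[of 0] axis_def zero_vec_def[symmetric])
next
  case (Suc k)
  define n where "n = axis j (int i) + axis 1 (int k) + axis 2 (int k)"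
  have n': "axis j (int i) + axis 1 (int (Suc k)) + axis 2 (int (Suc k)) = n + ev 1 + ev 2"
    by (simp add: vec3_eq_iff n_def)
  have "(real (i + k) + 1) * (real k + 1) * a (n + ev 1 + ev 2) = (real (i + k) + \<beta>) * (real k + \<beta>) * a n"
    using diag_a[of n] assms by (auto simp: n_def algebra_simps)
  then have "a (n + ev 1 + ev 2) = (real (i + k) + \<beta>) * (real k + \<beta>) * a n / ((real (i + k) + 1) * (real k + 1))"
    by (subst nonzero_eq_divide_eq) (auto simp: mult.commute add_eq_0_iff)
  then show ?case
    using Suc unfolding n' n_def[symmetric] by (simp add: poch_ratio_Suc)
qed

lemma slice_a_0: "subexp a 0"
  unfolding subexp_def
proof (intro allI impI)
  fix \<rho> :: real assume "\<rho> > 1"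
  \<comment> \<open>The three factors of \<open>axis_a\<close> contribute the exponent i + (i + k) +
    k of \<sigma>, at most twice n1 + n2 = i + 2 k; hence the square root.\<close>
  define \<sigma> where "\<sigma> = sqrt \<rho>"
  have \<sigma>: "\<sigma> > 1" "\<sigma> * \<sigma> = \<rho>" using \<open>\<rho> > 1\<close> by (auto simp: \<sigma>_def)
  have q: "(\<lambda>k. (real k + 1 - 2 * \<beta>) / (real k + 2 * \<beta>)) \<longlonglongrightarrow> 1"
    "(\<lambda>k. (real k + \<beta>) / (real k + 1)) \<longlonglongrightarrow> 1" by real_asymp+
  obtain C1 where C1: "C1 \<ge> 0" "\<And>k. \<bar>axis_ratio 1 k\<bar> \<le> C1 * \<sigma> ^ k"
    using ratio_subexponential[of "axis_ratio 1", OF axis_ratio_Suc q(1) \<sigma>(1)] by blast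
  obtain C2 where C2: "C2 \<ge> 0" "\<And>k. \<bar>axis_ratio 2 k\<bar> \<le> C2 * \<sigma> ^ k"
    using ratio_subexponential[of "axis_ratio 2", OF axis_ratio_Suc q(1) \<sigma>(1)] by blast
  obtain P where P: "P \<ge> 0" "\<And>k. \<bar>poch_ratio k\<bar> \<le> P * \<sigma> ^ k"
    using ratio_subexponential[of "poch_ratio", OF poch_ratio_Suc q(2) \<sigma>(1)] by blast
  define C where "C = max C1 C2"
  have C: "C \<ge> 0" "\<And>j k. j = 1 \<or> j = 2 \<Longrightarrow> \<bar>axis_ratio j k\<bar> \<le> C * \<sigma> ^ k"
  proof -
    fix j :: 3 and k assume j: "j = 1 \<or> j = 2"
    have "C1 * \<sigma> ^ k \<le> C * \<sigma> ^ k" "C2 * \<sigma> ^ k \<le> C * \<sigma> ^ k"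
      using \<sigma> by (auto simp: C_def intro!: mult_right_mono)
    with j C1(2)[of k] C2(2)[of k] show "\<bar>axis_ratio j k\<bar> \<le> C * \<sigma> ^ k" by auto
  qed (use C1 in \<open>simp add: C_def\<close>)
  have "\<bar>a n\<bar> \<le> C * P * P * \<rho> ^ (nat (n $ 1) + nat (n $ 2))" if "n $ 3 = 0" for n
  proof (cases "n $ 1 < 0 \<or> n $ 2 < 0")
    case True
    then show ?thesis using zero_a[of n] C P \<open>\<rho> > 1\<close> by auto
  next
    case False
    obtain j i k where j: "j = 1 \<or> j = 2" and n: "n = axis j (int i) + axis 1 (int k) + axis 2 (int k)"
    proof (cases "n $ 2 \<le> n $ 1")
      case True
      then show ?thesis using False \<open>n $ 3 = 0\<close>
        by (intro that[of 1 "nat (n $ 1 - n $ 2)" "nat (n $ 2)"]) (simp_all add: vec3_eq_iff)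
    next
      case F2: False
      then show ?thesis using False \<open>n $ 3 = 0\<close>
        by (intro that[of 2 "nat (n $ 2 - n $ 1)" "nat (n $ 1)"]) (simp_all add: vec3_eq_iff)
    qed
    have N: "nat (n $ 1) + nat (n $ 2) = i + 2 * k"
      using j by (auto simp: n)
    have "\<bar>a n\<bar> \<le> (C * \<sigma> ^ i) * (P * \<sigma> ^ (i + k)) * (P * \<sigma> ^ k)"
      unfolding n axis_a[OF j] abs_mult using C P \<sigma> j by (intro mult_mono) auto
    also have "\<dots> = C * P * P * (\<sigma> ^ (2 * i + 2 * k))"
      by (simp add: power_add[symmetric] algebra_simps flip: mult_2)
    also have "\<dots> \<le> C * P * P * (\<sigma> ^ (2 * (i + 2 * k)))"
      using C P \<sigma> by (intro mult_left_mono power_increasing) auto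
    also have "\<sigma> ^ (2 * (i + 2 * k)) = \<rho> ^ (i + 2 * k)"
      by (metis \<sigma>(2) power2_eq_square power_mult)
    finally show ?thesis by (simp add: N)
  qed
  then show "\<exists>C. \<forall>n. n $ 3 = 0 \<longrightarrow> \<bar>a n\<bar> \<le> C * \<rho> ^ (nat (n $ 1) + nat (n $ 2))" by blast
qed

lemma slice_b_if_a:
  assumes "subexp a k"
  shows "subexp b k"
proof (rule subexp_diagonal[OF _ suppb])
  show "subexp (\<lambda>n. - (of_int k + \<beta>) * (of_int (n $ 1) * a n + of_int (n $ 2) * a n + \<beta> * a n)) k"
    by (intro subexp_cmult subexp_add subexp_mult_index assms suppa) auto
  show "b n = b (n - ev 1 - ev 2) + - (of_int k + \<beta>) * (of_int (n $ 1) * a n + of_int (n $ 2) * a n + \<beta> * a n)"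
    if "n $ 3 = k" for n
    using J_sum[of n] that by (simp add: algebra_simps)
qed

text \<open>The first relation with l = 3 can be solved for the next plane because its leading
  factor (k + 1)(k + 2 \<beta>) is positive. \<open>slice_b_if_a\<close> then supplies B there, and
  the induction in \<open>slices\<close> continues.\<close>

lemma slice_a_Suc:
  assumes "subexp a (int k)" "subexp b (int k)"
  shows "subexp a (int (Suc k))"
proof -
  define d where "d n = b n - b (n - ev 1) - b (n - ev 2) + b (n - ev 1 - ev 2)" for n
  have "subexp d (int k)"
    unfolding d_def by (intro subexp_add subexp_diff subexp_shift12 assms
        subexp_shift12[where a = "\<lambda>n. b (n - ev 1)"] subexp_shift12[where a = "\<lambda>n. b (n - ev 2)"]) auto
  then have "subexp (\<lambda>n. inverse ((real k + 1) * (real k + 2 * \<beta>)) *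
      ((real k + \<beta>) * (real k + 1 - \<beta>) * a (n - ev 3) + d (n - ev 3))) (int (Suc k))"
    using assms by (intro subexp_cmult subexp_add subexp_shift3) auto
  also have "?this \<longleftrightarrow> ?thesis"
  proof (rule subexp_cong)
    fix n :: "int ^ 3" assume n: "n $ 3 = int (Suc k)"
    have "(real k + 1) * (real k + 2 * \<beta>) * a n = (real k + \<beta>) * (real k + 1 - \<beta>) * a (n - ev 3) + d (n - ev 3)"
      using eqL[OF perms(3), of "n - ev 3"] n by (simp add: d_def)
    moreover have "(real k + 1) * (real k + 2 * \<beta>) \<noteq> 0" using beta by auto
    ultimately show "inverse ((real k + 1) * (real k + 2 * \<beta>)) *
      ((real k + \<beta>) * (real k + 1 - \<beta>) * a (n - ev 3) + d (n - ev 3)) = a n"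
      by (metis mult.assoc left_inverse mult_1)
  qed
  finally show ?thesis .
qed

lemma slices: "subexp a k \<and> subexp b k"
proof (cases "k < 0")
  case True
  have "subexp (\<lambda>n. 0 :: real) k" by (auto simp: subexp_def intro!: exI[of _ 0])
  then show ?thesis
    using subexp_cong[of k a "\<lambda>n. 0"] subexp_cong[of k b "\<lambda>n. 0"] zero_a zero_b True by simp
next
  case False
  have "subexp a (int m)" for m
    by (induction m) (auto intro: slice_a_0 slice_b_if_a simp del: of_nat_Suc intro!: slice_a_Suc)
  from this[of "nat k"] show ?thesis using False slice_b_if_a by auto
qed

end

section \<open>Slice series\<close>

definition tame :: "(int ^ 3 \<Rightarrow> real) \<Rightarrow> bool" where
  "tame c \<longleftrightarrow> nonneg_supp c \<and> (\<forall>k. subexp c k)"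

text \<open>On coefficients, \<open>shift j\<close> is multiplication by r_j and
  \<open>euler j\<close> is the Euler operator r_j d/dr_j.\<close>

definition shift :: "3 \<Rightarrow> (int ^ 3 \<Rightarrow> real) \<Rightarrow> int ^ 3 \<Rightarrow> real" where
  "shift j c n = c (n - ev j)"

definition euler :: "3 \<Rightarrow> (int ^ 3 \<Rightarrow> real) \<Rightarrow> int ^ 3 \<Rightarrow> real" where
  "euler j c n = of_int (n $ j) * c n"

lemma tame_add: "tame c \<Longrightarrow> tame d \<Longrightarrow> tame (\<lambda>n. c n + d n)"
  by (auto simp: tame_def nonneg_supp_def intro: subexp_add)

lemma tame_diff: "tame c \<Longrightarrow> tame d \<Longrightarrow> tame (\<lambda>n. c n - d n)"
  by (auto simp: tame_def nonneg_supp_def intro: subexp_diff)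

lemma tame_cmult: "tame c \<Longrightarrow> tame (\<lambda>n. x * c n)"
  by (auto simp: tame_def nonneg_supp_def intro: subexp_cmult)

lemma tame_shift: "tame c \<Longrightarrow> tame (shift j c)"
  using exhaust_3[of j] nonneg_supp_shift[of c j]
  by (auto simp: tame_def shift_def[abs_def] intro: subexp_shift12 subexp_shift3)

lemma tame_euler:
  assumes "tame c"
  shows "tame (euler j c)"
proof -
  have "subexp (euler 3 c) k" for k
    using subexp_cmult[of c k "of_int k"] assms subexp_cong[of k "euler 3 c" "\<lambda>n. of_int k * c n"]
    by (simp add: tame_def euler_def)
  then show ?thesis
    using exhaust_3[of j] assms
    by (auto simp: tame_def euler_def[abs_def] nonneg_supp_def intro: subexp_mult_index)
qed

lemmas tame_intros = tame_add tame_diff tame_cmult tame_shift tame_euler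

definition slice_arr :: "(int ^ 3 \<Rightarrow> real) \<Rightarrow> int \<Rightarrow> int ^ 3 \<Rightarrow> complex" where
  "slice_arr c k n = (if n $ 3 = k then of_real (c n) else 0)"

text \<open>The third coordinate is set to 1, which removes the factor r3^k. A shift by e_3 then
  only lowers the slice number.\<close>

definition slice_sum :: "(int ^ 3 \<Rightarrow> real) \<Rightarrow> int \<Rightarrow> complex \<Rightarrow> complex \<Rightarrow> complex" where
  "slice_sum c k x y = (\<Sum>\<^sub>\<infinity>n. slice_arr c k n * arr_pow (vector [x, y, 1]) n)"

lemma geometric_has_sum: "norm x < 1 \<Longrightarrow> ((\<lambda>n. x ^ n) has_sum (1 / (1 - x))) UNIV"
  for x :: "'a :: {real_normed_field, banach}"
  by (intro norm_summable_imp_has_sum geometric_sums) (auto simp: norm_power intro: summable_geometric)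

lemma summable_on_times_nonneg:
  fixes f :: "'a \<Rightarrow> real" and g :: "'b \<Rightarrow> real"
  assumes "f summable_on A" "g summable_on B" "\<And>x. x \<in> A \<Longrightarrow> f x \<ge> 0" "\<And>y. y \<in> B \<Longrightarrow> g y \<ge> 0"
  shows "(\<lambda>(x, y). f x * g y) summable_on (A \<times> B)"
proof (rule summable_on_SigmaI)
  show "((\<lambda>y. case (x, y) of (x, y) \<Rightarrow> f x * g y) has_sum f x * infsum g B) B" for x
    using has_sum_cmult_right[OF has_sum_infsum[OF assms(2)], of "f x"] by simp
  show "(\<lambda>x. f x * infsum g B) summable_on A"
    using assms(1) by (rule summable_on_cmult_left)
qed (use assms in auto)

lemma slice_dominated:
  assumes "subexp c k" "nonneg_supp c" "0 \<le> R" "R < 1"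
  obtains M where "M summable_on UNIV"
    "\<And>x y n. norm x \<le> R \<Longrightarrow> norm y \<le> R \<Longrightarrow> norm (slice_arr c k n * arr_pow (vector [x, y, 1]) n) \<le> M n"
proof -
  \<comment> \<open>Any \<rho> > 1 with \<rho> R < 1 would serve; this one also covers R =
    0.\<close>
  define \<rho> where "\<rho> = 2 / (1 + R)"
  have \<rho>: "\<rho> > 1" "\<rho> * R < 1" using assms by (auto simp: \<rho>_def field_simps)
  obtain C where C: "C \<ge> 0" "\<And>n. n $ 3 = k \<Longrightarrow> \<bar>c n\<bar> \<le> C * \<rho> ^ (nat (n $ 1) + nat (n $ 2))"
    using slice_subE[OF assms(1) \<rho>(1)] by blast
  define h :: "nat \<times> nat \<Rightarrow> int ^ 3" where "h = (\<lambda>(i, j). vector [int i, int j, k])"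
  have inj: "inj h" by (auto simp: inj_def h_def vec3_eq_iff)
  define M where "M n = (if n \<in> range h then C * ((\<rho> * R) ^ nat (n $ 1) * (\<rho> * R) ^ nat (n $ 2)) else 0)" for n
  have g: "(\<lambda>i. (\<rho> * R) ^ i) summable_on UNIV"
    using geometric_has_sum[of "\<rho> * R"] \<rho> assms by (auto simp: summable_on_def)
  have "(\<lambda>p. C * (case p of (i, j) \<Rightarrow> (\<rho> * R) ^ i * (\<rho> * R) ^ j)) summable_on UNIV"
    using summable_on_times_nonneg[OF g g] \<rho> assms by (intro summable_on_cmult_right) simp
  also have "?this \<longleftrightarrow> (M \<circ> h) summable_on UNIV"
    by (intro summable_on_cong) (auto simp: M_def h_def)
  also have "\<dots> \<longleftrightarrow> M summable_on range h"
    using summable_on_reindex[OF inj, of M] by simp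
  also have "\<dots> \<longleftrightarrow> M summable_on UNIV"
    by (rule summable_on_cong_neutral) (auto simp: M_def)
  finally have "M summable_on UNIV" .
  moreover have "norm (slice_arr c k n * arr_pow (vector [x, y, 1]) n) \<le> M n" if xy: "norm x \<le> R" "norm y \<le> R" for x y n
  proof (cases "0 \<le> n $ 1 \<and> 0 \<le> n $ 2 \<and> n $ 3 = k")
    case True
    then have n: "n = h (nat (n $ 1), nat (n $ 2))" by (simp add: h_def vec3_eq_iff)
    have "norm (arr_pow (vector [x, y, 1]) n) \<le> R ^ nat (n $ 1) * R ^ nat (n $ 2)"
      using xy assms(3) by (auto simp: arr_pow_def mpow_3 norm_mult norm_power intro!: mult_mono power_mono)
    moreover have "norm (slice_arr c k n) \<le> C * \<rho> ^ (nat (n $ 1) + nat (n $ 2))"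
      using C(2)[of n] True by (simp add: slice_arr_def)
    ultimately have "norm (slice_arr c k n * arr_pow (vector [x, y, 1]) n)
        \<le> (C * \<rho> ^ (nat (n $ 1) + nat (n $ 2))) * (R ^ nat (n $ 1) * R ^ nat (n $ 2))"
      unfolding norm_mult using C \<rho> by (intro mult_mono) auto
    also have "\<dots> = M n"
      using range_eqI[of n h, OF n] by (simp add: M_def power_mult_distrib power_add)
    finally show ?thesis .
  next
    case False
    then have "n $ 1 < 0 \<or> n $ 2 < 0 \<or> n $ 3 \<noteq> k" by linarith
    then have "slice_arr c k n = 0" using assms(2) unfolding slice_arr_def nonneg_supp_def by (metis of_real_0)
    moreover have "M n \<ge> 0" using C \<rho> assms by (auto simp: M_def)
    ultimately show ?thesis by simp
  qed
  ultimately show ?thesis by (rule that)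
qed

lemma slice_sum_zser:
  assumes "tame c" "norm x < 1" "norm y < 1"
  shows "arr_series (slice_arr c k) (vector [x, y, 1]) (slice_sum c k x y)"
proof -
  define R where "R = max (norm x) (norm y)"
  have R: "0 \<le> R" "R < 1" "norm x \<le> R" "norm y \<le> R" using assms by (auto simp: R_def le_max_iff_disj)
  have "subexp c k" "nonneg_supp c" using assms(1) by (auto simp: tame_def)
  from slice_dominated[OF this R(1,2)] obtain M where "M summable_on UNIV"
    "\<And>n. norm (slice_arr c k n * arr_pow (vector [x, y, 1]) n) \<le> M n"
    using R(3,4) by metis
  then have "(\<lambda>n. norm (slice_arr c k n * arr_pow (vector [x, y, 1]) n)) summable_on UNIV"
    by (rule Infinite_Sum.abs_summable_on_comparison_test')
  then show ?thesis
    unfolding arr_series_def slice_sum_def by (intro has_sum_infsum) (rule abs_summable_summable)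
qed

lemma nonneg_supp_slc: "tame c \<Longrightarrow> nonneg_supp (slice_arr c k)"
  by (auto simp: tame_def nonneg_supp_def slice_arr_def)

text \<open>The list contains \<open>euler 3\<close> but neither \<open>euler 1\<close> nor
  \<open>euler 2\<close>: these produce new tame arrays whose slice sums enter the recurrences as
  separate unknowns, so no function of x and y has to be differentiated there.\<close>

lemma slice_arr_ops:
  "slice_arr (\<lambda>n. c n + d n) k = (\<lambda>n. slice_arr c k n + slice_arr d k n)"
  "slice_arr (\<lambda>n. c n - d n) k = (\<lambda>n. slice_arr c k n - slice_arr d k n)"
  "slice_arr (\<lambda>n. r * c n) k = (\<lambda>n. of_real r * slice_arr c k n)"
  "slice_arr (euler 3 c) k = (\<lambda>n. of_int k * slice_arr c k n)"
  "slice_arr (shift 1 c) k = (\<lambda>n. slice_arr c k (n - ev 1))"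
  "slice_arr (shift 2 c) k = (\<lambda>n. slice_arr c k (n - ev 2))"
  "slice_arr (shift 3 c) k = (\<lambda>n. slice_arr c (k - 1) (n - ev 3))"
  by (auto simp: slice_arr_def euler_def shift_def)

context
  fixes x y :: complex
  assumes xy: "norm x < 1" "norm y < 1"
begin

lemma slice_sum_add: "tame c \<Longrightarrow> tame d \<Longrightarrow> slice_sum (\<lambda>n. c n + d n) k x y = slice_sum c k x y + slice_sum d k x y"
  by (rule arr_series_unique[OF slice_sum_zser[OF tame_add xy]])
     (simp_all add: slice_arr_ops arr_series_add slice_sum_zser xy)

lemma slice_sum_diff: "tame c \<Longrightarrow> tame d \<Longrightarrow> slice_sum (\<lambda>n. c n - d n) k x y = slice_sum c k x y - slice_sum d k x y"
  by (rule arr_series_unique[OF slice_sum_zser[OF tame_diff xy]])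
     (simp_all add: slice_arr_ops arr_series_diff slice_sum_zser xy)

lemma slice_sum_cmult: "tame c \<Longrightarrow> slice_sum (\<lambda>n. r * c n) k x y = of_real r * slice_sum c k x y"
  by (rule arr_series_unique[OF slice_sum_zser[OF tame_cmult xy]])
     (simp_all add: slice_arr_ops arr_series_cmult slice_sum_zser xy)

lemma slice_sum_euler3: "tame c \<Longrightarrow> slice_sum (euler 3 c) k x y = of_int k * slice_sum c k x y"
  by (rule arr_series_unique[OF slice_sum_zser[OF tame_euler xy]])
     (simp_all add: slice_arr_ops arr_series_cmult slice_sum_zser xy)

lemma slice_sum_shift1: "tame c \<Longrightarrow> slice_sum (shift 1 c) k x y = x * slice_sum c k x y"
  using arr_series_shift[OF nonneg_supp_slc slice_sum_zser[OF _ xy], of c k 1]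
  by (intro arr_series_unique[OF slice_sum_zser[OF tame_shift xy]]) (simp_all add: slice_arr_ops)

lemma slice_sum_shift2: "tame c \<Longrightarrow> slice_sum (shift 2 c) k x y = y * slice_sum c k x y"
  using arr_series_shift[OF nonneg_supp_slc slice_sum_zser[OF _ xy], of c k 2]
  by (intro arr_series_unique[OF slice_sum_zser[OF tame_shift xy]]) (simp_all add: slice_arr_ops)

lemma slice_sum_shift3: "tame c \<Longrightarrow> slice_sum (shift 3 c) k x y = slice_sum c (k - 1) x y"
  using arr_series_shift[OF nonneg_supp_slc slice_sum_zser[OF _ xy], of c "k - 1" 3]
  by (intro arr_series_unique[OF slice_sum_zser[OF tame_shift xy]]) (simp_all add: slice_arr_ops)

lemmas slice_sum_simps = slice_sum_add slice_sum_diff slice_sum_cmult slice_sum_euler3 slice_sum_shift1 slice_sum_shift2 slice_sum_shift3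

end

section \<open>The relations as identities between slice sums\<close>

context neighbor
begin

lemma tame_a: "tame a" and tame_b: "tame b"
  using suppa suppb slices by (auto simp: tame_def)

lemma rec_J_diff:
  assumes "norm x < 1" "norm y < 1"
  shows "of_int k * (slice_sum (euler 1 a) k x y - slice_sum (euler 2 a) k x y) = (y - x) * slice_sum b (k - 1) x y"
proof -
  have "(\<lambda>n. euler 3 (euler 1 a) n - euler 3 (euler 2 a) n) = (\<lambda>n. shift 2 (shift 3 b) n - shift 1 (shift 3 b) n)"
    using J_diff by (auto simp: euler_def shift_def algebra_simps)
  from arg_cong[OF this, of "\<lambda>c. slice_sum c k x y"] show ?thesis
    by (simp add: slice_sum_simps assms tame_intros tame_a tame_b algebra_simps)
qed

lemma rec_J_sum:
  assumes "norm x < 1" "norm y < 1"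
  shows "(1 - x * y) * slice_sum b k x y =
    - (of_int k + of_real \<beta>) * (slice_sum (euler 1 a) k x y + slice_sum (euler 2 a) k x y + of_real \<beta> * slice_sum a k x y)"
proof -
  have "(\<lambda>n. euler 3 (euler 1 a) n + euler 3 (euler 2 a) n + \<beta> * euler 3 a n + \<beta> * euler 1 a n + \<beta> * euler 2 a n + \<beta> * (\<beta> * a n))
      = (\<lambda>n. shift 2 (shift 1 b) n - b n)"
    using J_sum by (auto simp: euler_def shift_def algebra_simps)
  from arg_cong[OF this, of "\<lambda>c. slice_sum c k x y"] show ?thesis
    by (simp add: slice_sum_simps assms tame_intros tame_a tame_b algebra_simps)
qed

text \<open>The first relation with l = 1 is taken at n - e_1, that is, multiplied by r1. It then
  involves only Euler operators and can be solved for the second-order one in the first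
  variable.\<close>

lemma rec_L1:
  assumes "norm x < 1" "norm y < 1"
  shows "(1 - x) * slice_sum (euler 1 (euler 1 a)) k x y = (1 - 2 * of_real \<beta> + x) * slice_sum (euler 1 a) k x y
     + x * of_real \<beta> * (1 - of_real \<beta>) * slice_sum a k x y + x * (1 - y) * (slice_sum b k x y - slice_sum b (k - 1) x y)"
proof -
  have "euler 1 (euler 1 a) n + (2 * \<beta> - 1) * euler 1 a n - (shift 1 (euler 1 (euler 1 a)) n + shift 1 (euler 1 a) n + (\<beta> * (1 - \<beta>)) * shift 1 a n)
      = shift 1 b n - shift 2 (shift 1 b) n - shift 3 (shift 1 b) n + shift 3 (shift 2 (shift 1 b)) n" for n
    using eqL[OF perms(1), of "n - ev 1"] by (simp add: euler_def shift_def algebra_simps)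
  then have "(\<lambda>n. euler 1 (euler 1 a) n + (2 * \<beta> - 1) * euler 1 a n - (shift 1 (euler 1 (euler 1 a)) n + shift 1 (euler 1 a) n + (\<beta> * (1 - \<beta>)) * shift 1 a n))
      = (\<lambda>n. shift 1 b n - shift 2 (shift 1 b) n - shift 3 (shift 1 b) n + shift 3 (shift 2 (shift 1 b)) n)" by blast
  from arg_cong[OF this, of "\<lambda>c. slice_sum c k x y"] show ?thesis
    by (simp add: slice_sum_simps assms tame_intros tame_a tame_b algebra_simps)
qed

lemma rec_L2:
  assumes "norm x < 1" "norm y < 1"
  shows "(1 - y) * slice_sum (euler 2 (euler 2 a)) k x y = (1 - 2 * of_real \<beta> + y) * slice_sum (euler 2 a) k x y
     + y * of_real \<beta> * (1 - of_real \<beta>) * slice_sum a k x y + y * (1 - x) * (slice_sum b k x y - slice_sum b (k - 1) x y)"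
proof -
  have "euler 2 (euler 2 a) n + (2 * \<beta> - 1) * euler 2 a n - (shift 2 (euler 2 (euler 2 a)) n + shift 2 (euler 2 a) n + (\<beta> * (1 - \<beta>)) * shift 2 a n)
      = shift 2 b n - shift 1 (shift 2 b) n - shift 3 (shift 2 b) n + shift 3 (shift 1 (shift 2 b)) n" for n
    using eqL[OF perms(2), of "n - ev 2"] by (simp add: euler_def shift_def algebra_simps)
  then have "(\<lambda>n. euler 2 (euler 2 a) n + (2 * \<beta> - 1) * euler 2 a n - (shift 2 (euler 2 (euler 2 a)) n + shift 2 (euler 2 a) n + (\<beta> * (1 - \<beta>)) * shift 2 a n))
      = (\<lambda>n. shift 2 b n - shift 1 (shift 2 b) n - shift 3 (shift 2 b) n + shift 3 (shift 1 (shift 2 b)) n)" by blast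
  from arg_cong[OF this, of "\<lambda>c. slice_sum c k x y"] show ?thesis
    by (simp add: slice_sum_simps assms tame_intros tame_a tame_b algebra_simps)
qed

lemma rec_J12:
  assumes "norm x < 1" "norm y < 1"
  shows "2 * slice_sum (euler 1 (euler 2 a)) k x y =
     - of_real \<beta> * (slice_sum (euler 1 a) k x y + slice_sum (euler 2 a) k x y + (of_int k + of_real \<beta>) * slice_sum a k x y)
     + (x + y) * slice_sum b (k - 1) x y - (1 + x * y) * slice_sum b k x y"
proof -
  have "2 * euler 1 (euler 2 a) n + \<beta> * euler 1 a n + \<beta> * euler 2 a n + \<beta> * euler 3 a n + \<beta> * (\<beta> * a n)
      = shift 1 (shift 3 b) n + shift 2 (shift 3 b) n - b n - shift 2 (shift 1 b) n" for n
    using eqJ[OF perms(3), of n] by (simp add: euler_def shift_def algebra_simps power2_eq_square)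
  then have "(\<lambda>n. 2 * euler 1 (euler 2 a) n + \<beta> * euler 1 a n + \<beta> * euler 2 a n + \<beta> * euler 3 a n + \<beta> * (\<beta> * a n))
      = (\<lambda>n. shift 1 (shift 3 b) n + shift 2 (shift 3 b) n - b n - shift 2 (shift 1 b) n)" by blast
  from arg_cong[OF this, of "\<lambda>c. slice_sum c k x y"] show ?thesis
    by (simp add: slice_sum_simps assms tame_intros tame_a tame_b algebra_simps)
qed

text \<open>This is D1 + D2 applied to \<open>rec_J_sum\<close>, carried out on coefficients as
  multiplication by n1 + n2. The term 2 x y b arises because D1 + D2 maps x y to 2 x y. It supplies
  the derivative of the B-slice that \<open>rec_Euler_L3\<close> needs.\<close>

lemma rec_Euler_J:
  assumes "norm x < 1" "norm y < 1"
  shows "(1 - x * y) * (slice_sum (euler 1 b) k x y + slice_sum (euler 2 b) k x y) = 2 * x * y * slice_sum b k x y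
     - (of_int k + of_real \<beta>) * (slice_sum (euler 1 (euler 1 a)) k x y + 2 * slice_sum (euler 1 (euler 2 a)) k x y + slice_sum (euler 2 (euler 2 a)) k x y
         + of_real \<beta> * (slice_sum (euler 1 a) k x y + slice_sum (euler 2 a) k x y))"
proof -
  define q where "q n = euler 1 (euler 1 a) n + 2 * euler 1 (euler 2 a) n + euler 2 (euler 2 a) n + \<beta> * euler 1 a n + \<beta> * euler 2 a n" for n
  have tq: "tame q" unfolding q_def[abs_def] by (intro tame_intros tame_a)
  have "euler 3 q n + \<beta> * q n = shift 1 (shift 2 (euler 1 b)) n + shift 1 (shift 2 (euler 2 b)) n + 2 * shift 1 (shift 2 b) n - (euler 1 b n + euler 2 b n)" for n
  proof -
    have "euler 3 q n + \<beta> * q n = (of_int (n $ 1) + of_int (n $ 2)) *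
        ((of_int (n $ 3) + \<beta>) * (of_int (n $ 1) + of_int (n $ 2) + \<beta>) * a n)"
      by (simp add: q_def euler_def algebra_simps)
    also have "\<dots> = shift 1 (shift 2 (euler 1 b)) n + shift 1 (shift 2 (euler 2 b)) n + 2 * shift 1 (shift 2 b) n - (euler 1 b n + euler 2 b n)"
      unfolding J_sum by (simp add: euler_def shift_def algebra_simps)
    finally show ?thesis .
  qed
  then have "(\<lambda>n. euler 3 q n + \<beta> * q n) =
      (\<lambda>n. shift 1 (shift 2 (euler 1 b)) n + shift 1 (shift 2 (euler 2 b)) n + 2 * shift 1 (shift 2 b) n - (euler 1 b n + euler 2 b n))" by blast
  from arg_cong[OF this, of "\<lambda>c. slice_sum c k x y"]
  have "of_int k * slice_sum q k x y + of_real \<beta> * slice_sum q k x y = x * (y * slice_sum (euler 1 b) k x y) + x * (y * slice_sum (euler 2 b) k x y)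
      + 2 * (x * (y * slice_sum b k x y)) - (slice_sum (euler 1 b) k x y + slice_sum (euler 2 b) k x y)"
    by (simp add: slice_sum_simps assms tame_intros tame_a tame_b tq)
  moreover have "slice_sum q k x y = slice_sum (euler 1 (euler 1 a)) k x y + 2 * slice_sum (euler 1 (euler 2 a)) k x y + slice_sum (euler 2 (euler 2 a)) k x y
         + of_real \<beta> * (slice_sum (euler 1 a) k x y + slice_sum (euler 2 a) k x y)"
    unfolding q_def[abs_def] by (simp add: slice_sum_simps assms tame_intros tame_a tame_b algebra_simps)
  ultimately show ?thesis by (simp add: algebra_simps)
qed

lemma L3_shifted:
  "of_int (n $ 3) * (of_int (n $ 3) - 1 + 2 * \<beta>) * a n =
     shift 3 (euler 3 (euler 3 a)) n + shift 3 (euler 3 a) n + (\<beta> * (1 - \<beta>)) * shift 3 a n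
     + shift 3 b n - shift 1 (shift 3 b) n - shift 2 (shift 3 b) n + shift 2 (shift 1 (shift 3 b)) n"
proof -
  have "n - ev 3 - ev 1 = n - ev 1 - ev 3" "n - ev 3 - ev 2 = n - ev 2 - ev 3"
    "n - ev 3 - ev 1 - ev 2 = n - ev 2 - ev 1 - ev 3" by simp_all
  then show ?thesis
    using eqL[OF perms(3), of "n - ev 3"] by (simp add: euler_def shift_def algebra_simps)
qed

lemma rec_L3:
  assumes "norm x < 1" "norm y < 1"
  shows "(of_int k + 1) * (of_int k + 2 * of_real \<beta>) * slice_sum a (k + 1) x y =
     (of_int k + of_real \<beta>) * (of_int k + 1 - of_real \<beta>) * slice_sum a k x y + (1 - x) * (1 - y) * slice_sum b k x y"
proof -
  have "(\<lambda>n. euler 3 (euler 3 a) n + (2 * \<beta> - 1) * euler 3 a n) =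
     (\<lambda>n. shift 3 (euler 3 (euler 3 a)) n + shift 3 (euler 3 a) n + (\<beta> * (1 - \<beta>)) * shift 3 a n
     + shift 3 b n - shift 1 (shift 3 b) n - shift 2 (shift 3 b) n + shift 2 (shift 1 (shift 3 b)) n)"
    unfolding L3_shifted[symmetric] by (simp add: euler_def algebra_simps)
  from arg_cong[OF this, of "\<lambda>c. slice_sum c (k + 1) x y"] show ?thesis
    by (simp add: slice_sum_simps assms tame_intros tame_a tame_b algebra_simps)
qed

text \<open>This is D1 + D2 applied to \<open>rec_L3\<close>; the last term is the derivative of the
  factor (1 - x)(1 - y). It yields the first-order derivative of the next A-slice, from which
  \<open>rec_J_sum\<close> gives the next B-slice.\<close>

lemma rec_Euler_L3:
  assumes "norm x < 1" "norm y < 1"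
  shows "(of_int k + 1) * (of_int k + 2 * of_real \<beta>) * (slice_sum (euler 1 a) (k + 1) x y + slice_sum (euler 2 a) (k + 1) x y) =
     (of_int k + of_real \<beta>) * (of_int k + 1 - of_real \<beta>) * (slice_sum (euler 1 a) k x y + slice_sum (euler 2 a) k x y)
     + (1 - x) * (1 - y) * (slice_sum (euler 1 b) k x y + slice_sum (euler 2 b) k x y) - (x + y - 2 * x * y) * slice_sum b k x y"
proof -
  define p where "p n = euler 1 a n + euler 2 a n" for n
  define s where "s n = euler 1 b n + euler 2 b n" for n
  have t: "tame p" "tame s" unfolding p_def[abs_def] s_def[abs_def] by (intro tame_intros tame_a tame_b)+
  have "euler 3 (euler 3 p) n + (2 * \<beta> - 1) * euler 3 p n =
     shift 3 (euler 3 (euler 3 p)) n + shift 3 (euler 3 p) n + (\<beta> * (1 - \<beta>)) * shift 3 p n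
     + shift 3 s n - (shift 1 (shift 3 s) n + shift 1 (shift 3 b) n) - (shift 2 (shift 3 s) n + shift 2 (shift 3 b) n)
     + (shift 2 (shift 1 (shift 3 s)) n + 2 * shift 2 (shift 1 (shift 3 b)) n)" for n
  proof -
    have "euler 3 (euler 3 p) n + (2 * \<beta> - 1) * euler 3 p n = (of_int (n $ 1) + of_int (n $ 2)) *
        (of_int (n $ 3) * (of_int (n $ 3) - 1 + 2 * \<beta>) * a n)"
      by (simp add: p_def euler_def algebra_simps)
    then show ?thesis
      unfolding L3_shifted by (simp add: p_def s_def euler_def shift_def algebra_simps)
  qed
  then have "(\<lambda>n. euler 3 (euler 3 p) n + (2 * \<beta> - 1) * euler 3 p n) =
     (\<lambda>n. shift 3 (euler 3 (euler 3 p)) n + shift 3 (euler 3 p) n + (\<beta> * (1 - \<beta>)) * shift 3 p n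
     + shift 3 s n - (shift 1 (shift 3 s) n + shift 1 (shift 3 b) n) - (shift 2 (shift 3 s) n + shift 2 (shift 3 b) n)
     + (shift 2 (shift 1 (shift 3 s)) n + 2 * shift 2 (shift 1 (shift 3 b)) n))" by blast
  from arg_cong[OF this, of "\<lambda>c. slice_sum c (k + 1) x y"]
  have "(of_int k + 1) * (of_int k + 2 * of_real \<beta>) * slice_sum p (k + 1) x y =
     (of_int k + of_real \<beta>) * (of_int k + 1 - of_real \<beta>) * slice_sum p k x y
     + (1 - x) * (1 - y) * slice_sum s k x y - (x + y - 2 * x * y) * slice_sum b k x y"
    by (simp add: slice_sum_simps assms tame_intros tame_b t algebra_simps)
  moreover have "slice_sum p k x y = slice_sum (euler 1 a) k x y + slice_sum (euler 2 a) k x y" "slice_sum s k x y = slice_sum (euler 1 b) k x y + slice_sum (euler 2 b) k x y" for k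
    unfolding p_def[abs_def] s_def[abs_def] by (simp_all add: slice_sum_simps assms tame_intros tame_a tame_b)
  ultimately show ?thesis by simp
qed

end

section \<open>The lens domain and linear recurrences\<close>

text \<open>For r = x^2 the square root is 2 |Im x|, whichever root x is taken
  (\<open>margin_square\<close>), so the formula is continuous on all of C without a branch cut.
  Positivity means that x lies in both discs of radius sqrt 2 about i and -i, whose intersection is
  a lens with corners 1 and -1.\<close>

definition margin :: "complex \<Rightarrow> real" where
  "margin r = 1 - cmod r - sqrt (2 * (cmod r - Re r))"

lemma margin_square: "margin (x\<^sup>2) = 1 - (cmod x)\<^sup>2 - 2 * \<bar>Im x\<bar>"
proof -
  have "2 * ((cmod x)\<^sup>2 - Re (x\<^sup>2)) = (2 * \<bar>Im x\<bar>)\<^sup>2"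
    by (simp add: cmod_power2 Re_power2 power_mult_distrib)
  from arg_cong[OF this, of sqrt] have "sqrt (2 * ((cmod x)\<^sup>2 - Re (x\<^sup>2))) = 2 * \<bar>Im x\<bar>"
    unfolding real_sqrt_abs by simp
  then show ?thesis by (simp add: margin_def norm_power)
qed

lemma margin_le: "margin r \<le> 1 - cmod r"
  using complex_Re_le_cmod[of r] by (simp add: margin_def)

lemma continuous_margin [continuous_intros]: "continuous_on S margin"
  unfolding margin_def[abs_def] by (intro continuous_intros)

lemma margin_scale: "0 \<le> s \<Longrightarrow> s \<le> 1 \<Longrightarrow> margin r \<le> margin (of_real s * r)"
proof -
  assume s: "0 \<le> s" "s \<le> 1"
  have "cmod (of_real s * r) \<le> cmod r"
    using s mult_right_mono[of s 1 "cmod r"] by (simp add: norm_mult)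
  moreover have "s * (cmod r - Re r) \<le> 1 * (cmod r - Re r)"
    using s complex_Re_le_cmod[of r] by (intro mult_right_mono) auto
  then have "sqrt (2 * (cmod (of_real s * r) - Re (of_real s * r))) \<le> sqrt (2 * (cmod r - Re r))"
    using s by (intro real_sqrt_le_mono) (simp add: norm_mult algebra_simps)
  ultimately show ?thesis unfolding margin_def by linarith
qed

lemma margin_of_real: "0 \<le> t \<Longrightarrow> margin (of_real t) = 1 - t"
  by (simp add: margin_def)

text \<open>The radius 1/8 exceeds 1/10, which leaves room for the Cauchy estimates in
  \<open>slices_sum_series\<close>. The value follows from 2 (|r| - Re r) \<le> 4 |r| \<le> 1/2 <
  9/16 and 1 - 1/8 - 3/4 = 1/8.\<close>

lemma margin_small: "cmod r \<le> 1 / 8 \<Longrightarrow> margin r \<ge> 1 / 8"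
proof -
  assume r: "cmod r \<le> 1 / 8"
  have "2 * (cmod r - Re r) \<le> (3 / 4)\<^sup>2"
    using r abs_Re_le_cmod[of r] by (simp add: power2_eq_square)
  then have "sqrt (2 * (cmod r - Re r)) \<le> 3 / 4"
    using real_sqrt_le_mono by fastforce
  then show ?thesis using r by (simp add: margin_def)
qed

text \<open>
  With x = tanh u and y = tanh v the quotient below is tanh (u + v), and positivity of the margin of
  the square of tanh u says that \<open>\<bar>Im u\<bar> < \<pi> / 8\<close>; on the strip \<open>\<bar>Im\<bar> < \<pi> / 4\<close> the modulus of tanh is
  less than 1.
\<close>

lemma tanh_sum_bound:
  assumes "0 < \<delta>" "\<delta> \<le> margin (x\<^sup>2)" "\<delta> \<le> margin (y\<^sup>2)"
  shows "1 + x * y \<noteq> 0" "cmod (((x + y) / (1 + x * y))\<^sup>2) \<le> 1 - \<delta>\<^sup>2 / 4"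
proof -
  have m: "1 - (cmod x)\<^sup>2 \<ge> \<delta> + 2 * \<bar>Im x\<bar>" "1 - (cmod y)\<^sup>2 \<ge> \<delta> + 2 * \<bar>Im y\<bar>"
    using assms by (auto simp: margin_square)
  \<comment> \<open>For real x and y the last term is absent. In general it is at most the product
    of 2 |Im x| and 2 |Im y|, which the two margins hold in reserve.\<close>
  have id: "(cmod (1 + x * y))\<^sup>2 - (cmod (x + y))\<^sup>2 = (1 - (cmod x)\<^sup>2) * (1 - (cmod y)\<^sup>2) - 4 * Im x * Im y"
    unfolding cmod_power2 by (simp add: algebra_simps power2_eq_square)
  have "\<delta>\<^sup>2 + 4 * \<bar>Im x\<bar> * \<bar>Im y\<bar> \<le> (\<delta> + 2 * \<bar>Im x\<bar>) * (\<delta> + 2 * \<bar>Im y\<bar>)"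
    using assms(1) by (simp add: algebra_simps power2_eq_square)
  also have "\<dots> \<le> (1 - (cmod x)\<^sup>2) * (1 - (cmod y)\<^sup>2)"
    using m assms(1) by (intro mult_mono) auto
  finally have "\<delta>\<^sup>2 + 4 * \<bar>Im x * Im y\<bar> \<le> (1 - (cmod x)\<^sup>2) * (1 - (cmod y)\<^sup>2)"
    by (simp add: abs_mult)
  then have diff: "\<delta>\<^sup>2 \<le> (cmod (1 + x * y))\<^sup>2 - (cmod (x + y))\<^sup>2"
    unfolding id using abs_ge_self[of "Im x * Im y"] by simp
  have pos: "(cmod (1 + x * y))\<^sup>2 > 0"
    using diff assms(1) zero_le_power2[of "cmod (x + y)"] zero_less_power[of \<delta> 2] by linarith
  then show "1 + x * y \<noteq> 0" by auto
  have "(cmod x)\<^sup>2 \<le> 1\<^sup>2" "(cmod y)\<^sup>2 \<le> 1\<^sup>2" using m assms(1) by auto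
  then have "cmod x \<le> 1" "cmod y \<le> 1" using power2_le_imp_le[of _ 1] by auto
  \<comment> \<open>Dividing the gap \<delta>^2 by |1 + x y|^2 \<le> 4 is the source of the constant
    \<delta>^2 / 4.\<close>
  then have "cmod (1 + x * y) \<le> 1 + 1 * 1"
    using norm_triangle_ineq[of 1 "x * y"] mult_mono[of "cmod x" 1 "cmod y" 1] by (simp add: norm_mult)
  then have "(cmod (1 + x * y))\<^sup>2 \<le> 2\<^sup>2" by (intro power_mono) auto
  then have le4: "(cmod (1 + x * y))\<^sup>2 \<le> 4" by simp
  have "\<delta>\<^sup>2 / 4 * (cmod (1 + x * y))\<^sup>2 \<le> \<delta>\<^sup>2 / 4 * 4"
    using le4 by (intro mult_left_mono) auto
  then have "(cmod (x + y))\<^sup>2 \<le> (1 - \<delta>\<^sup>2 / 4) * (cmod (1 + x * y))\<^sup>2"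
    using diff by (simp add: algebra_simps)
  then show "cmod (((x + y) / (1 + x * y))\<^sup>2) \<le> 1 - \<delta>\<^sup>2 / 4"
    using pos by (simp add: norm_power norm_divide power_divide pos_divide_le_eq)
qed

text \<open>The limit recurrence has the roots 1, t1, t2. The combination h_n = V_n - t1 V_{n-1}
  obeys h_{n+1} = t2 h_n up to the error, and the weighted norm |F_n| + \<kappa> |V_{n-1}| + \<mu>
  |h_n| does not increase under the limit recurrence. The weights depend only on q and \<gamma>, so
  the bound is uniform in p and survives t1 = t2, where a diagonalisation would break down. The
  perturbation costs a factor 1 + \<epsilon> per step.\<close>

lemma linear_recurrence_growth:
  fixes F V :: "nat \<Rightarrow> 'p \<Rightarrow> complex" and c t1 t2 :: "'p \<Rightarrow> complex"
  assumes q: "0 \<le> q" "q < 1" and \<gamma>: "0 \<le> \<gamma>"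
    and bds: "\<And>p. p \<in> K \<Longrightarrow> cmod (t1 p) \<le> q \<and> cmod (t2 p) \<le> q \<and> cmod (c p) \<le> \<gamma>"
    and rec: "\<And>\<epsilon>. \<epsilon> > 0 \<Longrightarrow> \<exists>n0\<ge>1. \<forall>n\<ge>n0. \<forall>p\<in>K.
      cmod (F (Suc n) p - (F n p + c p * V n p)) \<le> \<epsilon> * (cmod (F n p) + cmod (V n p) + cmod (V (n - 1) p)) \<and>
      cmod (V (Suc n) p - ((t1 p + t2 p) * V n p - t1 p * t2 p * V (n - 1) p))
        \<le> \<epsilon> * (cmod (F n p) + cmod (V n p) + cmod (V (n - 1) p))"
    and bd0: "\<And>n. \<exists>C. \<forall>p\<in>K. cmod (F n p) \<le> C \<and> cmod (V n p) \<le> C"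
    and \<epsilon>: "\<epsilon> > 0"
  shows "\<exists>C\<ge>0. \<forall>n. \<forall>p\<in>K. cmod (F n p) \<le> C * (1 + \<epsilon>) ^ n \<and> cmod (V n p) \<le> C * (1 + \<epsilon>) ^ n"
proof -
  \<comment> \<open>After |V_n| \<le> |h_n| + q |V_{n-1}|, one limit step replaces the weights
    \<kappa> and \<mu> by (\<gamma> + \<kappa>) q and \<gamma> + \<kappa> + \<mu> q. The definitions
    make these at most \<kappa> and \<mu>, with slack 1 - q, and keep both weights at least
    1.\<close>
  define \<kappa> where "\<kappa> = 1 + \<gamma> * q / (1 - q)"
  define \<mu> where "\<mu> = 1 + (\<gamma> + \<kappa>) / (1 - q)"
  have "\<kappa> * (1 - q) = (1 - q) + \<gamma> * q" "\<mu> * (1 - q) = (1 - q) + (\<gamma> + \<kappa>)"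
    using q unfolding \<kappa>_def \<mu>_def distrib_right[of 1] by simp_all
  moreover have "\<kappa> \<ge> 1" using q \<gamma> by (simp add: \<kappa>_def)
  moreover have "\<mu> \<ge> 1" using q \<gamma> \<open>\<kappa> \<ge> 1\<close> by (simp add: \<mu>_def)
  ultimately have \<kappa>: "\<kappa> \<ge> 1" "(\<gamma> + \<kappa>) * q \<le> \<kappa>" and \<mu>: "\<mu> \<ge> 1" "\<gamma> + \<kappa> + \<mu> * q \<le> \<mu>"
    using q by (simp_all add: algebra_simps)
  \<comment> \<open>Both errors enter the new norm, with total weight 1 + \<mu>, and the sum of
    moduli that they are proportional to is at most twice the old norm.\<close>
  define \<epsilon>' where "\<epsilon>' = \<epsilon> / (2 * (1 + \<mu>))"
  have \<epsilon>': "\<epsilon>' > 0" "2 * (1 + \<mu>) * \<epsilon>' = \<epsilon>" using \<epsilon> \<mu> by (auto simp: \<epsilon>'_def field_simps)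
  obtain n0 where n0: "n0 \<ge> 1" and step: "\<And>n p. n \<ge> n0 \<Longrightarrow> p \<in> K \<Longrightarrow>
      cmod (F (Suc n) p - (F n p + c p * V n p)) \<le> \<epsilon>' * (cmod (F n p) + cmod (V n p) + cmod (V (n - 1) p)) \<and>
      cmod (V (Suc n) p - ((t1 p + t2 p) * V n p - t1 p * t2 p * V (n - 1) p))
        \<le> \<epsilon>' * (cmod (F n p) + cmod (V n p) + cmod (V (n - 1) p))"
    using rec[OF \<epsilon>'(1)] by blast
  define h where "h n p = V n p - t1 p * V (n - 1) p" for n p
  define N where "N n p = cmod (F n p) + \<kappa> * cmod (V (n - 1) p) + \<mu> * cmod (h n p)" for n p
  have Nstep: "N (Suc n) p \<le> (1 + \<epsilon>) * N n p" if n: "n \<ge> n0" and p: "p \<in> K" for n p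
  proof -
    define e where "e = \<epsilon>' * (cmod (F n p) + cmod (V n p) + cmod (V (n - 1) p))"
    define A where "A = cmod (F n p)"
    define W where "W = cmod (V (n - 1) p)"
    define Hn where "Hn = cmod (h n p)"
    have nn: "A \<ge> 0" "W \<ge> 0" "Hn \<ge> 0" by (auto simp: A_def W_def Hn_def)
    note b = bds[OF p]
    have "cmod (V n p) \<le> Hn + cmod (t1 p * V (n - 1) p)"
      using norm_triangle_ineq[of "h n p" "t1 p * V (n - 1) p"] by (simp add: h_def Hn_def)
    then have Vn: "cmod (V n p) \<le> Hn + q * W"
      using b mult_right_mono[of "cmod (t1 p)" q W] nn by (simp add: norm_mult W_def)
    have "q * W \<le> W" using q nn mult_right_mono[of q 1 W] by simp
    with Vn have "cmod (V n p) \<le> Hn + W" by (rule order_trans[OF _ add_left_mono])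
    then have "A + cmod (V n p) + W \<le> 2 * (A + W + Hn)" using nn unfolding distrib_left by linarith
    also have "A + W + Hn \<le> N n p"
      using mult_right_mono[OF \<kappa>(1) nn(2)] mult_right_mono[OF \<mu>(1) nn(3)] by (simp add: N_def A_def W_def Hn_def)
    finally have e: "e \<le> \<epsilon>' * (2 * N n p)"
      using \<epsilon>'(1) by (auto simp: e_def A_def W_def intro!: mult_left_mono)
    have "cmod (F (Suc n) p) \<le> cmod (F n p + c p * V n p) + e"
      using step[OF n p] norm_triangle_sub[of "F (Suc n) p" "F n p + c p * V n p"] by (simp add: e_def)
    also have "cmod (F n p + c p * V n p) \<le> A + \<gamma> * cmod (V n p)"
      using norm_triangle_ineq[of "F n p" "c p * V n p"] b mult_right_mono[of "cmod (c p)" \<gamma> "cmod (V n p)"]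
      by (simp add: norm_mult A_def)
    finally have F: "cmod (F (Suc n) p) \<le> A + \<gamma> * cmod (V n p) + e" by simp
    define E where "E = V (Suc n) p - ((t1 p + t2 p) * V n p - t1 p * t2 p * V (n - 1) p)"
    have "h (Suc n) p = t2 p * h n p + E"
      by (simp add: h_def E_def algebra_simps)
    moreover have "cmod E \<le> e" using step[OF n p] by (simp add: E_def e_def)
    ultimately have "cmod (h (Suc n) p) \<le> cmod (t2 p) * Hn + e"
      using norm_triangle_ineq[of "t2 p * h n p" E] by (simp add: norm_mult Hn_def)
    then have h: "cmod (h (Suc n) p) \<le> q * Hn + e"
      using b mult_right_mono[of "cmod (t2 p)" q Hn] nn by linarith
    have "N (Suc n) p \<le> (A + \<gamma> * cmod (V n p) + e) + \<kappa> * cmod (V n p) + \<mu> * (q * Hn + e)"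
    proof -
      have "\<mu> * cmod (h (Suc n) p) \<le> \<mu> * (q * Hn + e)" using h \<mu>(1) by (intro mult_left_mono) auto
      then show ?thesis using F unfolding N_def diff_Suc_1 by linarith
    qed
    also have "\<dots> = A + (\<gamma> + \<kappa>) * cmod (V n p) + \<mu> * q * Hn + (1 + \<mu>) * e"
      by (simp add: algebra_simps)
    also have "\<dots> \<le> A + (\<gamma> + \<kappa>) * (Hn + q * W) + \<mu> * q * Hn + (1 + \<mu>) * (\<epsilon>' * (2 * N n p))"
      using Vn e \<kappa> \<mu> \<gamma> by (intro add_mono mult_left_mono order_refl) auto
    also have "\<dots> = A + ((\<gamma> + \<kappa>) * q) * W + (\<gamma> + \<kappa> + \<mu> * q) * Hn + 2 * (1 + \<mu>) * \<epsilon>' * N n p"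
      by (simp add: algebra_simps)
    also have "\<dots> \<le> A + \<kappa> * W + \<mu> * Hn + \<epsilon> * N n p"
      unfolding \<epsilon>'(2) using \<kappa> \<mu> nn by (intro add_mono mult_right_mono order_refl) auto
    also have "\<dots> = (1 + \<epsilon>) * N n p"
      by (simp add: N_def A_def W_def Hn_def algebra_simps)
    finally show ?thesis .
  qed
  obtain Cb where Cb: "\<And>n p. p \<in> K \<Longrightarrow> cmod (F n p) \<le> Cb n \<and> cmod (V n p) \<le> Cb n"
    using bd0 by metis
  define C where "C = (1 + \<kappa> + \<mu> * 2) * (\<Sum>n\<le>n0. \<bar>Cb n\<bar>)"
  have Cn: "\<bar>Cb n\<bar> \<le> (\<Sum>n\<le>n0. \<bar>Cb n\<bar>)" if "n \<le> n0" for n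
    using that by (intro member_le_sum) auto
  have C0: "(\<Sum>n\<le>n0. \<bar>Cb n\<bar>) \<ge> 0" by (auto intro: sum_nonneg)
  have C: "C \<ge> 0" "(\<Sum>n\<le>n0. \<bar>Cb n\<bar>) \<le> C"
    using C0 \<kappa> \<mu> mult_right_mono[of 1 "1 + \<kappa> + \<mu> * 2", OF _ C0] by (auto simp: C_def)
  have Nn0: "N n0 p \<le> C" if p: "p \<in> K" for p
  proof -
    define S where "S = (\<Sum>n\<le>n0. \<bar>Cb n\<bar>)"
    have b: "cmod (F n0 p) \<le> S" "cmod (V (n0 - 1) p) \<le> S" "cmod (V n0 p) \<le> S"
      using Cb[OF p, of n0] Cb[OF p, of "n0 - 1"] Cn[of n0] Cn[of "n0 - 1"] by (auto simp: S_def)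
    have "cmod (t1 p * V (n0 - 1) p) \<le> 1 * S"
      unfolding norm_mult using b bds[OF p] q by (intro mult_mono) auto
    then have "cmod (h n0 p) \<le> 2 * S"
      using b norm_triangle_ineq4[of "V n0 p" "t1 p * V (n0 - 1) p"] by (simp add: h_def)
    then have "N n0 p \<le> S + \<kappa> * S + \<mu> * (2 * S)"
      unfolding N_def using b \<kappa> \<mu> by (intro add_mono mult_left_mono) auto
    then show ?thesis by (simp add: C_def S_def algebra_simps)
  qed
  have Nn: "N (n0 + m) p \<le> C * (1 + \<epsilon>) ^ (n0 + m)" if p: "p \<in> K" for m p
  proof (induction m)
    case 0
    have "C * 1 \<le> C * (1 + \<epsilon>) ^ n0" using C \<epsilon> by (intro mult_left_mono one_le_power) auto
    then show ?case using Nn0[OF p] by simp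
  next
    case (Suc m)
    have "N (n0 + Suc m) p \<le> (1 + \<epsilon>) * (C * (1 + \<epsilon>) ^ (n0 + m))"
      using order_trans[OF Nstep[OF _ p] mult_left_mono[OF Suc]] \<epsilon> by simp
    then show ?case by (simp add: algebra_simps)
  qed
  have fin: "cmod (F n p) \<le> C * (1 + \<epsilon>) * (1 + \<epsilon>) ^ n \<and> cmod (V n p) \<le> C * (1 + \<epsilon>) * (1 + \<epsilon>) ^ n"
    if p: "p \<in> K" for n p
  proof (cases "n \<ge> n0")
    case True
    then obtain m where m: "n = n0 + m" using le_Suc_ex by blast
    have "0 \<le> \<kappa> * cmod (V (n - 1) p)" "0 \<le> \<mu> * cmod (h n p)" "0 \<le> \<mu> * cmod (h (Suc n) p)"
      "0 \<le> cmod (F (Suc n) p)"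
      using \<kappa> \<mu> by auto
    moreover have "1 * cmod (V n p) \<le> \<kappa> * cmod (V n p)" using \<kappa>(1) by (rule mult_right_mono) simp
    \<comment> \<open>The norm with index n contains only \<open>V (n - 1)\<close>, so V at n is
      read off the next norm. This is paid for by the extra factor 1 + \<epsilon> in the
      constant.\<close>
    ultimately have "cmod (F n p) \<le> N n p" "cmod (V n p) \<le> N (Suc n) p"
      unfolding N_def diff_Suc_1 by linarith+
    moreover have "N n p \<le> C * (1 + \<epsilon>) ^ n" "N (Suc n) p \<le> C * (1 + \<epsilon>) ^ Suc n"
      using Nn[OF p, of m] Nn[OF p, of "Suc m"] m by auto
    moreover have "C * (1 + \<epsilon>) ^ n * 1 \<le> C * (1 + \<epsilon>) ^ n * (1 + \<epsilon>)"
      using C \<epsilon> by (intro mult_left_mono) auto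
    ultimately show ?thesis by (auto simp: algebra_simps)
  next
    case False
    have "C * 1 \<le> C * (1 + \<epsilon>) ^ Suc n" using C \<epsilon> by (intro mult_left_mono one_le_power) auto
    moreover have "\<bar>Cb n\<bar> \<le> C" using Cn[of n] C False by linarith
    ultimately show ?thesis using Cb[OF p, of n] by (auto simp: algebra_simps)
  qed
  show ?thesis
    using fin C \<epsilon> by (intro exI[of _ "C * (1 + \<epsilon>)"]) auto
qed

section \<open>The three-term recurrence and its limit\<close>

text \<open>
  Write t = 1 / n, f = the n-th slice of A, v = (n-th slice of B) / n^2 and v' likewise for n - 1.
  With D1, D2 the Euler operators in the first two variables, the functions below express
  \<open>t (D1 + D2) f\<close>, \<open>t (D1 - D2) f\<close>, \<open>t^2 (g_n - g_{n-1})\<close>, \<open>t^2 (D1 + D2)^2 f\<close>, \<open>t^3 (D1 + D2) g_n\<close>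
  and \<open>t (D1 + D2) f_{n+1}\<close> linearly through f, v and v', where \<open>f_n\<close>, \<open>g_n\<close> are the slices of A and B;
  they are continuous up to t = 0.
\<close>

definition pP :: "complex \<Rightarrow> complex \<Rightarrow> complex \<Rightarrow> complex \<Rightarrow> complex \<Rightarrow> complex \<Rightarrow> complex \<Rightarrow> complex" where
  "pP b x y t f v v' = - ((1 - x * y) * v / (1 + b * t)) - b * t * f"

definition pD :: "complex \<Rightarrow> complex \<Rightarrow> complex \<Rightarrow> complex \<Rightarrow> complex" where
  "pD x y t v' = (y - x) * ((1 - t)\<^sup>2 * v')"

definition pU :: "complex \<Rightarrow> complex \<Rightarrow> complex \<Rightarrow> complex" where
  "pU t v v' = v - (1 - t)\<^sup>2 * v'"

definition pQ :: "complex \<Rightarrow> complex \<Rightarrow> complex \<Rightarrow> complex \<Rightarrow> complex \<Rightarrow> complex \<Rightarrow> complex \<Rightarrow> complex" where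
  "pQ b x y t f v v' =
     ((1 - 2 * b + x) * t * ((pP b x y t f v v' + pD x y t v') / 2) + x * b * (1 - b) * t\<^sup>2 * f
        + x * (1 - y) * pU t v v') / (1 - x)
   + (- b * (t * pP b x y t f v v' + (1 + b * t) * t * f) + (x + y) * ((1 - t)\<^sup>2 * v') - (1 + x * y) * v)
   + ((1 - 2 * b + y) * t * ((pP b x y t f v v' - pD x y t v') / 2) + y * b * (1 - b) * t\<^sup>2 * f
        + y * (1 - x) * pU t v v') / (1 - y)"

definition pG :: "complex \<Rightarrow> complex \<Rightarrow> complex \<Rightarrow> complex \<Rightarrow> complex \<Rightarrow> complex \<Rightarrow> complex \<Rightarrow> complex" where
  "pG b x y t f v v' = (2 * x * y * t * v - (1 + b * t) * (pQ b x y t f v v' + b * t * pP b x y t f v v')) / (1 - x * y)"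

definition pR :: "complex \<Rightarrow> complex \<Rightarrow> complex \<Rightarrow> complex \<Rightarrow> complex \<Rightarrow> complex \<Rightarrow> complex \<Rightarrow> complex" where
  "pR b x y t f v v' = ((1 + b * t) * (1 + (1 - b) * t) * pP b x y t f v v' + (1 - x) * (1 - y) * pG b x y t f v v'
     - (x + y - 2 * x * y) * t * v) / ((1 + t) * (1 + 2 * b * t))"

text \<open>\<open>PhiF\<close> and \<open>PhiV\<close> are the one-step maps from (f, v, v') to the
  next f and the next v, by \<open>Phi_recurrence\<close> with t = 1 / n.\<close>

definition PhiF :: "complex \<Rightarrow> complex \<Rightarrow> complex \<Rightarrow> complex \<Rightarrow> complex \<Rightarrow> complex \<Rightarrow> complex \<Rightarrow> complex" where
  "PhiF b x y t f v v' = ((1 + b * t) * (1 + (1 - b) * t) * f + (1 - x) * (1 - y) * v) / ((1 + t) * (1 + 2 * b * t))"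

definition PhiV :: "complex \<Rightarrow> complex \<Rightarrow> complex \<Rightarrow> complex \<Rightarrow> complex \<Rightarrow> complex \<Rightarrow> complex \<Rightarrow> complex" where
  "PhiV b x y t f v v' = (- (1 + (1 + b) * t) / ((1 - x * y) * (1 + t)\<^sup>2)) *
     (pR b x y t f v v' + b * t * PhiF b x y t f v v')"

text \<open>Linearity in (f, v, v') reduces the comparison of t > 0 with t = 0 to three coefficient
  functions of (x, y, t), one for each basis vector.\<close>

definition lin3 :: "(complex \<Rightarrow> complex \<Rightarrow> complex \<Rightarrow> complex) \<Rightarrow> bool" where
  "lin3 h \<longleftrightarrow> (\<forall>f v v'. h f v v' = f * h 1 0 0 + v * h 0 1 0 + v' * h 0 0 1)"

lemma lin3_proj: "lin3 (\<lambda>f v v'. f)" "lin3 (\<lambda>f v v'. v)" "lin3 (\<lambda>f v v'. v')"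
  by (simp_all add: lin3_def)

lemma lin3I: "(\<And>f v v'. h f v v' = f * h 1 0 0 + v * h 0 1 0 + v' * h 0 0 1) \<Longrightarrow> lin3 h"
  unfolding lin3_def by blast

lemma lin3D: "lin3 h \<Longrightarrow> h f v v' = f * h 1 0 0 + v * h 0 1 0 + v' * h 0 0 1"
  unfolding lin3_def by blast

lemma lin3_add:
  assumes "lin3 g" "lin3 h"
  shows "lin3 (\<lambda>f v v'. g f v v' + h f v v')"
proof (rule lin3I)
  fix f v v'
  show "g f v v' + h f v v' = f * (g 1 0 0 + h 1 0 0) + v * (g 0 1 0 + h 0 1 0) + v' * (g 0 0 1 + h 0 0 1)"
    unfolding lin3D[OF assms(1), of f v v'] lin3D[OF assms(2), of f v v'] by (simp add: algebra_simps add_divide_distrib)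
qed

lemma lin3_diff:
  assumes "lin3 g" "lin3 h"
  shows "lin3 (\<lambda>f v v'. g f v v' - h f v v')"
proof (rule lin3I)
  fix f v v'
  show "g f v v' - h f v v' = f * (g 1 0 0 - h 1 0 0) + v * (g 0 1 0 - h 0 1 0) + v' * (g 0 0 1 - h 0 0 1)"
    unfolding lin3D[OF assms(1), of f v v'] lin3D[OF assms(2), of f v v'] by (simp add: algebra_simps add_divide_distrib)
qed

lemma lin3_cmult:
  assumes "lin3 g"
  shows "lin3 (\<lambda>f v v'. c * g f v v')"
proof (rule lin3I)
  fix f v v'
  show "c * g f v v' = f * (c * g 1 0 0) + v * (c * g 0 1 0) + v' * (c * g 0 0 1)"
    unfolding lin3D[OF assms(1), of f v v'] by (simp add: algebra_simps add_divide_distrib)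
qed

lemma lin3_divide:
  assumes "lin3 g"
  shows "lin3 (\<lambda>f v v'. g f v v' / c)"
proof (rule lin3I)
  fix f v v'
  show "g f v v' / c = f * (g 1 0 0 / c) + v * (g 0 1 0 / c) + v' * (g 0 0 1 / c)"
    unfolding lin3D[OF assms(1), of f v v'] by (simp add: algebra_simps add_divide_distrib)
qed

lemma lin3_uminus:
  assumes "lin3 g"
  shows "lin3 (\<lambda>f v v'. - g f v v')"
proof (rule lin3I)
  fix f v v'
  show "- g f v v' = f * (- g 1 0 0) + v * (- g 0 1 0) + v' * (- g 0 0 1)"
    unfolding lin3D[OF assms(1), of f v v'] by (simp add: algebra_simps add_divide_distrib)
qed

lemmas lin3_ops = lin3_add lin3_diff lin3_cmult lin3_divide lin3_uminus

lemma lin3_Phi: "lin3 (PhiF b x y t)" "lin3 (PhiV b x y t)"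
proof -
  have P: "lin3 (pP b x y t)" unfolding pP_def[abs_def] by (intro lin3_ops lin3_proj)
  have Q: "lin3 (pQ b x y t)" unfolding pQ_def[abs_def] pU_def pD_def by (intro lin3_ops lin3_proj P)
  have G: "lin3 (pG b x y t)" unfolding pG_def[abs_def] by (intro lin3_ops lin3_proj P Q)
  have R: "lin3 (pR b x y t)" unfolding pR_def[abs_def] by (intro lin3_ops lin3_proj P G)
  show F: "lin3 (PhiF b x y t)" unfolding PhiF_def[abs_def] by (intro lin3_ops lin3_proj)
  show "lin3 (PhiV b x y t)" unfolding PhiV_def[abs_def] by (intro lin3_ops R F)
qed

lemma lin3_diff_bound:
  assumes "lin3 g" "lin3 h"
    and "cmod (g 1 0 0 - h 1 0 0) \<le> \<epsilon>" "cmod (g 0 1 0 - h 0 1 0) \<le> \<epsilon>" "cmod (g 0 0 1 - h 0 0 1) \<le> \<epsilon>"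
  shows "cmod (g f v v' - h f v v') \<le> \<epsilon> * (cmod f + cmod v + cmod v')"
proof -
  define A where "A = g 1 0 0 - h 1 0 0"
  define B where "B = g 0 1 0 - h 0 1 0"
  define C where "C = g 0 0 1 - h 0 0 1"
  have "g f v v' - h f v v' = f * A + v * B + v' * C"
    unfolding lin3D[OF assms(1), of f v v'] lin3D[OF assms(2), of f v v'] A_def B_def C_def
    by (simp only: right_diff_distrib) simp
  moreover have "cmod (f * A + v * B + v' * C) \<le> cmod f * cmod A + cmod v * cmod B + cmod v' * cmod C"
    by (intro norm_triangle_le add_mono) (simp_all add: norm_mult)
  moreover have "cmod f * cmod A + cmod v * cmod B + cmod v' * cmod C \<le> cmod f * \<epsilon> + cmod v * \<epsilon> + cmod v' * \<epsilon>"
    using assms(3-5) unfolding A_def B_def C_def by (intro add_mono mult_left_mono norm_ge_zero)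
  ultimately show ?thesis by (simp add: algebra_simps)
qed

text \<open>The limit is triangular: v evolves without f, and f receives v as a source. The two
  coefficients of v and v' are the sum and the product of the roots in \<open>roots\<close>, the
  form required by \<open>linear_recurrence_growth\<close>.\<close>

lemma Phi_at_0:
  assumes "x \<noteq> 1" "y \<noteq> 1" "x * y \<noteq> 1"
  shows "PhiF b x y 0 f v v' = f + (1 - x) * (1 - y) * v"
    "PhiV b x y 0 f v v' = 2 * ((x + y) * (1 + x * y) - 4 * (x * y)) / (1 - x * y)\<^sup>2 * v - ((x - y) / (1 - x * y))\<^sup>2 * v'"
proof -
  have nz: "1 - x \<noteq> 0" "1 - y \<noteq> 0" "1 - x * y \<noteq> 0" using assms by auto
  show "PhiF b x y 0 f v v' = f + (1 - x) * (1 - y) * v" by (simp add: PhiF_def)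
  define Q where "Q = pQ b x y 0 f v v'"
  \<comment> \<open>Naming the two quotients keeps them opaque until (1 - x)(1 - y) clears both
    denominators at once; the rest is a polynomial identity.\<close>
  define h1 where "h1 = x * (1 - y) * (v - v') / (1 - x)"
  define h2 where "h2 = y * (1 - x) * (v - v') / (1 - y)"
  have h: "(1 - x) * h1 = x * (1 - y) * (v - v')" "(1 - y) * h2 = y * (1 - x) * (v - v')"
    using nz by (simp_all add: h1_def h2_def)
  have Qsum: "Q = h1 + ((x + y) * v' - (1 + x * y) * v) + h2"
    by (simp add: Q_def pQ_def pU_def h1_def h2_def)
  have "(1 - x) * (1 - y) * Q = (1 - y) * ((1 - x) * h1) + (1 - x) * (1 - y) * ((x + y) * v' - (1 + x * y) * v)
      + (1 - x) * ((1 - y) * h2)"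
    unfolding Qsum by (simp only: distrib_left mult_ac)
  then have Q: "(1 - x) * (1 - y) * Q = x * (1 - y)\<^sup>2 * (v - v') + y * (1 - x)\<^sup>2 * (v - v')
      + (1 - x) * (1 - y) * ((x + y) * v' - (1 + x * y) * v)"
    unfolding h by (simp only: power2_eq_square mult_ac add_ac)
  define w where "w = 1 - x * y"
  define c where "c = (1 - x) * (1 - y)"
  have "PhiV b x y 0 f v v' = (- 1 / w) * (- (w * v) + c * (- Q / w))"
    by (simp add: PhiV_def pR_def pG_def Q_def pP_def w_def c_def)
  also have "\<dots> = v + c * Q / w\<^sup>2"
    using nz(3) unfolding w_def[symmetric] by (simp add: field_simps power2_eq_square)
  finally have "PhiV b x y 0 f v v' = v + ((1 - x) * (1 - y) * Q) / (1 - x * y)\<^sup>2"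
    by (simp add: w_def c_def)
  also have "\<dots> = ((1 - x * y)\<^sup>2 * v + (1 - x) * (1 - y) * Q) / (1 - x * y)\<^sup>2"
    using nz by (simp add: add_divide_distrib)
  also have "(1 - x * y)\<^sup>2 * v + (1 - x) * (1 - y) * Q = 2 * ((x + y) * (1 + x * y) - 4 * (x * y)) * v - (x - y)\<^sup>2 * v'"
    unfolding Q by (simp add: algebra_simps power2_eq_square)
  finally show "PhiV b x y 0 f v v' = 2 * ((x + y) * (1 + x * y) - 4 * (x * y)) / (1 - x * y)\<^sup>2 * v - ((x - y) / (1 - x * y))\<^sup>2 * v'"
    unfolding power_divide by (simp only: diff_divide_distrib times_divide_eq_left)
qed

lemma continuous_on_Phi:
  fixes X Y T :: "'p :: topological_space \<Rightarrow> complex"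
  assumes c: "continuous_on S X" "continuous_on S Y" "continuous_on S T"
    and nz: "\<forall>u\<in>S. 1 - X u \<noteq> 0" "\<forall>u\<in>S. 1 - Y u \<noteq> 0" "\<forall>u\<in>S. 1 - X u * Y u \<noteq> 0"
      "\<forall>u\<in>S. 1 + b * T u \<noteq> 0" "\<forall>u\<in>S. 1 + T u \<noteq> 0" "\<forall>u\<in>S. 1 + 2 * b * T u \<noteq> 0"
  shows "continuous_on S (\<lambda>u. PhiF b (X u) (Y u) (T u) f v v')"
    "continuous_on S (\<lambda>u. PhiV b (X u) (Y u) (T u) f v v')"
proof -
  have nz2: "\<forall>u\<in>S. (1 + T u) * (1 + 2 * b * T u) \<noteq> 0" "\<forall>u\<in>S. (1 - X u * Y u) * (1 + T u)\<^sup>2 \<noteq> 0" "\<forall>u\<in>S. (2 :: complex) \<noteq> 0"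
    using nz by auto
  have P: "continuous_on S (\<lambda>u. pP b (X u) (Y u) (T u) f v v')"
    unfolding pP_def by (intro continuous_intros c nz)
  have D: "continuous_on S (\<lambda>u. pD (X u) (Y u) (T u) v')"
    unfolding pD_def by (intro continuous_intros c)
  have U: "continuous_on S (\<lambda>u. pU (T u) v v')"
    unfolding pU_def by (intro continuous_intros c)
  have Q: "continuous_on S (\<lambda>u. pQ b (X u) (Y u) (T u) f v v')"
    unfolding pQ_def by (intro continuous_intros c P D U nz nz2)
  have G: "continuous_on S (\<lambda>u. pG b (X u) (Y u) (T u) f v v')"
    unfolding pG_def by (intro continuous_intros c P Q nz)
  have R: "continuous_on S (\<lambda>u. pR b (X u) (Y u) (T u) f v v')"
    unfolding pR_def by (intro continuous_intros c P G nz2)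
  show F: "continuous_on S (\<lambda>u. PhiF b (X u) (Y u) (T u) f v v')"
    unfolding PhiF_def by (intro continuous_intros c nz2)
  show "continuous_on S (\<lambda>u. PhiV b (X u) (Y u) (T u) f v v')"
    unfolding PhiV_def by (intro continuous_intros c R F nz2)
qed

lemma uniformly_close_at_0:
  fixes \<phi> :: "'p :: metric_space \<times> real \<Rightarrow> complex"
  assumes "compact K" "continuous_on (K \<times> {0..1}) \<phi>" "\<epsilon> > 0"
  obtains \<delta> where "\<delta> > 0" "\<And>p t. p \<in> K \<Longrightarrow> 0 \<le> t \<Longrightarrow> t \<le> 1 \<Longrightarrow> t < \<delta> \<Longrightarrow> cmod (\<phi> (p, t) - \<phi> (p, 0)) < \<epsilon>"
proof -
  have "uniformly_continuous_on (K \<times> {0..1}) \<phi>"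
    by (intro compact_uniformly_continuous assms compact_Times compact_Icc)
  then obtain \<delta> where \<delta>: "\<delta> > 0" "\<And>u u'. u \<in> K \<times> {0..1} \<Longrightarrow> u' \<in> K \<times> {0..1} \<Longrightarrow> dist u' u < \<delta> \<Longrightarrow> dist (\<phi> u') (\<phi> u) < \<epsilon>"
    using assms(3) unfolding uniformly_continuous_on_def by metis
  show ?thesis
  proof (rule that[OF \<delta>(1)])
    fix p t assume "p \<in> K" "0 \<le> t" "t \<le> (1 :: real)" "t < \<delta>"
    then show "cmod (\<phi> (p, t) - \<phi> (p, 0)) < \<epsilon>"
      using \<delta>(2)[of "(p, 0)" "(p, t)"] by (simp add: dist_Pair_Pair dist_norm)
  qed
qed

text \<open>Compactness of K times [0, 1] makes the limit t to 0 uniform in (x, y), and linearity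
  makes the error proportional to the size of (f, v, v').\<close>

lemma Phi_close:
  fixes K :: "(complex \<times> complex) set"
  assumes K: "compact K" "\<And>x y. (x, y) \<in> K \<Longrightarrow> x \<noteq> 1 \<and> y \<noteq> 1 \<and> x * y \<noteq> 1" and "\<beta> > 0" "\<epsilon> > 0"
  obtains \<delta> where "\<delta> > 0" "\<delta> \<le> 1" "\<And>x y t f v v'. (x, y) \<in> K \<Longrightarrow> 0 \<le> t \<Longrightarrow> t < \<delta> \<Longrightarrow>
      cmod (PhiF (of_real \<beta>) x y (of_real t) f v v' - PhiF (of_real \<beta>) x y 0 f v v') \<le> \<epsilon> * (cmod f + cmod v + cmod v') \<and>
      cmod (PhiV (of_real \<beta>) x y (of_real t) f v v' - PhiV (of_real \<beta>) x y 0 f v v') \<le> \<epsilon> * (cmod f + cmod v + cmod v')"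
proof -
  have nz: "1 + complex_of_real \<beta> * of_real t \<noteq> 0" "1 + complex_of_real t \<noteq> 0" "1 + 2 * complex_of_real \<beta> * of_real t \<noteq> 0"
    if "0 \<le> t" for t
  proof -
    have "0 \<le> \<beta> * t" using that \<open>\<beta> > 0\<close> by simp
    then have "1 + \<beta> * t \<noteq> 0" "1 + t \<noteq> 0" "1 + 2 * \<beta> * t \<noteq> 0"
      using that unfolding mult.assoc by linarith+
    then have "complex_of_real (1 + \<beta> * t) \<noteq> 0" "complex_of_real (1 + t) \<noteq> 0" "complex_of_real (1 + 2 * \<beta> * t) \<noteq> 0"
      unfolding of_real_eq_0_iff .
    then show "1 + complex_of_real \<beta> * of_real t \<noteq> 0" "1 + complex_of_real t \<noteq> 0" "1 + 2 * complex_of_real \<beta> * of_real t \<noteq> 0"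
      by simp_all
  qed
  have cont: "continuous_on (K \<times> {0..1}) (\<lambda>u. PhiF (of_real \<beta>) (fst (fst u)) (snd (fst u)) (of_real (snd u)) f v v')"
    "continuous_on (K \<times> {0..1}) (\<lambda>u. PhiV (of_real \<beta>) (fst (fst u)) (snd (fst u)) (of_real (snd u)) f v v')" for f v v'
  proof -
    have "\<forall>u\<in>K \<times> {0..1}. 1 - fst (fst u) \<noteq> 0 \<and> 1 - snd (fst u) \<noteq> 0 \<and> 1 - fst (fst u) * snd (fst u) \<noteq> 0"
      using K(2) by force
    moreover have "\<forall>u\<in>K \<times> {0..1}. 1 + complex_of_real \<beta> * of_real (snd u) \<noteq> 0 \<and>
        1 + complex_of_real (snd u) \<noteq> 0 \<and> 1 + 2 * complex_of_real \<beta> * of_real (snd u) \<noteq> 0"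
      using nz by auto
    ultimately show "continuous_on (K \<times> {0..1}) (\<lambda>u. PhiF (of_real \<beta>) (fst (fst u)) (snd (fst u)) (of_real (snd u)) f v v')"
    "continuous_on (K \<times> {0..1}) (\<lambda>u. PhiV (of_real \<beta>) (fst (fst u)) (snd (fst u)) (of_real (snd u)) f v v')"
      by (intro continuous_on_Phi continuous_intros; blast)+
  qed
  have ex: "\<exists>\<delta>>0. \<forall>x y t. (x, y) \<in> K \<longrightarrow> 0 \<le> t \<longrightarrow> t \<le> 1 \<longrightarrow> t < \<delta> \<longrightarrow>
      cmod (PhiF (of_real \<beta>) x y (of_real t) f v v' - PhiF (of_real \<beta>) x y 0 f v v') < \<epsilon> \<and>
      cmod (PhiV (of_real \<beta>) x y (of_real t) f v v' - PhiV (of_real \<beta>) x y 0 f v v') < \<epsilon>" for f v v'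
  proof -
    obtain \<delta>1 where 1: "\<delta>1 > 0" "\<And>p t. p \<in> K \<Longrightarrow> 0 \<le> t \<Longrightarrow> t \<le> 1 \<Longrightarrow> t < \<delta>1 \<Longrightarrow>
        cmod (PhiF (of_real \<beta>) (fst p) (snd p) (of_real t) f v v' - PhiF (of_real \<beta>) (fst p) (snd p) 0 f v v') < \<epsilon>"
      using uniformly_close_at_0[OF K(1) cont(1) \<open>\<epsilon> > 0\<close>, of f v v'] by auto
    obtain \<delta>2 where 2: "\<delta>2 > 0" "\<And>p t. p \<in> K \<Longrightarrow> 0 \<le> t \<Longrightarrow> t \<le> 1 \<Longrightarrow> t < \<delta>2 \<Longrightarrow>
        cmod (PhiV (of_real \<beta>) (fst p) (snd p) (of_real t) f v v' - PhiV (of_real \<beta>) (fst p) (snd p) 0 f v v') < \<epsilon>"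
      using uniformly_close_at_0[OF K(1) cont(2) \<open>\<epsilon> > 0\<close>, of f v v'] by auto
    show ?thesis
    proof (intro exI[of _ "min \<delta>1 \<delta>2"] conjI allI impI)
      show "min \<delta>1 \<delta>2 > 0" using 1(1) 2(1) by simp
    next
      fix x y t assume *: "(x, y) \<in> K" "0 \<le> t" "t \<le> 1" "t < min \<delta>1 \<delta>2"
      show "cmod (PhiF (of_real \<beta>) x y (of_real t) f v v' - PhiF (of_real \<beta>) x y 0 f v v') < \<epsilon>"
        using 1(2)[OF *(1-3)] *(4) by simp
      show "cmod (PhiV (of_real \<beta>) x y (of_real t) f v v' - PhiV (of_real \<beta>) x y 0 f v v') < \<epsilon>"
        using 2(2)[OF *(1-3)] *(4) by simp
    qed
  qed
  obtain \<delta>1 where d1: "\<delta>1 > 0" "\<And>x y t. (x, y) \<in> K \<Longrightarrow> 0 \<le> t \<Longrightarrow> t \<le> 1 \<Longrightarrow> t < \<delta>1 \<Longrightarrow>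
      cmod (PhiF (of_real \<beta>) x y (of_real t) 1 0 0 - PhiF (of_real \<beta>) x y 0 1 0 0) < \<epsilon> \<and>
      cmod (PhiV (of_real \<beta>) x y (of_real t) 1 0 0 - PhiV (of_real \<beta>) x y 0 1 0 0) < \<epsilon>"
    using ex[of 1 0 0] by blast
  obtain \<delta>2 where d2: "\<delta>2 > 0" "\<And>x y t. (x, y) \<in> K \<Longrightarrow> 0 \<le> t \<Longrightarrow> t \<le> 1 \<Longrightarrow> t < \<delta>2 \<Longrightarrow>
      cmod (PhiF (of_real \<beta>) x y (of_real t) 0 1 0 - PhiF (of_real \<beta>) x y 0 0 1 0) < \<epsilon> \<and>
      cmod (PhiV (of_real \<beta>) x y (of_real t) 0 1 0 - PhiV (of_real \<beta>) x y 0 0 1 0) < \<epsilon>"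
    using ex[of 0 1 0] by blast
  obtain \<delta>3 where d3: "\<delta>3 > 0" "\<And>x y t. (x, y) \<in> K \<Longrightarrow> 0 \<le> t \<Longrightarrow> t \<le> 1 \<Longrightarrow> t < \<delta>3 \<Longrightarrow>
      cmod (PhiF (of_real \<beta>) x y (of_real t) 0 0 1 - PhiF (of_real \<beta>) x y 0 0 0 1) < \<epsilon> \<and>
      cmod (PhiV (of_real \<beta>) x y (of_real t) 0 0 1 - PhiV (of_real \<beta>) x y 0 0 0 1) < \<epsilon>"
    using ex[of 0 0 1] by blast
  define \<delta> where "\<delta> = min (min 1 \<delta>1) (min \<delta>2 \<delta>3)"
  show ?thesis
  proof (rule that[of \<delta>])
    fix x y f v v' :: complex and t :: real
    assume *: "(x, y) \<in> K" "0 \<le> t" "t < \<delta>"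
    then have t: "t \<le> 1" "t < \<delta>1" "t < \<delta>2" "t < \<delta>3" by (simp_all add: \<delta>_def)
    note d = d1(2)[OF *(1,2) t(1,2)] d2(2)[OF *(1,2) t(1,3)] d3(2)[OF *(1,2) t(1,4)]
    show "cmod (PhiF (of_real \<beta>) x y (of_real t) f v v' - PhiF (of_real \<beta>) x y 0 f v v') \<le> \<epsilon> * (cmod f + cmod v + cmod v') \<and>
      cmod (PhiV (of_real \<beta>) x y (of_real t) f v v' - PhiV (of_real \<beta>) x y 0 f v v') \<le> \<epsilon> * (cmod f + cmod v + cmod v')"
      by (intro conjI lin3_diff_bound lin3_Phi less_imp_le) (use d in blast)+
  next
    show "\<delta> > 0" "\<delta> \<le> 1" using d1(1) d2(1) d3(1) by (simp_all add: \<delta>_def)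
  qed
qed

lemma lens_compact:
  assumes "\<delta> > 0"
  shows "compact {(x, y). \<delta> \<le> margin x \<and> \<delta> \<le> margin y}"
proof (rule compact_eq_bounded_closed[THEN iffD2], rule conjI)
  have "{x. \<delta> \<le> margin x} \<subseteq> cball 0 1"
  proof
    fix x assume "x \<in> {x. \<delta> \<le> margin x}"
    then have "cmod x \<le> 1" using margin_le[of x] assms by simp
    then show "x \<in> cball 0 1" by simp
  qed
  then have b: "bounded {x. \<delta> \<le> margin x}" by (rule bounded_subset[OF bounded_cball])
  have "{(x, y). \<delta> \<le> margin x \<and> \<delta> \<le> margin y} = {x. \<delta> \<le> margin x} \<times> {x. \<delta> \<le> margin x}" by auto
  moreover have "closed {x. \<delta> \<le> margin x}"
    by (intro closed_Collect_le continuous_intros)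
  ultimately show "bounded {(x, y). \<delta> \<le> margin x \<and> \<delta> \<le> margin y}" "closed {(x, y). \<delta> \<le> margin x \<and> \<delta> \<le> margin y}"
    using b by (auto intro: bounded_Times closed_Times)
qed

text \<open>The characteristic roots of the limit recurrence at t = 0.\<close>

definition root1 :: "complex \<Rightarrow> complex \<Rightarrow> complex" where
  "root1 x y = ((csqrt x + csqrt y) / (1 + csqrt x * csqrt y))\<^sup>2"

definition root2 :: "complex \<Rightarrow> complex \<Rightarrow> complex" where
  "root2 x y = ((csqrt x - csqrt y) / (1 - csqrt x * csqrt y))\<^sup>2"

text \<open>The second root is the first with Y replaced by -Y. The margin sees only Y^2, so
  \<open>tanh_sum_bound\<close> applies to both, and the symmetric functions of the roots are
  rational in x and y.\<close>

lemma roots: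
  assumes "0 < \<delta>" "\<delta> \<le> margin x" "\<delta> \<le> margin y"
  shows "cmod (root1 x y) \<le> 1 - \<delta>\<^sup>2 / 4" "cmod (root2 x y) \<le> 1 - \<delta>\<^sup>2 / 4"
    "root1 x y + root2 x y = 2 * ((x + y) * (1 + x * y) - 4 * (x * y)) / (1 - x * y)\<^sup>2"
    "root1 x y * root2 x y = ((x - y) / (1 - x * y))\<^sup>2"
proof -
  define X where "X = csqrt x"
  define Y where "Y = csqrt y"
  have XY: "x = X\<^sup>2" "y = Y\<^sup>2" by (simp_all add: X_def Y_def)
  have 1: "1 + X * Y \<noteq> 0" "cmod (((X + Y) / (1 + X * Y))\<^sup>2) \<le> 1 - \<delta>\<^sup>2 / 4"
    using tanh_sum_bound[of \<delta> X Y] assms by (simp_all add: XY)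
  have 2: "1 - X * Y \<noteq> 0" "cmod (((X - Y) / (1 - X * Y))\<^sup>2) \<le> 1 - \<delta>\<^sup>2 / 4"
    using tanh_sum_bound[of \<delta> X "-Y"] assms by (simp_all add: XY)
  have r: "root1 x y = ((X + Y) / (1 + X * Y))\<^sup>2" "root2 x y = ((X - Y) / (1 - X * Y))\<^sup>2"
    by (simp_all add: root1_def root2_def X_def Y_def)
  show "cmod (root1 x y) \<le> 1 - \<delta>\<^sup>2 / 4" "cmod (root2 x y) \<le> 1 - \<delta>\<^sup>2 / 4"
    using 1 2 by (simp_all add: r)
  have w: "1 - x * y = (1 + X * Y) * (1 - X * Y)" by (simp add: XY algebra_simps power2_eq_square)
  have "root1 x y + root2 x y = ((X + Y)\<^sup>2 * (1 - X * Y)\<^sup>2 + (X - Y)\<^sup>2 * (1 + X * Y)\<^sup>2) / (1 - x * y)\<^sup>2"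
    unfolding r w using 1 2 by (simp add: power_divide power_mult_distrib add_frac_eq)
  also have "(X + Y)\<^sup>2 * (1 - X * Y)\<^sup>2 + (X - Y)\<^sup>2 * (1 + X * Y)\<^sup>2 = 2 * ((x + y) * (1 + x * y) - 4 * (x * y))"
    unfolding XY by (simp add: algebra_simps power2_eq_square)
  finally show "root1 x y + root2 x y = 2 * ((x + y) * (1 + x * y) - 4 * (x * y)) / (1 - x * y)\<^sup>2" .
  have "x - y = (X + Y) * (X - Y)" by (simp add: XY algebra_simps power2_eq_square)
  then show "root1 x y * root2 x y = ((x - y) / (1 - x * y))\<^sup>2"
    unfolding r w by (simp add: power_divide power_mult_distrib)
qed

section \<open>Elimination of the Euler derivatives\<close>

context neighbor
begin

abbreviation "bb \<equiv> complex_of_real \<beta>"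

text \<open>Junk value 0 at n = 0; the recurrence is only used from n = 2 on.\<close>

definition scaled_slice :: "nat \<Rightarrow> complex \<Rightarrow> complex \<Rightarrow> complex" where
  "scaled_slice n x y = slice_sum b (int n) x y / (of_nat n)\<^sup>2"

text \<open>The elimination goes through \<open>rec_J_sum\<close> and \<open>rec_J_diff\<close> for
  D1 f and D2 f; \<open>rec_L1\<close>, \<open>rec_L2\<close> and \<open>rec_J12\<close> for the
  second-order derivatives; \<open>rec_Euler_J\<close> for (D1 + D2) g; \<open>rec_Euler_L3\<close>
  and \<open>rec_L3\<close> for the next slice of A and its derivative; and \<open>rec_J_sum\<close>
  at n + 1 for the next slice of B. Each relation is multiplied by the power of t that makes its
  coefficients continuous up to t = 0.\<close>

lemma Phi_recurrence:
  assumes xy: "norm x < 1" "norm y < 1" and n: "n \<ge> 2"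
  shows "slice_sum a (int (Suc n)) x y = PhiF bb x y (1 / of_nat n) (slice_sum a (int n) x y) (scaled_slice n x y) (scaled_slice (n - 1) x y)"
    "scaled_slice (Suc n) x y = PhiV bb x y (1 / of_nat n) (slice_sum a (int n) x y) (scaled_slice n x y) (scaled_slice (n - 1) x y)"
proof -
  define N where "N = complex_of_nat n"
  define t where "t = 1 / N"
  define f where "f = slice_sum a (int n) x y"
  define f' where "f' = slice_sum a (int n + 1) x y"
  define g where "g = slice_sum b (int n) x y"
  define g' where "g' = slice_sum b (int n - 1) x y"
  define v where "v = scaled_slice n x y"
  define v' where "v' = scaled_slice (n - 1) x y"
  define F1 where "F1 = slice_sum (euler 1 a) (int n) x y"
  define F2 where "F2 = slice_sum (euler 2 a) (int n) x y"
  define F11 where "F11 = slice_sum (euler 1 (euler 1 a)) (int n) x y"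
  define F22 where "F22 = slice_sum (euler 2 (euler 2 a)) (int n) x y"
  define F12 where "F12 = slice_sum (euler 1 (euler 2 a)) (int n) x y"
  define G where "G = slice_sum (euler 1 b) (int n) x y + slice_sum (euler 2 b) (int n) x y"
  define p' where "p' = slice_sum (euler 1 a) (int n + 1) x y + slice_sum (euler 2 a) (int n + 1) x y"
  define P where "P = pP bb x y t f v v'"
  define D where "D = pD x y t v'"
  have N0: "N \<noteq> 0" "N - 1 \<noteq> 0" using n by (auto simp: N_def)
  have tN: "t * N = 1" using N0 by (simp add: t_def)
  have nzr: "1 + c * complex_of_real (1 / real n) \<noteq> 0" if "c = of_real d" "d > 0" for c d
  proof -
    have "1 + d * (1 / real n) > 0" using that by (simp add: add_pos_nonneg)
    then have "complex_of_real (1 + d * (1 / real n)) \<noteq> 0" unfolding of_real_eq_0_iff by linarith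
    then show ?thesis using that by simp
  qed
  have tr: "t = complex_of_real (1 / real n)" by (simp add: t_def N_def)
  have nz: "1 + bb * t \<noteq> 0" "1 + t \<noteq> 0" "1 + 2 * bb * t \<noteq> 0"
    using nzr[of bb \<beta>] nzr[of 1 1] nzr[of "2 * bb" "2 * \<beta>"] beta by (simp_all add: tr)
  have "x \<noteq> 1" "y \<noteq> 1" using xy by auto
  moreover have "cmod (x * y) < 1 * 1" unfolding norm_mult using xy by (intro mult_strict_mono') auto
  then have "x * y \<noteq> 1" by auto
  ultimately have nz': "1 - x \<noteq> 0" "1 - y \<noteq> 0" "1 - x * y \<noteq> 0" by auto
  have tg: "t\<^sup>2 * g = v" using N0 by (simp add: v_def scaled_slice_def g_def t_def N_def power_divide)
  \<comment> \<open>The previous slice is scaled by n - 1 and not by n, whence the factors (1 - t)^2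
    in \<open>pD\<close>, \<open>pU\<close> and \<open>pQ\<close>. From n = 2 on the divisor n - 1
    is nonzero.\<close>
  have "v' = g' / (N - 1)\<^sup>2" using n by (simp add: v'_def scaled_slice_def g'_def N_def of_nat_diff)
  moreover have "1 - t = t * (N - 1)" using tN by (simp add: algebra_simps)
  ultimately have tg': "t\<^sup>2 * g' = (1 - t)\<^sup>2 * v'" using N0 by (simp add: power_mult_distrib)
  have kb: "t * (N + bb) = 1 + bb * t" using tN by (simp add: algebra_simps)
  have "(1 + bb * t) * (t * (F1 + F2) + bb * t * f) = t\<^sup>2 * ((N + bb) * (F1 + F2 + bb * f))"
    unfolding kb[symmetric] by (simp add: algebra_simps power2_eq_square)
  also have "(N + bb) * (F1 + F2 + bb * f) = - ((1 - x * y) * g)"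
    using rec_J_sum[OF xy, of "int n"] by (simp add: N_def F1_def F2_def f_def g_def algebra_simps)
  also have "t\<^sup>2 * - ((1 - x * y) * g) = - ((1 - x * y) * v)"
    unfolding tg[symmetric] by simp
  finally have "t * (F1 + F2) + bb * t * f = - ((1 - x * y) * v) / (1 + bb * t)"
    using nz by (subst nonzero_eq_divide_eq) (auto simp: mult.commute)
  then have tp: "t * (F1 + F2) = P" unfolding P_def pP_def by (simp only: minus_divide_left eq_diff_eq)
  have "t * (F1 - F2) = t * ((t * N) * (F1 - F2))" by (simp add: tN)
  also have "\<dots> = t\<^sup>2 * (N * (F1 - F2))" by (simp only: power2_eq_square mult_ac)
  also have "N * (F1 - F2) = (y - x) * g'"
    using rec_J_diff[OF xy, of "int n"] by (simp add: N_def F1_def F2_def g'_def)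
  also have "t\<^sup>2 * ((y - x) * g') = (y - x) * (t\<^sup>2 * g')" by simp
  finally have td: "t * (F1 - F2) = D" by (simp add: tg' D_def pD_def)
  have tF1: "t * F1 = (P + D) / 2" and tF2: "t * F2 = (P - D) / 2"
    unfolding tp[symmetric] td[symmetric] by (simp_all add: algebra_simps)
  have U: "t\<^sup>2 * g - t\<^sup>2 * g' = pU t v v'" by (simp add: tg tg' pU_def)
  have "t\<^sup>2 * F11 * (1 - x) = t\<^sup>2 * ((1 - x) * F11)" by simp
  also have "(1 - x) * F11 = (1 - 2 * bb + x) * F1 + x * bb * (1 - bb) * f + x * (1 - y) * (g - g')"
    using rec_L1[OF xy, of "int n"] by (simp add: F11_def F1_def f_def g_def g'_def)
  also have "t\<^sup>2 * \<dots> = (1 - 2 * bb + x) * t * (t * F1) + x * bb * (1 - bb) * t\<^sup>2 * f + x * (1 - y) * (t\<^sup>2 * g - t\<^sup>2 * g')"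
    by (simp add: algebra_simps power2_eq_square)
  finally have H1: "t\<^sup>2 * F11 = ((1 - 2 * bb + x) * t * ((P + D) / 2) + x * bb * (1 - bb) * t\<^sup>2 * f + x * (1 - y) * pU t v v') / (1 - x)"
    unfolding U tF1 using nz' by (simp add: nonzero_eq_divide_eq)
  have "t\<^sup>2 * F22 * (1 - y) = t\<^sup>2 * ((1 - y) * F22)" by simp
  also have "(1 - y) * F22 = (1 - 2 * bb + y) * F2 + y * bb * (1 - bb) * f + y * (1 - x) * (g - g')"
    using rec_L2[OF xy, of "int n"] by (simp add: F22_def F2_def f_def g_def g'_def)
  also have "t\<^sup>2 * \<dots> = (1 - 2 * bb + y) * t * (t * F2) + y * bb * (1 - bb) * t\<^sup>2 * f + y * (1 - x) * (t\<^sup>2 * g - t\<^sup>2 * g')"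
    by (simp add: algebra_simps power2_eq_square)
  finally have H2: "t\<^sup>2 * F22 = ((1 - 2 * bb + y) * t * ((P - D) / 2) + y * bb * (1 - bb) * t\<^sup>2 * f + y * (1 - x) * pU t v v') / (1 - y)"
    unfolding U tF2 using nz' by (simp add: nonzero_eq_divide_eq)
  have "t\<^sup>2 * (2 * F12) = t\<^sup>2 * (- bb * (F1 + F2 + (N + bb) * f) + (x + y) * g' - (1 + x * y) * g)"
    using rec_J12[OF xy, of "int n"] by (simp add: F12_def F1_def F2_def f_def g_def g'_def N_def)
  also have "\<dots> = - bb * (t * (t * (F1 + F2)) + (t * (N + bb)) * t * f) + (x + y) * (t\<^sup>2 * g') - (1 + x * y) * (t\<^sup>2 * g)"
    by (simp add: algebra_simps power2_eq_square)
  finally have H12: "t\<^sup>2 * (2 * F12) = - bb * (t * P + (1 + bb * t) * t * f) + (x + y) * ((1 - t)\<^sup>2 * v') - (1 + x * y) * v"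
    by (simp add: tp kb tg tg')
  have Q: "t\<^sup>2 * (F11 + 2 * F12 + F22) = pQ bb x y t f v v'"
    unfolding distrib_left[of "t\<^sup>2"] H1 H2 H12 by (simp add: pQ_def P_def D_def)
  have "t ^ 3 * G * (1 - x * y) = t ^ 3 * ((1 - x * y) * G)" by simp
  also have "(1 - x * y) * G = 2 * x * y * g - (N + bb) * (F11 + 2 * F12 + F22 + bb * (F1 + F2))"
    using rec_Euler_J[OF xy, of "int n"] by (simp add: G_def N_def F11_def F12_def F22_def F1_def F2_def g_def)
  also have "t ^ 3 * \<dots> = 2 * x * y * t * (t\<^sup>2 * g) - (t * (N + bb)) * (t\<^sup>2 * (F11 + 2 * F12 + F22) + bb * t * (t * (F1 + F2)))"
    by (simp add: algebra_simps power2_eq_square power3_eq_cube)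
  finally have tG: "t ^ 3 * G = pG bb x y t f v v'"
    unfolding tg kb Q tp using nz' by (simp add: pG_def P_def nonzero_eq_divide_eq)
  have k1: "t * (N + 1) = 1 + t" "t * (N + 2 * bb) = 1 + 2 * bb * t" "t * (N + 1 - bb) = 1 + (1 - bb) * t"
    "t * (N + 1 + bb) = 1 + (1 + bb) * t"
    using tN by (simp_all add: algebra_simps)
  have "t * p' * ((1 + t) * (1 + 2 * bb * t)) = t ^ 3 * ((N + 1) * (N + 2 * bb) * p')"
    unfolding k1[symmetric] by (simp add: algebra_simps power3_eq_cube)
  also have "(N + 1) * (N + 2 * bb) * p' = (N + bb) * (N + 1 - bb) * (F1 + F2) + (1 - x) * (1 - y) * G - (x + y - 2 * x * y) * g"
    using rec_Euler_L3[OF xy, of "int n"] by (simp add: p'_def N_def F1_def F2_def g_def G_def)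
  also have "t ^ 3 * \<dots> = (t * (N + bb)) * (t * (N + 1 - bb)) * (t * (F1 + F2)) + (1 - x) * (1 - y) * (t ^ 3 * G) - (x + y - 2 * x * y) * t * (t\<^sup>2 * g)"
    by (simp add: algebra_simps power2_eq_square power3_eq_cube)
  finally have tp': "t * p' = pR bb x y t f v v'"
    unfolding tg kb k1 tp tG using nz by (simp add: pR_def P_def nonzero_eq_divide_eq)
  have "f' * ((1 + t) * (1 + 2 * bb * t)) = t\<^sup>2 * ((N + 1) * (N + 2 * bb) * f')"
    unfolding k1[symmetric] by (simp add: algebra_simps power2_eq_square)
  also have "(N + 1) * (N + 2 * bb) * f' = (N + bb) * (N + 1 - bb) * f + (1 - x) * (1 - y) * g"
    using rec_L3[OF xy, of "int n"] by (simp add: f'_def N_def f_def g_def)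
  also have "t\<^sup>2 * \<dots> = (t * (N + bb)) * (t * (N + 1 - bb)) * f + (1 - x) * (1 - y) * (t\<^sup>2 * g)"
    by (simp add: algebra_simps power2_eq_square)
  finally have tf': "f' = PhiF bb x y t f v v'"
    unfolding tg kb k1 using nz by (simp add: PhiF_def nonzero_eq_divide_eq)
  have Suc: "int (Suc n) = int n + 1" by simp
  show "slice_sum a (int (Suc n)) x y = PhiF bb x y (1 / of_nat n) (slice_sum a (int n) x y) (scaled_slice n x y) (scaled_slice (n - 1) x y)"
    using tf' unfolding Suc f'_def t_def N_def f_def v_def v'_def .
  define v'' where "v'' = scaled_slice (Suc n) x y"
  have "v'' = slice_sum b (int n + 1) x y / (N + 1)\<^sup>2"
    unfolding v''_def scaled_slice_def Suc by (simp add: N_def algebra_simps)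
  moreover have "N + 1 \<noteq> 0" using k1(1) nz(2) by auto
  ultimately have "v'' * (1 + t)\<^sup>2 = t\<^sup>2 * slice_sum b (int n + 1) x y"
    unfolding k1[symmetric] by (simp add: power_mult_distrib)
  then have "v'' * ((1 - x * y) * (1 + t)\<^sup>2) = t\<^sup>2 * ((1 - x * y) * slice_sum b (int n + 1) x y)"
    by (simp add: algebra_simps)
  also have "(1 - x * y) * slice_sum b (int n + 1) x y = - ((N + 1 + bb) * (p' + bb * f'))"
    using rec_J_sum[OF xy, of "int n + 1"] by (simp add: N_def p'_def f'_def algebra_simps)
  also have "t\<^sup>2 * \<dots> = - (t * (N + 1 + bb)) * (t * p' + bb * t * f')"
    by (simp add: algebra_simps power2_eq_square)
  finally have "v'' * ((1 - x * y) * (1 + t)\<^sup>2) = - (1 + (1 + bb) * t) * (pR bb x y t f v v' + bb * t * PhiF bb x y t f v v')"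
    unfolding k1 tp' tf' by simp
  then have "v'' = (- (1 + (1 + bb) * t) * (pR bb x y t f v v' + bb * t * PhiF bb x y t f v v')) / ((1 - x * y) * (1 + t)\<^sup>2)"
    using nz nz' by (subst nonzero_eq_divide_eq) auto
  then have "v'' = PhiV bb x y t f v v'" by (simp add: PhiV_def)
  then show "scaled_slice (Suc n) x y = PhiV bb x y (1 / of_nat n) (slice_sum a (int n) x y) (scaled_slice n x y) (scaled_slice (n - 1) x y)"
    unfolding v''_def t_def N_def f_def v_def v'_def .
qed

end

section \<open>Growth of the slice series\<close>

lemma slice_sum_bounded:
  assumes "tame c" "0 \<le> R" "R < 1"
  shows "\<exists>C. \<forall>x y. cmod x \<le> R \<longrightarrow> cmod y \<le> R \<longrightarrow> cmod (slice_sum c k x y) \<le> C"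
proof -
  have "subexp c k" "nonneg_supp c" using assms(1) by (auto simp: tame_def)
  from slice_dominated[OF this assms(2,3)] obtain M where M: "M summable_on UNIV"
    "\<And>x y n. norm x \<le> R \<Longrightarrow> norm y \<le> R \<Longrightarrow> norm (slice_arr c k n * arr_pow (vector [x, y, 1]) n) \<le> M n"
    by metis
  have "cmod (slice_sum c k x y) \<le> infsum M UNIV" if "cmod x \<le> R" "cmod y \<le> R" for x y
    using slice_sum_zser[OF assms(1), of x y k] that assms(3) M(2)[OF that] unfolding arr_series_def
    by (intro norm_infsum_le[OF _ has_sum_infsum[OF M(1)]]) auto
  then show ?thesis by blast
qed

lemma upd_vector3: "upd (vector [x, y, w]) 1 z = vector [z, y, w]" "upd (vector [x, y, w]) 2 z = vector [x, z, w]"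
  "upd (vector [x, y, w]) 3 z = vector [x, y, z]"
  by (simp_all add: vec3_eq_iff)

lemma slice_sum_holomorphic:
  assumes "tame c"
  shows "norm y < 1 \<Longrightarrow> (\<lambda>x. slice_sum c k x y) holomorphic_on ball 0 1"
    "norm x < 1 \<Longrightarrow> (\<lambda>y. slice_sum c k x y) holomorphic_on ball 0 1"
proof -
  assume y: "norm y < 1"
  have ser: "arr_series (slice_arr c k) (upd (vector [0, y, 1]) 1 z) (slice_sum c k z y)" if "norm z < 1" for z
    using slice_sum_zser[OF assms that y] by (simp add: upd_vector3)
  have "\<exists>d. ((\<lambda>x. slice_sum c k x y) has_field_derivative d) (at z)" if "norm z < 1" for z
    by (rule arr_series_deriv[where \<Phi> = "\<lambda>x. slice_sum c k x y", OF ser that]) blast+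
  then show "(\<lambda>x. slice_sum c k x y) holomorphic_on ball 0 1"
    by (simp add: holomorphic_on_open)
next
  assume x: "norm x < 1"
  have ser: "arr_series (slice_arr c k) (upd (vector [x, 0, 1]) 2 z) (slice_sum c k x z)" if "norm z < 1" for z
    using slice_sum_zser[OF assms x that] by (simp add: upd_vector3)
  have "\<exists>d. ((\<lambda>y. slice_sum c k x y) has_field_derivative d) (at z)" if "norm z < 1" for z
    by (rule arr_series_deriv[where \<Phi> = "\<lambda>y. slice_sum c k x y", OF ser that]) blast+
  then show "(\<lambda>y. slice_sum c k x y) holomorphic_on ball 0 1"
    by (simp add: holomorphic_on_open)
qed

context neighbor
begin

lemma slice_growth_scaled:
  assumes "\<delta> > 0" "\<epsilon> > 0"
  shows "\<exists>C\<ge>0. \<forall>n x y. \<delta> \<le> margin x \<longrightarrow> \<delta> \<le> margin y \<longrightarrow>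
    cmod (slice_sum a (int n) x y) \<le> C * (1 + \<epsilon>) ^ n \<and> cmod (scaled_slice n x y) \<le> C * (1 + \<epsilon>) ^ n"
proof -
  define K where "K = {(x, y). \<delta> \<le> margin x \<and> \<delta> \<le> margin y}"
  have lt1: "cmod x \<le> 1 - \<delta>" if "\<delta> \<le> margin x" for x using margin_le[of x] that by simp
  have Kxy: "cmod x < 1 \<and> cmod y < 1 \<and> x \<noteq> 1 \<and> y \<noteq> 1 \<and> x * y \<noteq> 1" if "(x, y) \<in> K" for x y
  proof -
    have *: "cmod x < 1" "cmod y < 1" using that lt1[of x] lt1[of y] assms(1) by (auto simp: K_def)
    then have "cmod (x * y) < 1 * 1" unfolding norm_mult by (intro mult_strict_mono') auto
    with * show ?thesis by auto
  qed
  \<comment> \<open>For \<delta> > 2 the bound of \<open>roots\<close> would be negative. The region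
    K is empty in that case, but q must still be nonnegative.\<close>
  define q where "q = max 0 (1 - \<delta>\<^sup>2 / 4)"
  have q: "0 \<le> q" "q < 1" using assms(1) by (auto simp: q_def)
  have main: "\<exists>C\<ge>0. \<forall>n. \<forall>p\<in>K. cmod (slice_sum a (int n) (fst p) (snd p)) \<le> C * (1 + \<epsilon>) ^ n \<and> cmod (scaled_slice n (fst p) (snd p)) \<le> C * (1 + \<epsilon>) ^ n"
  \<comment> \<open>The constant 4 bounds |1 - x| |1 - y| on the unit bidisc.\<close>
  proof (rule linear_recurrence_growth[OF q, of 4 K "\<lambda>p. root1 (fst p) (snd p)" "\<lambda>p. root2 (fst p) (snd p)" "\<lambda>p. (1 - fst p) * (1 - snd p)"])
    fix p assume p: "p \<in> K"
    obtain x y where xy: "p = (x, y)" by (cases p)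
    have "cmod ((1 - x) * (1 - y)) \<le> 2 * 2"
      unfolding norm_mult using Kxy[of x y] p xy norm_triangle_ineq4[of 1 x] norm_triangle_ineq4[of 1 y]
      by (intro mult_mono) auto
    then show "cmod (root1 (fst p) (snd p)) \<le> q \<and> cmod (root2 (fst p) (snd p)) \<le> q \<and> cmod ((1 - fst p) * (1 - snd p)) \<le> 4"
      using roots(1,2)[OF assms(1), of x y] p xy by (simp add: K_def q_def le_max_iff_disj)
  next
    fix \<eta> :: real assume \<eta>: "\<eta> > 0"
    have cK: "compact K" unfolding K_def by (rule lens_compact[OF assms(1)])
    obtain d where d: "d > 0" "d \<le> 1" "\<And>x y t f v v'. (x, y) \<in> K \<Longrightarrow> 0 \<le> t \<Longrightarrow> t < d \<Longrightarrow>
      cmod (PhiF bb x y (of_real t) f v v' - PhiF bb x y 0 f v v') \<le> \<eta> * (cmod f + cmod v + cmod v') \<and>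
      cmod (PhiV bb x y (of_real t) f v v' - PhiV bb x y 0 f v v') \<le> \<eta> * (cmod f + cmod v + cmod v')"
      using Phi_close[OF cK _ beta \<eta>] Kxy by blast
    obtain N where N: "real N > 1 / d" using reals_Archimedean2 by blast
    define n0 where "n0 = max 2 N"
    show "\<exists>n0\<ge>1. \<forall>n\<ge>n0. \<forall>p\<in>K.
      cmod (slice_sum a (int (Suc n)) (fst p) (snd p) - (slice_sum a (int n) (fst p) (snd p) + (1 - fst p) * (1 - snd p) * scaled_slice n (fst p) (snd p)))
        \<le> \<eta> * (cmod (slice_sum a (int n) (fst p) (snd p)) + cmod (scaled_slice n (fst p) (snd p)) + cmod (scaled_slice (n - 1) (fst p) (snd p))) \<and>
      cmod (scaled_slice (Suc n) (fst p) (snd p) - ((root1 (fst p) (snd p) + root2 (fst p) (snd p)) * scaled_slice n (fst p) (snd p)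
          - root1 (fst p) (snd p) * root2 (fst p) (snd p) * scaled_slice (n - 1) (fst p) (snd p)))
        \<le> \<eta> * (cmod (slice_sum a (int n) (fst p) (snd p)) + cmod (scaled_slice n (fst p) (snd p)) + cmod (scaled_slice (n - 1) (fst p) (snd p)))"
    proof (intro exI[of _ n0] conjI allI impI ballI)
      show "1 \<le> n0" by (simp add: n0_def)
      fix n p assume n: "n0 \<le> n" and "p \<in> K"
      obtain x y where p: "p = (x, y)" by (cases p)
      have xyK: "(x, y) \<in> K" using p \<open>p \<in> K\<close> by simp
      note nz = Kxy[OF xyK]
      have n2: "n \<ge> 2" using n by (simp add: n0_def)
      have "1 / d < real n" using N n by (simp add: n0_def)
      then have t: "1 / real n < d" using d(1) n2 by (simp add: field_simps)
      note rec = Phi_recurrence[of x y n, OF _ _ n2]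
      note cl = d(3)[OF xyK _ t, of "slice_sum a (int n) x y" "scaled_slice n x y" "scaled_slice (n - 1) x y"]
      have r: "root1 x y + root2 x y = 2 * ((x + y) * (1 + x * y) - 4 * (x * y)) / (1 - x * y)\<^sup>2"
        "root1 x y * root2 x y = ((x - y) / (1 - x * y))\<^sup>2"
        using roots(3,4)[OF assms(1), of x y] xyK by (simp_all add: K_def)
      show "cmod (slice_sum a (int (Suc n)) (fst p) (snd p) - (slice_sum a (int n) (fst p) (snd p) + (1 - fst p) * (1 - snd p) * scaled_slice n (fst p) (snd p)))
        \<le> \<eta> * (cmod (slice_sum a (int n) (fst p) (snd p)) + cmod (scaled_slice n (fst p) (snd p)) + cmod (scaled_slice (n - 1) (fst p) (snd p)))"
        using cl rec nz unfolding p by (simp add: Phi_at_0)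
      show "cmod (scaled_slice (Suc n) (fst p) (snd p) - ((root1 (fst p) (snd p) + root2 (fst p) (snd p)) * scaled_slice n (fst p) (snd p)
          - root1 (fst p) (snd p) * root2 (fst p) (snd p) * scaled_slice (n - 1) (fst p) (snd p)))
        \<le> \<eta> * (cmod (slice_sum a (int n) (fst p) (snd p)) + cmod (scaled_slice n (fst p) (snd p)) + cmod (scaled_slice (n - 1) (fst p) (snd p)))"
        using cl rec nz unfolding p fst_conv snd_conv r by (simp add: Phi_at_0(2))
    qed
  next
    fix n
    show "\<exists>C. \<forall>p\<in>K. cmod (slice_sum a (int n) (fst p) (snd p)) \<le> C \<and> cmod (scaled_slice n (fst p) (snd p)) \<le> C"
    proof (cases "\<delta> \<le> 1")
      case True
      have *: "0 \<le> 1 - \<delta>" "1 - \<delta> < 1" using True assms(1) by auto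
      obtain C1 C2 where C: "\<And>x y. cmod x \<le> 1 - \<delta> \<Longrightarrow> cmod y \<le> 1 - \<delta> \<Longrightarrow> cmod (slice_sum a (int n) x y) \<le> C1"
        "\<And>x y. cmod x \<le> 1 - \<delta> \<Longrightarrow> cmod y \<le> 1 - \<delta> \<Longrightarrow> cmod (slice_sum b (int n) x y) \<le> C2"
        using slice_sum_bounded[OF tame_a *, of "int n"] slice_sum_bounded[OF tame_b *, of "int n"] by metis
      show ?thesis
      proof (intro exI[of _ "max C1 (C2 / (real n)\<^sup>2)"] ballI)
        fix p assume "p \<in> K"
        then obtain x y where p: "p = (x, y)" "cmod x \<le> 1 - \<delta>" "cmod y \<le> 1 - \<delta>"
          using lt1 by (auto simp: K_def)
        have "cmod (scaled_slice n x y) \<le> C2 / (real n)\<^sup>2"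
          using C(2)[OF p(2,3)] by (simp add: scaled_slice_def norm_divide norm_power divide_right_mono)
        then show "cmod (slice_sum a (int n) (fst p) (snd p)) \<le> max C1 (C2 / (real n)\<^sup>2) \<and> cmod (scaled_slice n (fst p) (snd p)) \<le> max C1 (C2 / (real n)\<^sup>2)"
          using C(1)[OF p(2,3)] by (simp add: p(1) le_max_iff_disj)
      qed
    next
      case False
      have "K = {}"
      proof (rule equals0I)
        fix p assume "p \<in> K"
        then obtain x where "cmod x \<le> 1 - \<delta>" using lt1 by (auto simp: K_def)
        with norm_ge_zero[of x] False show False by linarith
      qed
      then show ?thesis by simp
    qed
  qed (use assms(2) in auto)
  then obtain C where "C \<ge> 0" "\<And>n p. p \<in> K \<Longrightarrow> cmod (slice_sum a (int n) (fst p) (snd p)) \<le> C * (1 + \<epsilon>) ^ n \<and> cmod (scaled_slice n (fst p) (snd p)) \<le> C * (1 + \<epsilon>) ^ n"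
    by blast
  from this(1) this(2)[of "(_, _)"] show ?thesis
    by (intro exI[of _ C]) (auto simp: K_def)
qed

lemma slice_growth:
  assumes "\<delta> > 0" "\<sigma> > 1"
  shows "\<exists>C\<ge>0. \<forall>n x y. \<delta> \<le> margin x \<longrightarrow> \<delta> \<le> margin y \<longrightarrow>
    cmod (slice_sum a (int n) x y) \<le> C * \<sigma> ^ n \<and> cmod (slice_sum b (int n) x y) \<le> C * \<sigma> ^ n"
proof -
  \<comment> \<open>One factor s^n is the growth of the scaled slice; the other two absorb the n^2
    lost in the scaling, through Bernoulli's bound n \<epsilon> \<le> s^n.\<close>
  define s where "s = root 3 \<sigma>"
  define \<epsilon> where "\<epsilon> = s - 1"
  have s: "s > 1" "s ^ 3 = \<sigma>" using assms(2) by (simp_all add: s_def real_root_gt_1_iff)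
  have \<epsilon>: "\<epsilon> > 0" using s by (simp add: \<epsilon>_def)
  obtain C where C: "C \<ge> 0" "\<And>n x y. \<delta> \<le> margin x \<Longrightarrow> \<delta> \<le> margin y \<Longrightarrow>
    cmod (slice_sum a (int n) x y) \<le> C * s ^ n \<and> cmod (scaled_slice n x y) \<le> C * s ^ n"
    using slice_growth_scaled[OF assms(1) \<epsilon>] by (auto simp: \<epsilon>_def)
  \<comment> \<open>The scaled slice carries no information at n = 0, so that slice of B is bounded
    directly. For \<delta> > 1 the region is empty, since the margin never exceeds 1.\<close>
  obtain C0 where C0: "\<And>x y. \<delta> \<le> margin x \<Longrightarrow> \<delta> \<le> margin y \<Longrightarrow> cmod (slice_sum b 0 x y) \<le> C0"
  proof (cases "\<delta> \<le> 1")
    case True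
    then obtain C0 where "\<And>x y. cmod x \<le> 1 - \<delta> \<Longrightarrow> cmod y \<le> 1 - \<delta> \<Longrightarrow> cmod (slice_sum b 0 x y) \<le> C0"
      using slice_sum_bounded[OF tame_b, of "1 - \<delta>" 0] assms(1) by auto
    moreover have "cmod x \<le> 1 - \<delta>" if "\<delta> \<le> margin x" for x using margin_le[of x] that by simp
    ultimately show ?thesis using that by blast
  next
    case False
    have "\<not> \<delta> \<le> margin x" for x using margin_le[of x] norm_ge_zero[of x] False by linarith
    then show ?thesis using that by blast
  qed
  define D where "D = max C (max C0 (C / \<epsilon>\<^sup>2))"
  have D: "D \<ge> 0" "C \<le> D" "C0 \<le> D" "C / \<epsilon>\<^sup>2 \<le> D" using C(1) by (auto simp: D_def)
  have sn: "s ^ n \<le> \<sigma> ^ n" for n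
  proof -
    have "s ^ n \<le> s ^ (3 * n)" using s by (intro power_increasing) auto
    then show ?thesis by (simp add: power_mult s)
  qed
  have "cmod (slice_sum a (int n) x y) \<le> D * \<sigma> ^ n \<and> cmod (slice_sum b (int n) x y) \<le> D * \<sigma> ^ n"
    if m: "\<delta> \<le> margin x" "\<delta> \<le> margin y" for n x y
  proof
    have "C * s ^ n \<le> D * \<sigma> ^ n" using D sn[of n] s by (intro mult_mono) auto
    then show "cmod (slice_sum a (int n) x y) \<le> D * \<sigma> ^ n" using C(2)[OF m, of n] by linarith
    show "cmod (slice_sum b (int n) x y) \<le> D * \<sigma> ^ n"
    proof (cases "n = 0")
      case True
      then show ?thesis using C0[OF m] D by simp
    next
      case False
      have "1 + real n * \<epsilon> \<le> (1 + \<epsilon>) ^ n" using \<epsilon> by (intro Bernoulli_inequality) auto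
      then have "real n * \<epsilon> \<le> s ^ n" by (simp add: \<epsilon>_def)
      then have "(real n * \<epsilon>)\<^sup>2 \<le> (s ^ n)\<^sup>2" using \<epsilon> by (intro power_mono) auto
      then have n2: "(real n)\<^sup>2 \<le> (s ^ n)\<^sup>2 / \<epsilon>\<^sup>2" using \<epsilon> by (simp add: power_mult_distrib pos_le_divide_eq)
      have "cmod (slice_sum b (int n) x y) = (real n)\<^sup>2 * cmod (scaled_slice n x y)"
        using False by (simp add: scaled_slice_def norm_divide norm_power)
      also have "\<dots> \<le> ((s ^ n)\<^sup>2 / \<epsilon>\<^sup>2) * (C * s ^ n)"
        using n2 C(2)[OF m, of n] by (intro mult_mono) auto
      also have "\<dots> = C / \<epsilon>\<^sup>2 * \<sigma> ^ n"
      proof -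
        have "\<sigma> ^ n = (s ^ n) ^ 3" by (simp add: s(2)[symmetric] power_mult[symmetric] mult.commute)
        then show ?thesis by (simp add: power2_eq_square power3_eq_cube)
      qed
      also have "\<dots> \<le> D * \<sigma> ^ n" using D assms(2) by (intro mult_right_mono) auto
      finally show ?thesis .
    qed
  qed
  with D(1) show ?thesis by blast
qed

end

section \<open>Taylor coefficients depending on parameters\<close>

text \<open>The parameter type is arbitrary so that one notion serves pairs of variables, a single
  variable and, with \<open>unit\<close>, no parameter at all.\<close>

definition taylor_coeff :: "('p \<Rightarrow> complex \<Rightarrow> complex) \<Rightarrow> complex \<Rightarrow> nat \<Rightarrow> 'p \<Rightarrow> complex" where
  "taylor_coeff f a k p = (deriv ^^ k) (f p) a / fact k"

lemma taylor_coeff_sums: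
  assumes "f p holomorphic_on ball a \<rho>" "z \<in> ball a \<rho>"
  shows "(\<lambda>k. taylor_coeff f a k p * (z - a) ^ k) sums f p z"
  unfolding taylor_coeff_def by (rule holomorphic_power_series[OF assms])

lemma taylor_coeff_bound:
  assumes hol: "f p holomorphic_on ball a \<rho>" and M: "\<And>z. z \<in> ball a \<rho> \<Longrightarrow> cmod (f p z) \<le> M" and "\<rho> > 0"
  shows "cmod (taylor_coeff f a k p) \<le> M / \<rho> ^ k"
proof -
  have r: "cmod (taylor_coeff f a k p) * r ^ k \<le> M" if r: "0 < r" "r < \<rho>" for r
  proof -
    have "cmod ((deriv ^^ k) (f p) a) \<le> fact k * M / r ^ k"
    proof (rule Cauchy_inequality)
      show "f p holomorphic_on ball a r" using hol r by (auto intro: holomorphic_on_subset)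
      show "continuous_on (cball a r) (f p)"
        using hol r by (intro holomorphic_on_imp_continuous_on holomorphic_on_subset[OF hol]) auto
      show "cmod (f p x) \<le> M" if "cmod (a - x) = r" for x
        using that r by (intro M) (simp add: dist_norm)
    qed (use r in auto)
    then show ?thesis using r by (simp add: taylor_coeff_def norm_divide field_simps)
  qed
  \<comment> \<open>The function is bounded on the open ball only, so Cauchy's inequality is applied
    at radii r < \<rho> and the estimate is extended to \<rho> by a limit.\<close>
  have "((\<lambda>r. cmod (taylor_coeff f a k p) * r ^ k) \<longlongrightarrow> cmod (taylor_coeff f a k p) * \<rho> ^ k) (at_left \<rho>)"
    by (intro tendsto_intros)
  moreover have "eventually (\<lambda>r. cmod (taylor_coeff f a k p) * r ^ k \<le> M) (at_left \<rho>)"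
    using eventually_at_left_real[OF \<open>\<rho> > 0\<close>] by eventually_elim (use r in auto)
  ultimately have "cmod (taylor_coeff f a k p) * \<rho> ^ k \<le> M"
    by (rule tendsto_upperbound) simp
  then show ?thesis using \<open>\<rho> > 0\<close> by (simp add: field_simps)
qed

text \<open>
  The k-th Taylor coefficient is the uniform limit, as h tends to 0, of the quotients of
  \<open>f - \<Sum>i<k. c_i h^i\<close> by \<open>h^k\<close>; hence it inherits holomorphy in the parameter.
\<close>

lemma taylor_coeff_holomorphic:
  fixes f :: "'p \<Rightarrow> complex \<Rightarrow> complex" and \<phi> :: "complex \<Rightarrow> 'p"
  assumes hol: "\<And>p. p \<in> P \<Longrightarrow> f p holomorphic_on ball a \<rho>"
    and M: "\<And>p z. p \<in> P \<Longrightarrow> z \<in> ball a \<rho> \<Longrightarrow> cmod (f p z) \<le> M"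
    and "\<rho> > 0" and S: "open S" "\<And>s. s \<in> S \<Longrightarrow> \<phi> s \<in> P"
    and par: "\<And>z. z \<in> ball a \<rho> \<Longrightarrow> (\<lambda>s. f (\<phi> s) z) holomorphic_on S"
  shows "(\<lambda>s. taylor_coeff f a k (\<phi> s)) holomorphic_on S"
proof (induction k rule: less_induct)
  case (less k)
  \<comment> \<open>Steps inside the disc that tend to 0. With \<theta> = 1 / (j + 2) the tail of
    the expansion is geometric with sum \<theta> / (1 - \<theta>) = 1 / (j + 1), a bound uniform in
    the parameter.\<close>
  define h where "h j = \<rho> / of_nat (j + 2)" for j :: nat
  have h: "0 < h j" "h j < \<rho>" for j
    using \<open>\<rho> > 0\<close> mult_strict_left_mono[of 1 "real j + 2" \<rho>] by (simp_all add: h_def pos_divide_less_eq add.commute)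
  define H where "H j = complex_of_real (h j)" for j
  have H: "a + H j \<in> ball a \<rho>" "H j \<noteq> 0" "cmod (H j) = h j" for j
    using h[of j] by (auto simp: H_def dist_norm)
  define g where "g j s = (f (\<phi> s) (a + H j) - (\<Sum>i<k. taylor_coeff f a i (\<phi> s) * H j ^ i)) / H j ^ k" for j s
  have est: "cmod (g j s - taylor_coeff f a k (\<phi> s)) \<le> \<bar>M\<bar> / \<rho> ^ k / (real j + 1)" if s: "s \<in> S" for j s
  proof -
    define c where "c i = taylor_coeff f a i (\<phi> s)" for i
    have cb: "cmod (c i) \<le> \<bar>M\<bar> / \<rho> ^ i" for i
    proof -
      have "cmod (c i) \<le> M / \<rho> ^ i" unfolding c_def
        by (intro taylor_coeff_bound hol M S(2) s \<open>\<rho> > 0\<close>)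
      also have "\<dots> \<le> \<bar>M\<bar> / \<rho> ^ i" using \<open>\<rho> > 0\<close> by (intro divide_right_mono) auto
      finally show ?thesis .
    qed
    have "(\<lambda>i. c i * H j ^ i) sums f (\<phi> s) (a + H j)"
      using taylor_coeff_sums[of f "\<phi> s", OF hol[OF S(2)[OF s]] H(1)[of j]] by (simp add: c_def)
    then have "(\<lambda>i. c (i + k) * H j ^ (i + k)) sums (f (\<phi> s) (a + H j) - (\<Sum>i<k. c i * H j ^ i))"
      by (subst sums_iff_shift) simp
    then have "(\<lambda>i. c (i + k) * H j ^ (i + k) / H j ^ k) sums g j s"
      unfolding g_def c_def by (rule sums_divide)
    also have "(\<lambda>i. c (i + k) * H j ^ (i + k) / H j ^ k) = (\<lambda>i. c (i + k) * H j ^ i)"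
      using H(2)[of j] by (simp add: power_add)
    finally have "(\<lambda>i. c (Suc i + k) * H j ^ Suc i) sums (g j s - c k)"
      by (subst sums_Suc_iff) simp
    then have eq: "g j s - c k = (\<Sum>i. c (Suc i + k) * H j ^ Suc i)" by (rule sums_unique)
    define \<theta> where "\<theta> = 1 / (real j + 2)"
    have \<theta>: "0 < \<theta>" "\<theta> < 1" "h j = \<rho> * \<theta>" by (auto simp: \<theta>_def h_def)
    have "norm (c (Suc i + k) * H j ^ Suc i) \<le> \<bar>M\<bar> / \<rho> ^ k * \<theta> * \<theta> ^ i" for i
    proof -
      have "norm (c (Suc i + k) * H j ^ Suc i) \<le> \<bar>M\<bar> / \<rho> ^ (Suc i + k) * h j ^ Suc i"
        unfolding norm_mult norm_power H(3) by (rule mult_right_mono[OF cb]) (use h(1)[of j] in simp)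
      also have "\<dots> = \<bar>M\<bar> / \<rho> ^ k * \<theta> * \<theta> ^ i"
        using \<open>\<rho> > 0\<close> by (simp add: \<theta>(3) power_mult_distrib power_add)
      finally show ?thesis .
    qed
    moreover have gs: "(\<lambda>i. \<bar>M\<bar> / \<rho> ^ k * \<theta> * \<theta> ^ i) sums (\<bar>M\<bar> / \<rho> ^ k * \<theta> * (1 / (1 - \<theta>)))"
      using \<theta> by (intro sums_mult geometric_sums) simp
    ultimately have "norm (\<Sum>i. c (Suc i + k) * H j ^ Suc i) \<le> (\<Sum>i. \<bar>M\<bar> / \<rho> ^ k * \<theta> * \<theta> ^ i)"
      by (intro norm_suminf_le sums_summable)
    also have "\<dots> = \<bar>M\<bar> / \<rho> ^ k * (\<theta> * (1 / (1 - \<theta>)))"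
      using sums_unique[OF gs] by (simp add: mult.assoc)
    also have "\<theta> * (1 / (1 - \<theta>)) = 1 / (real j + 1)" by (simp add: \<theta>_def field_simps)
    finally have "norm (g j s - c k) \<le> \<bar>M\<bar> / \<rho> ^ k * (1 / (real j + 1))" unfolding eq .
    then show ?thesis by (simp add: c_def)
  qed
  have ul: "uniform_limit S g (\<lambda>s. taylor_coeff f a k (\<phi> s)) sequentially"
  proof (rule uniform_limitI)
    fix e :: real assume "e > 0"
    have "(\<lambda>j. \<bar>M\<bar> / \<rho> ^ k / (real j + 1)) \<longlonglongrightarrow> 0" by real_asymp
    then have "eventually (\<lambda>j. \<bar>M\<bar> / \<rho> ^ k / (real j + 1) < e) sequentially"
      using \<open>e > 0\<close> by (rule order_tendstoD)
    then show "\<forall>\<^sub>F j in sequentially. \<forall>s\<in>S. dist (g j s) (taylor_coeff f a k (\<phi> s)) < e"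
      by eventually_elim (use est in \<open>auto simp: dist_norm intro: le_less_trans\<close>)
  qed
  show ?case
  proof (rule holomorphic_uniform_sequence[OF S(1)])
    have "(\<lambda>s. (f (\<phi> s) (a + H j) - (\<Sum>i<k. taylor_coeff f a i (\<phi> s) * H j ^ i)) / H j ^ k) holomorphic_on S" for j
      by (intro holomorphic_intros par H(1) less.IH) (use H(2) in auto)
    then show "g j holomorphic_on S" for j
      by (simp add: g_def[abs_def])
    show "\<exists>d>0. cball x d \<subseteq> S \<and> uniform_limit (cball x d) g (\<lambda>s. taylor_coeff f a k (\<phi> s)) sequentially" if "x \<in> S" for x
      using that S(1) uniform_limit_on_subset[OF ul] by (meson open_contains_cball)
  qed
qed

lemma power_series_has_sum:
  fixes c :: "nat \<Rightarrow> complex"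
  assumes "(\<lambda>n. c n * z ^ n) sums s" "\<And>n. cmod (c n) \<le> M / \<rho> ^ n" "cmod z < \<rho>"
  shows "((\<lambda>n. c n * z ^ n) has_sum s) UNIV"
proof (rule norm_summable_imp_has_sum[OF _ assms(1)])
  have \<rho>: "\<rho> > 0" using assms(3) norm_ge_zero[of z] by linarith
  have A: "summable (\<lambda>n. M * (cmod z / \<rho>) ^ n)"
    using assms(3) \<rho> by (intro summable_mult summable_geometric) (auto simp: norm_divide)
  have B: "norm (norm (c n * z ^ n)) \<le> M * (cmod z / \<rho>) ^ n" for n
    using mult_right_mono[OF assms(2)[of n], of "cmod z ^ n"] by (simp add: norm_mult norm_power power_divide)
  show "summable (\<lambda>n. norm (c n * z ^ n))"
    by (rule summable_comparison_test'[OF A, where N = 0]) (rule B)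
qed

text \<open>Osgood's lemma for bounded functions: the Taylor expansion is iterated over the variables.\<close>

lemma osgood3:
  fixes f :: "complex \<Rightarrow> complex \<Rightarrow> complex \<Rightarrow> complex"
  assumes "\<rho> > 0"
    and M: "\<And>x y z. x \<in> ball a1 \<rho> \<Longrightarrow> y \<in> ball a2 \<rho> \<Longrightarrow> z \<in> ball a3 \<rho> \<Longrightarrow> cmod (f x y z) \<le> M"
    and h1: "\<And>y z. y \<in> ball a2 \<rho> \<Longrightarrow> z \<in> ball a3 \<rho> \<Longrightarrow> (\<lambda>x. f x y z) holomorphic_on ball a1 \<rho>"
    and h2: "\<And>x z. x \<in> ball a1 \<rho> \<Longrightarrow> z \<in> ball a3 \<rho> \<Longrightarrow> (\<lambda>y. f x y z) holomorphic_on ball a2 \<rho>"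
    and h3: "\<And>x y. x \<in> ball a1 \<rho> \<Longrightarrow> y \<in> ball a2 \<rho> \<Longrightarrow> (\<lambda>z. f x y z) holomorphic_on ball a3 \<rho>"
  obtains c :: "nat \<Rightarrow> nat \<Rightarrow> nat \<Rightarrow> complex" where
    "\<And>x y z. x \<in> ball a1 \<rho> \<Longrightarrow> y \<in> ball a2 \<rho> \<Longrightarrow> z \<in> ball a3 \<rho> \<Longrightarrow>
      ((\<lambda>(k, j, i). c k j i * (x - a1) ^ i * (y - a2) ^ j * (z - a3) ^ k) has_sum f x y z) UNIV"
proof -
  \<comment> \<open>Every expansion needs a bound as well as holomorphy in the remaining variables:
    the bound M / \<rho>^k on the coefficients in one variable takes the place of M in the next. The
    third variable is expanded first and is the outermost summation index.\<close>
  define c3 where "c3 k x y = taylor_coeff (\<lambda>(x, y). f x y) a3 k (x, y)" for k x y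
  define c2 where "c2 k j x = taylor_coeff (c3 k) a2 j x" for k j x
  define c1 where "c1 k j i = taylor_coeff (\<lambda>_ :: unit. c2 k j) a1 i ()" for k j i
  have s3: "(\<lambda>k. c3 k x y * (z - a3) ^ k) sums f x y z" if "x \<in> ball a1 \<rho>" "y \<in> ball a2 \<rho>" "z \<in> ball a3 \<rho>" for x y z
    using taylor_coeff_sums[of "\<lambda>(x, y). f x y" "(x, y)" a3 \<rho> z] h3 that by (simp add: c3_def)
  have b3: "cmod (c3 k x y) \<le> M / \<rho> ^ k" if "x \<in> ball a1 \<rho>" "y \<in> ball a2 \<rho>" for k x y
    using taylor_coeff_bound[of "\<lambda>(x, y). f x y" "(x, y)" a3 \<rho> M] h3 M that \<open>\<rho> > 0\<close> by (simp add: c3_def)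
  have h3x: "(\<lambda>x. c3 k x y) holomorphic_on ball a1 \<rho>" if y: "y \<in> ball a2 \<rho>" for k y
    unfolding c3_def
    by (rule taylor_coeff_holomorphic[where P = "ball a1 \<rho> \<times> ball a2 \<rho>" and \<rho> = \<rho> and M = M and \<phi> = "\<lambda>x. (x, y)"])
      (use h1 h3 M \<open>\<rho> > 0\<close> y in auto)
  have h3y: "(\<lambda>y. c3 k x y) holomorphic_on ball a2 \<rho>" if x: "x \<in> ball a1 \<rho>" for k x
    unfolding c3_def
    by (rule taylor_coeff_holomorphic[where P = "ball a1 \<rho> \<times> ball a2 \<rho>" and \<rho> = \<rho> and M = M and \<phi> = "\<lambda>y. (x, y)"])
      (use h2 h3 M \<open>\<rho> > 0\<close> x in auto)
  have s2: "(\<lambda>j. c2 k j x * (y - a2) ^ j) sums c3 k x y" if "x \<in> ball a1 \<rho>" "y \<in> ball a2 \<rho>" for k x y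
    unfolding c2_def using h3y that by (intro taylor_coeff_sums)
  have b2: "cmod (c2 k j x) \<le> M / \<rho> ^ k / \<rho> ^ j" if "x \<in> ball a1 \<rho>" for k j x
    unfolding c2_def using h3y b3 that \<open>\<rho> > 0\<close> by (intro taylor_coeff_bound)
  have h2x: "(\<lambda>x. c2 k j x) holomorphic_on ball a1 \<rho>" for k j
    unfolding c2_def
    by (rule taylor_coeff_holomorphic[where P = "ball a1 \<rho>" and \<rho> = \<rho> and M = "M / \<rho> ^ k" and \<phi> = "\<lambda>x. x"])
      (use h3x h3y b3 \<open>\<rho> > 0\<close> in auto)
  have s1: "(\<lambda>i. c1 k j i * (x - a1) ^ i) sums c2 k j x" if "x \<in> ball a1 \<rho>" for k j x
    unfolding c1_def using taylor_coeff_sums[of "\<lambda>_ :: unit. c2 k j" "()", OF h2x that] .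
  have b1: "cmod (c1 k j i) \<le> M / \<rho> ^ k / \<rho> ^ j / \<rho> ^ i" for k j i
    unfolding c1_def using h2x b2 \<open>\<rho> > 0\<close> by (intro taylor_coeff_bound)
  show ?thesis
  proof (rule that)
    fix x y z assume xyz: "x \<in> ball a1 \<rho>" "y \<in> ball a2 \<rho>" "z \<in> ball a3 \<rho>"
    define X where "X = x - a1"
    define Y where "Y = y - a2"
    define Z where "Z = z - a3"
    have n: "cmod X < \<rho>" "cmod Y < \<rho>" "cmod Z < \<rho>"
      using xyz by (auto simp: X_def Y_def Z_def dist_norm norm_minus_commute)
    define u v w where "u = cmod X / \<rho>" and "v = cmod Y / \<rho>" and "w = cmod Z / \<rho>"
    have uvw: "0 \<le> u" "u < 1" "0 \<le> v" "v < 1" "0 \<le> w" "w < 1"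
      using n \<open>\<rho> > 0\<close> by (auto simp: u_def v_def w_def)
    have g: "(\<lambda>i. u ^ i) summable_on UNIV" "(\<lambda>i. v ^ i) summable_on UNIV" "(\<lambda>i. w ^ i) summable_on UNIV"
      using geometric_has_sum[of u] geometric_has_sum[of v] geometric_has_sum[of w] uvw
      by (auto simp: summable_on_def)
    have g2: "(\<lambda>(j, i). v ^ j * u ^ i) summable_on UNIV"
      using summable_on_times_nonneg[OF g(2,1)] uvw by simp
    have "(\<lambda>(k, ji). w ^ k * (case ji of (j, i) \<Rightarrow> v ^ j * u ^ i)) summable_on UNIV"
      using summable_on_times_nonneg[OF g(3) g2] uvw by auto
    then have gg: "(\<lambda>p. M * (case p of (k, j, i) \<Rightarrow> w ^ k * (v ^ j * u ^ i))) summable_on UNIV"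
      by (intro summable_on_cmult_right) (simp add: case_prod_unfold)
    have nb: "norm (case p of (k, j, i) \<Rightarrow> c1 k j i * X ^ i * Y ^ j * Z ^ k) \<le> M * (case p of (k, j, i) \<Rightarrow> w ^ k * (v ^ j * u ^ i))" for p
    proof -
      obtain k j i where p: "p = (k, j, i)" by (cases p)
      have "cmod (c1 k j i) * (cmod X ^ i * cmod Y ^ j * cmod Z ^ k) \<le> M / \<rho> ^ k / \<rho> ^ j / \<rho> ^ i * (cmod X ^ i * cmod Y ^ j * cmod Z ^ k)"
        by (intro mult_right_mono b1) auto
      then show ?thesis
        by (simp add: p norm_mult norm_power u_def v_def w_def power_divide mult_ac)
    qed
    have "(\<lambda>p. norm (case p of (k, j, i) \<Rightarrow> c1 k j i * X ^ i * Y ^ j * Z ^ k)) summable_on UNIV"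
      by (rule Infinite_Sum.abs_summable_on_comparison_test'[OF gg]) (rule nb)
    then have summ: "(\<lambda>(k, j, i). c1 k j i * X ^ i * Y ^ j * Z ^ k) summable_on UNIV"
      by (rule abs_summable_summable)
    have "((\<lambda>(k, ji). case ji of (j, i) \<Rightarrow> c1 k j i * X ^ i * Y ^ j * Z ^ k) has_sum f x y z) (UNIV \<times> UNIV)"
    proof (rule has_sum_SigmaI)
      show "((\<lambda>k. c3 k x y * Z ^ k) has_sum f x y z) UNIV"
        by (rule power_series_has_sum[where M = M, OF _ _ n(3)]) (use s3[OF xyz] b3[OF xyz(1,2)] in \<open>auto simp: Z_def\<close>)
      show "((\<lambda>ji. case (k, ji) of (k, ji) \<Rightarrow> case ji of (j, i) \<Rightarrow> c1 k j i * X ^ i * Y ^ j * Z ^ k) has_sum c3 k x y * Z ^ k) UNIV" for k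
      proof -
        have "((\<lambda>(j, i). c1 k j i * X ^ i * Y ^ j * Z ^ k) has_sum c3 k x y * Z ^ k) (UNIV \<times> UNIV)"
        proof (rule has_sum_SigmaI)
          have "((\<lambda>j. c2 k j x * Y ^ j) has_sum c3 k x y) UNIV"
            by (rule power_series_has_sum[where M = "M / \<rho> ^ k", OF _ _ n(2)]) (use s2[OF xyz(1,2)] b2[OF xyz(1)] in \<open>auto simp: Y_def\<close>)
          then show "((\<lambda>j. c2 k j x * Y ^ j * Z ^ k) has_sum c3 k x y * Z ^ k) UNIV"
            by (rule has_sum_cmult_left)
          have "((\<lambda>i. c1 k j i * X ^ i) has_sum c2 k j x) UNIV" for j
            by (rule power_series_has_sum[where M = "M / \<rho> ^ k / \<rho> ^ j", OF _ _ n(1)]) (use s1[OF xyz(1)] b1 in \<open>auto simp: X_def\<close>)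
          then have "((\<lambda>i. c1 k j i * X ^ i * Y ^ j * Z ^ k) has_sum c2 k j x * Y ^ j * Z ^ k) UNIV" for j
            by (intro has_sum_cmult_left)
          then show "((\<lambda>i. case (j, i) of (j, i) \<Rightarrow> c1 k j i * X ^ i * Y ^ j * Z ^ k) has_sum c2 k j x * Y ^ j * Z ^ k) UNIV" for j
            by simp
          show "(\<lambda>(j, i). c1 k j i * X ^ i * Y ^ j * Z ^ k) summable_on UNIV \<times> UNIV"
            using summable_on_SigmaD1[of "\<lambda>k ji. case ji of (j, i) \<Rightarrow> c1 k j i * X ^ i * Y ^ j * Z ^ k" UNIV "\<lambda>_. UNIV" k] summ
            by (simp add: case_prod_unfold)
        qed
        then show ?thesis by simp
      qed
      show "(\<lambda>(k, ji). case ji of (j, i) \<Rightarrow> c1 k j i * X ^ i * Y ^ j * Z ^ k) summable_on UNIV \<times> UNIV"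
        using summ by simp
    qed
    then show "((\<lambda>(k, j, i). c1 k j i * (x - a1) ^ i * (y - a2) ^ j * (z - a3) ^ k) has_sum f x y z) UNIV"
      by (simp add: X_def Y_def Z_def)
  qed
qed

section \<open>Cauchy estimates for the coefficients of a given series\<close>

lemma power_series_coeff_bound:
  fixes c :: "nat \<Rightarrow> complex"
  assumes sums: "\<And>z. cmod z < R \<Longrightarrow> (\<lambda>n. c n * z ^ n) sums f z" and M: "\<And>z. cmod z < R \<Longrightarrow> cmod (f z) \<le> M" and "R > 0"
  shows "cmod (c n) \<le> M / R ^ n"
proof -
  have hol: "f holomorphic_on ball 0 R"
    by (rule power_series_holomorphic[where a = c]) (use sums in simp)
  define t where "t n = taylor_coeff (\<lambda>_ :: unit. f) 0 n ()" for n
  have ts: "(\<lambda>n. t n * z ^ n) sums f z" if "cmod z < R" for z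
    using taylor_coeff_sums[of "\<lambda>_ :: unit. f" "()", OF hol, of z] that by (simp add: t_def)
  have z: "(\<lambda>n. (c n - t n) * (x - 0) ^ n) sums 0" if "norm (x - 0) < R" for x
    using sums_diff[OF sums[of x] ts[of x]] that by (simp add: left_diff_distrib)
  \<comment> \<open>Uniqueness of the expansion: the difference series sums to 0 throughout the
    disc, whereas a nonzero coefficient of positive index would make the zero at the centre
    isolated. The index 0 is read off at the centre itself.\<close>
  have "c n = t n"
  proof (rule ccontr)
    assume ne: "c n \<noteq> t n"
    show False
    proof (cases "n = 0")
      case True
      have "(\<lambda>n. (c n - t n) * 0 ^ n) sums (\<Sum>n\<in>{0}. (c n - t n) * 0 ^ n)"
        by (rule sums_finite) auto
      moreover have "(\<lambda>n. (c n - t n) * 0 ^ n) sums 0" using z[of 0] \<open>R > 0\<close> by simp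
      ultimately have "(\<Sum>n\<in>{0}. (c n - t n) * 0 ^ n) = 0" by (rule sums_unique2)
      with ne True show False by simp
    next
      case False
      show False
      proof (rule powser_0_nonzero[where a = "\<lambda>n. c n - t n" and f = "\<lambda>_. 0" and \<xi> = 0 and r = R and m = n])
        fix s :: real
        assume s: "0 < s" and nz: "\<And>z :: complex. z \<in> cball 0 s - {0} \<Longrightarrow> (0 :: complex) \<noteq> 0"
        have "complex_of_real s \<in> cball 0 s - {0}" using s by simp
        from nz[OF this] show False by simp
      qed (use z ne False \<open>R > 0\<close> in simp_all)
    qed
  qed
  then show ?thesis
    using taylor_coeff_bound[of "\<lambda>_ :: unit. f" "()", OF hol] M \<open>R > 0\<close> by (simp add: t_def)
qed

text \<open>The one-variable estimate is used twice: for fixed y on the series in x, whose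
  coefficients are the inner sums G, and then on each G as a series in y with the bound M /
  R^i.\<close>

lemma double_series_coeff_bound:
  fixes g :: "nat \<Rightarrow> nat \<Rightarrow> complex"
  assumes sum: "\<And>x y. cmod x < R \<Longrightarrow> cmod y < R \<Longrightarrow> ((\<lambda>(i, j). g i j * x ^ i * y ^ j) has_sum s x y) UNIV"
    and M: "\<And>x y. cmod x < R \<Longrightarrow> cmod y < R \<Longrightarrow> cmod (s x y) \<le> M" and R: "R > 0"
  shows "cmod (g i j) \<le> M / R ^ i / R ^ j"
proof -
  \<comment> \<open>A nonzero point is needed: inner summability is extracted from the double series
    at x0, and the power of x0 is divided out.\<close>
  obtain x0 :: real where x0: "0 < x0" "x0 < R" using dense[OF R] by blast
  have inner: "(\<lambda>j. g i j * y ^ j) summable_on UNIV" if y: "cmod y < R" for i y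
  proof -
    have "(\<lambda>(i, j). g i j * of_real x0 ^ i * y ^ j) summable_on Sigma UNIV (\<lambda>_. UNIV)"
      using sum[of "of_real x0" y] x0 y by (auto simp: summable_on_def)
    from summable_on_SigmaD1[OF this, of i]
    have "(\<lambda>j. inverse (of_real x0 ^ i) * (g i j * of_real x0 ^ i * y ^ j)) summable_on UNIV"
      by (intro summable_on_cmult_right) simp
    then show ?thesis using x0 by (simp add: field_simps)
  qed
  define G where "G i y = (\<Sum>\<^sub>\<infinity>j. g i j * y ^ j)" for i y
  have G: "((\<lambda>j. g i j * y ^ j) has_sum G i y) UNIV" if "cmod y < R" for i y
    unfolding G_def using inner[OF that] by simp
  have outer: "(\<lambda>i. G i y * x ^ i) sums s x y" if "cmod x < R" "cmod y < R" for x y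
  proof -
    have "((\<lambda>i. x ^ i * G i y) has_sum s x y) UNIV"
    proof (rule has_sum_SigmaD)
      show "((\<lambda>(i, j). g i j * x ^ i * y ^ j) has_sum s x y) (Sigma UNIV (\<lambda>_. UNIV))"
        using sum[OF that] by simp
      show "((\<lambda>j. case (i, j) of (i, j) \<Rightarrow> g i j * x ^ i * y ^ j) has_sum x ^ i * G i y) UNIV" for i
        using has_sum_cmult_right[OF G[OF that(2)], of "x ^ i" i] by (simp add: mult_ac)
    qed
    from has_sum_imp_sums[OF this] show ?thesis by (simp only: mult.commute)
  qed
  have "cmod (G i y) \<le> M / R ^ i" if "cmod y < R" for y
    by (rule power_series_coeff_bound[OF outer _ R]) (use M that in auto)
  then show ?thesis
    by (intro power_series_coeff_bound[OF has_sum_imp_sums[OF G] _ R])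
qed

section \<open>Analytic continuation\<close>

definition lens :: "complex set" where
  "lens = {z. 0 < margin z}"

definition ext_dom :: "(complex ^ 3) set" where
  "ext_dom = {r. r $ 1 \<in> lens \<and> r $ 2 \<in> lens \<and> cmod (r $ 3) < 1}"

lemma open_lens: "open lens"
  unfolding lens_def by (intro open_Collect_less continuous_intros)

lemma lens_lt1: "z \<in> lens \<Longrightarrow> cmod z < 1"
  using margin_le[of z] by (simp add: lens_def)

lemma starlike_lens: "starlike lens"
proof -
  have "closed_segment 0 z \<subseteq> lens" if "z \<in> lens" for z
  proof
    fix w assume "w \<in> closed_segment 0 z"
    then obtain s where s: "0 \<le> s" "s \<le> 1" "w = of_real s * z"
      by (auto simp: closed_segment_def scaleR_conv_of_real)
    then show "w \<in> lens" using margin_scale[of s z] that by (simp add: lens_def)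
  qed
  moreover have "0 \<in> lens" by (simp add: lens_def margin_def)
  ultimately show ?thesis unfolding starlike_def by blast
qed

lemma ball_subset_lens: "cmod z < 1 / 8 \<Longrightarrow> z \<in> lens"
  using margin_small[of z] by (simp add: lens_def)

lemma open_ext_dom: "open ext_dom"
proof -
  have "open ((\<lambda>r :: complex ^ 3. r $ 1) -` lens)" "open ((\<lambda>r :: complex ^ 3. r $ 2) -` lens)"
    by (intro open_vimage open_lens continuous_intros)+
  moreover have "open {r :: complex ^ 3. cmod (r $ 3) < 1}"
    by (intro open_Collect_less continuous_intros)
  moreover have "ext_dom = (\<lambda>r. r $ 1) -` lens \<inter> (\<lambda>r. r $ 2) -` lens \<inter> {r. cmod (r $ 3) < 1}"
    by (auto simp: ext_dom_def)
  ultimately show ?thesis by (metis open_Int)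
qed

lemma connected_ext_dom: "connected ext_dom"
proof (rule starlike_imp_connected)
  have "closed_segment 0 r \<subseteq> ext_dom" if r: "r \<in> ext_dom" for r
  proof
    fix w assume "w \<in> closed_segment 0 r"
    then obtain s where s: "0 \<le> s" "s \<le> 1" "w = s *\<^sub>R r"
      by (auto simp: closed_segment_def)
    have w: "w $ i = of_real s * r $ i" for i
      unfolding s(3) vector_scaleR_component by (rule scaleR_conv_of_real)
    have "s * cmod (r $ 3) \<le> 1 * cmod (r $ 3)" using s by (intro mult_right_mono) auto
    then show "w \<in> ext_dom"
      using margin_scale[of s "r $ 1"] margin_scale[of s "r $ 2"] r s(1,2)
      by (simp add: ext_dom_def lens_def w norm_mult)
  qed
  moreover have "0 \<in> ext_dom" by (simp add: ext_dom_def lens_def margin_def)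
  ultimately show "starlike ext_dom" unfolding starlike_def by blast
qed

lemma polydisc_subset_ext_dom: "polydisc 0 (1 / 10) \<subseteq> ext_dom"
proof
  fix r assume "r \<in> polydisc 0 (1 / 10)"
  then have n: "cmod (r $ i) < 1 / 10" for i by (auto simp: polydisc_def)
  then have "cmod (r $ i) < 1 / 8" for i by (rule less_trans) simp
  with n[of 3] show "r \<in> ext_dom" by (simp add: ext_dom_def ball_subset_lens)
qed

lemma cube_subset_ext_dom: "half_open_cube \<subseteq> ext_dom"
proof
  fix r assume "r \<in> half_open_cube"
  then have "\<exists>t. 0 \<le> t \<and> t < 1 \<and> r $ i = of_real t" for i by (force simp: half_open_cube_def)
  then obtain t where "\<And>i. 0 \<le> t i \<and> t i < 1 \<and> r $ i = of_real (t i)" by metis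
  then show "r \<in> ext_dom" by (simp add: ext_dom_def lens_def margin_of_real)
qed

section \<open>Local expansions and partial derivatives\<close>

definition power_series_on :: "(int ^ 3 \<Rightarrow> complex) \<Rightarrow> complex ^ 3 \<Rightarrow> real \<Rightarrow> (complex ^ 3 \<Rightarrow> complex) \<Rightarrow> bool" where
  "power_series_on c a \<rho> F \<longleftrightarrow> (\<forall>r\<in>polydisc a \<rho>. arr_series c (r - a) (F r))"

lemma polydisc_upd: "r \<in> polydisc a \<rho> \<Longrightarrow> cmod (z - a $ l) < \<rho> \<Longrightarrow> upd r l z \<in> polydisc a \<rho>"
  by (simp add: polydisc_def)

lemma power_series_on_partial3:
  assumes "power_series_on c a \<rho> F"
  shows "power_series_on (\<lambda>n. (of_int (n $ l) + 1) * c (n + ev l)) a \<rho> (partial3 l F)"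
    and "r \<in> polydisc a \<rho> \<Longrightarrow> (\<lambda>z. F (upd r l z)) field_differentiable (at (r $ l))"
proof -
  have *: "(\<lambda>z. F (upd r l z)) field_differentiable (at (r $ l)) \<and>
      arr_series (\<lambda>n. (of_int (n $ l) + 1) * c (n + ev l)) (r - a) (partial3 l F r)" if r: "r \<in> polydisc a \<rho>" for r
  proof -
    have ser: "arr_series c (upd (r - a) l z) (F (upd r l (z + a $ l)))" if "cmod z < \<rho>" for z
    proof -
      have "upd r l (z + a $ l) - a = upd (r - a) l z" by (simp add: vec_eq_iff)
      moreover have "upd r l (z + a $ l) \<in> polydisc a \<rho>" using r that by (intro polydisc_upd) auto
      ultimately show ?thesis using assms unfolding power_series_on_def by metis
    qed
    have lt: "cmod ((r - a) $ l) < \<rho>" using r by (simp add: polydisc_def)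
    obtain d where d: "((\<lambda>z. F (upd r l (z + a $ l))) has_field_derivative d) (at ((r - a) $ l))"
      "arr_series (\<lambda>n. (of_int (n $ l) + 1) * c (n + ev l)) (upd (r - a) l ((r - a) $ l)) d"
      by (rule arr_series_deriv[where \<Phi> = "\<lambda>z. F (upd r l (z + a $ l))", OF ser lt])
    have "((\<lambda>z. F (upd r l z)) has_field_derivative d) (at (r $ l))"
      using d(1) DERIV_shift[of "\<lambda>z. F (upd r l z)" d "r $ l - a $ l" "a $ l"] by simp
    moreover from this have "partial3 l F r = d" by (simp add: partial3_upd DERIV_imp_deriv)
    ultimately show ?thesis using d(2) upd_self[of "r - a" l] by (auto simp: field_differentiable_def)
  qed
  show "power_series_on (\<lambda>n. (of_int (n $ l) + 1) * c (n + ev l)) a \<rho> (partial3 l F)"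
    using * by (simp add: power_series_on_def)
  show "r \<in> polydisc a \<rho> \<Longrightarrow> (\<lambda>z. F (upd r l z)) field_differentiable (at (r $ l))"
    using * by blast
qed

lemma analytic3_on_iff_power_series: "analytic3_on F D \<longleftrightarrow> (\<forall>a\<in>D. \<exists>\<rho>>0. \<exists>c. power_series_on c a \<rho> F)"
proof -
  have "(\<exists>c :: nat ^ 3 \<Rightarrow> complex. \<forall>r\<in>polydisc a \<rho>. ((\<lambda>n. c n * mpow (r - a) n) has_sum F r) UNIV) \<longleftrightarrow>
      (\<exists>c. power_series_on c a \<rho> F)" for a \<rho>
  proof
    assume "\<exists>c :: nat ^ 3 \<Rightarrow> complex. \<forall>r\<in>polydisc a \<rho>. ((\<lambda>n. c n * mpow (r - a) n) has_sum F r) UNIV"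
    then obtain c :: "nat ^ 3 \<Rightarrow> complex" where c: "\<forall>r\<in>polydisc a \<rho>. ((\<lambda>n. c n * mpow (r - a) n) has_sum F r) UNIV"
      by blast
    have "power_series_on (\<lambda>n. c (\<chi> i. nat (n $ i))) a \<rho> F"
      using c by (simp add: power_series_on_def arr_series_iff_nat)
    then show "\<exists>c. power_series_on c a \<rho> F" by blast
  next
    assume "\<exists>c. power_series_on c a \<rho> F"
    then show "\<exists>c :: nat ^ 3 \<Rightarrow> complex. \<forall>r\<in>polydisc a \<rho>. ((\<lambda>n. c n * mpow (r - a) n) has_sum F r) UNIV"
      unfolding power_series_on_def arr_series_iff_nat by metis
  qed
  then show ?thesis by (simp add: analytic3_on_def)
qed

lemma analytic3_on_partial3: "analytic3_on F D \<Longrightarrow> analytic3_on (partial3 l F) D"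
  unfolding analytic3_on_iff_power_series using power_series_on_partial3(1) by blast

definition sep_diff :: "(complex ^ 3 \<Rightarrow> complex) \<Rightarrow> complex ^ 3 \<Rightarrow> bool" where
  "sep_diff F r \<longleftrightarrow> (\<forall>i. (\<lambda>z. F (upd r i z)) field_differentiable (at (r $ i)))"

text \<open>Separate differentiability is all that the one-variable identity theorem asks for, and
  it passes to polynomial combinations by the pointwise rules, without multiplying triple
  series.\<close>

lemma analytic3_on_imp_sep_diff: "analytic3_on F D \<Longrightarrow> r \<in> D \<Longrightarrow> sep_diff F r"
proof -
  assume "analytic3_on F D" "r \<in> D"
  then obtain \<rho> c where "\<rho> > 0" "power_series_on c r \<rho> F" unfolding analytic3_on_iff_power_series by blast
  moreover have "r \<in> polydisc r \<rho>" using \<open>\<rho> > 0\<close> by (simp add: polydisc_def)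
  ultimately show ?thesis unfolding sep_diff_def using power_series_on_partial3(2) by blast
qed

lemma sep_diff_const: "sep_diff (\<lambda>r. c) r"
  by (simp add: sep_diff_def)

lemma sep_diff_coord: "sep_diff (\<lambda>r. r $ l) r"
  unfolding sep_diff_def
proof
  fix i
  show "(\<lambda>z. upd r i z $ l) field_differentiable (at (r $ i))"
    by (cases "l = i") simp_all
qed

lemma sep_diff_add: "sep_diff F r \<Longrightarrow> sep_diff G r \<Longrightarrow> sep_diff (\<lambda>r. F r + G r) r"
  and sep_diff_diff: "sep_diff F r \<Longrightarrow> sep_diff G r \<Longrightarrow> sep_diff (\<lambda>r. F r - G r) r"
  and sep_diff_mult: "sep_diff F r \<Longrightarrow> sep_diff G r \<Longrightarrow> sep_diff (\<lambda>r. F r * G r) r"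
  by (simp_all add: sep_diff_def field_differentiable_add field_differentiable_diff field_differentiable_mult)

lemmas sep_diff_intros = sep_diff_const sep_diff_coord sep_diff_add sep_diff_diff sep_diff_mult

lemma zero_on_connected:
  assumes "open S" "connected S" "ball 0 (1 / 10) \<subseteq> S"
    and d: "\<And>z. z \<in> S \<Longrightarrow> \<phi> field_differentiable (at z)" and z: "\<And>z. cmod z < 1 / 10 \<Longrightarrow> \<phi> z = 0" and "w \<in> S"
  shows "\<phi> w = (0 :: complex)"
proof (rule analytic_continuation_open[of "ball 0 (1 / 10)" S \<phi> "\<lambda>_. 0" w])
  show "\<phi> holomorphic_on S" using d by (simp add: holomorphic_on_def field_differentiable_at_within)
qed (use assms in auto)

text \<open>The domain is a product, so the identity theorem is applied in one variable at a time.\<close>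

lemma identity_ext_dom:
  assumes sep: "\<And>r. r \<in> ext_dom \<Longrightarrow> sep_diff H r" and zero: "\<And>r. r \<in> polydisc 0 (1 / 10) \<Longrightarrow> H r = 0" and r: "r \<in> ext_dom"
  shows "H r = 0"
proof -
  have lens: "open lens" "connected lens" "ball 0 (1 / 10) \<subseteq> lens"
    using open_lens starlike_imp_connected[OF starlike_lens] ball_subset_lens by auto
  have d: "(\<lambda>x. H (vector [x, y, z])) field_differentiable (at x)" "(\<lambda>y. H (vector [x, y, z])) field_differentiable (at y)"
    "(\<lambda>z. H (vector [x, y, z])) field_differentiable (at z)"
    if "x \<in> lens" "y \<in> lens" "cmod z < 1" for x y z
  proof -
    have "vector [x, y, z] \<in> ext_dom" using that by (simp add: ext_dom_def)
    from sep[OF this] have s: "(\<lambda>w. H (upd (vector [x, y, z]) i w)) field_differentiable (at (vector [x, y, z] $ i))" for i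
      by (simp add: sep_diff_def)
    from s[of 1] s[of 2] s[of 3] show "(\<lambda>x. H (vector [x, y, z])) field_differentiable (at x)"
      "(\<lambda>y. H (vector [x, y, z])) field_differentiable (at y)" "(\<lambda>z. H (vector [x, y, z])) field_differentiable (at z)"
      by (simp_all add: upd_vector3)
  qed
  have sm: "z \<in> lens" "cmod z < 1" if "cmod z < 1 / 10" for z
    using that by (auto intro: ball_subset_lens)
  have 1: "H (vector [x, y, z]) = 0" if "x \<in> lens" "cmod y < 1 / 10" "cmod z < 1 / 10" for x y z
    by (rule zero_on_connected[OF lens, where \<phi> = "\<lambda>x. H (vector [x, y, z])"])
       (use that d sm in \<open>auto intro!: zero simp: polydisc_def forall_3\<close>)
  have 2: "H (vector [x, y, z]) = 0" if "x \<in> lens" "y \<in> lens" "cmod z < 1 / 10" for x y z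
    by (rule zero_on_connected[OF lens, where \<phi> = "\<lambda>y. H (vector [x, y, z])"]) (use that d sm 1 in auto)
  have b: "open (ball (0 :: complex) 1)" "connected (ball (0 :: complex) 1)" "ball 0 (1 / 10) \<subseteq> ball (0 :: complex) 1"
    by auto
  have 3: "H (vector [x, y, z]) = 0" if "x \<in> lens" "y \<in> lens" "cmod z < 1" for x y z
    by (rule zero_on_connected[OF b, where \<phi> = "\<lambda>z. H (vector [x, y, z])"]) (use that d 2 in auto)
  show ?thesis using 3[of "r $ 1" "r $ 2" "r $ 3"] r by (simp add: ext_dom_def)
qed

section \<open>Summation of the slices over the third variable\<close>

definition slices_grow :: "(int ^ 3 \<Rightarrow> real) \<Rightarrow> bool" where
  "slices_grow c \<longleftrightarrow> (\<forall>\<delta>>0. \<forall>\<sigma>>1. \<exists>C\<ge>0. \<forall>n x y. \<delta> \<le> margin x \<longrightarrow> \<delta> \<le> margin y \<longrightarrow> cmod (slice_sum c (int n) x y) \<le> C * \<sigma> ^ n)"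

definition slices_sum :: "(int ^ 3 \<Rightarrow> real) \<Rightarrow> complex \<Rightarrow> complex \<Rightarrow> complex \<Rightarrow> complex" where
  "slices_sum c x y z = (\<Sum>n. slice_sum c (int n) x y * z ^ n)"

text \<open>The bounds in \<open>slices_grow\<close> assume a positive lower bound on the margin;
  locally in the lens half the margin at the centre is such a bound.\<close>

lemma lens_neighbourhood:
  assumes "x \<in> lens"
  obtains d where "d > 0" "cball x d \<subseteq> lens" "\<And>w. w \<in> cball x d \<Longrightarrow> margin x / 2 \<le> margin w"
proof -
  have "open {w. margin x / 2 < margin w}" by (intro open_Collect_less continuous_intros)
  moreover have "x \<in> {w. margin x / 2 < margin w}" using assms by (simp add: lens_def)
  ultimately obtain d where d: "d > 0" "cball x d \<subseteq> {w. margin x / 2 < margin w}"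
    using open_contains_cball by blast
  then show ?thesis using assms by (intro that[of d]) (auto simp: lens_def)
qed

text \<open>The triple is reversed because \<open>osgood3\<close> and the sum over slices both keep
  the third variable outermost.\<close>

lemma has_sum_triple_iff:
  fixes g :: "nat ^ 3 \<Rightarrow> 'b :: {comm_monoid_add, topological_space}"
  shows "((\<lambda>(k, j, i). g (vector [i, j, k])) has_sum s) UNIV \<longleftrightarrow> (g has_sum s) UNIV"
proof -
  have "bij (\<lambda>(k, j, i). vector [i, j, k] :: nat ^ 3)"
    by (rule bij_betwI[of _ _ _ "\<lambda>n. (n $ 3, n $ 2, n $ 1)"]) auto
  from has_sum_reindex_bij_betw[OF this, of g s] show ?thesis by (simp add: case_prod_unfold)
qed

context
  fixes c :: "int ^ 3 \<Rightarrow> real"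
  assumes tame: "tame c" and grow: "slices_grow c"
begin

lemma slices_sum_dominated:
  assumes "\<delta> > 0" "0 \<le> R" "R < 1"
  obtains M :: "nat \<Rightarrow> real" where "summable M"
    "\<And>n x y z. \<delta> \<le> margin x \<Longrightarrow> \<delta> \<le> margin y \<Longrightarrow> cmod z \<le> R \<Longrightarrow> cmod (slice_sum c (int n) x y * z ^ n) \<le> M n"
proof -
  define \<sigma> where "\<sigma> = 2 / (1 + R)"
  have \<sigma>: "\<sigma> > 1" "\<sigma> * R < 1" using assms by (auto simp: \<sigma>_def field_simps)
  obtain C where C: "C \<ge> 0" "\<And>n x y. \<delta> \<le> margin x \<Longrightarrow> \<delta> \<le> margin y \<Longrightarrow> cmod (slice_sum c (int n) x y) \<le> C * \<sigma> ^ n"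
    using grow assms(1) \<sigma>(1) unfolding slices_grow_def by meson
  show ?thesis
  proof (rule that[of "\<lambda>n. C * (\<sigma> * R) ^ n"])
    show "summable (\<lambda>n. C * (\<sigma> * R) ^ n)"
      using \<sigma> assms by (intro summable_mult summable_geometric) auto
    fix n x y z assume *: "\<delta> \<le> margin x" "\<delta> \<le> margin y" "cmod z \<le> R"
    have "cmod (slice_sum c (int n) x y * z ^ n) \<le> (C * \<sigma> ^ n) * R ^ n"
      unfolding norm_mult norm_power using C * \<sigma> by (intro mult_mono power_mono) auto
    then show "cmod (slice_sum c (int n) x y * z ^ n) \<le> C * (\<sigma> * R) ^ n" by (simp add: power_mult_distrib)
  qed
qed

lemma slices_sum_sums:
  assumes "x \<in> lens" "y \<in> lens" "cmod z < 1"
  shows "summable (\<lambda>n. cmod (slice_sum c (int n) x y * z ^ n))" "(\<lambda>n. slice_sum c (int n) x y * z ^ n) sums slices_sum c x y z"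
proof -
  obtain M :: "nat \<Rightarrow> real" where M: "summable M"
    "\<And>n x' y' z'. min (margin x) (margin y) \<le> margin x' \<Longrightarrow> min (margin x) (margin y) \<le> margin y' \<Longrightarrow> cmod z' \<le> cmod z \<Longrightarrow>
      cmod (slice_sum c (int n) x' y' * z' ^ n) \<le> M n"
    using slices_sum_dominated[of "min (margin x) (margin y)" "cmod z"] assms by (auto simp: lens_def)
  have b: "cmod (slice_sum c (int n) x y * z ^ n) \<le> M n" for n
    by (rule M(2)) auto
  then show s: "summable (\<lambda>n. cmod (slice_sum c (int n) x y * z ^ n))"
    by (intro summable_comparison_test'[OF M(1), where N = 0]) auto
  show "(\<lambda>n. slice_sum c (int n) x y * z ^ n) sums slices_sum c x y z"
    unfolding slices_sum_def by (rule summable_sums[OF summable_norm_cancel[OF s]])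
qed

lemma slices_sum_bounded:
  assumes "\<delta> > 0" "0 \<le> R" "R < 1"
  shows "\<exists>M. \<forall>x y z. \<delta> \<le> margin x \<longrightarrow> \<delta> \<le> margin y \<longrightarrow> cmod z \<le> R \<longrightarrow> cmod (slices_sum c x y z) \<le> M"
proof -
  obtain M :: "nat \<Rightarrow> real" where M: "summable M"
    "\<And>n x y z. \<delta> \<le> margin x \<Longrightarrow> \<delta> \<le> margin y \<Longrightarrow> cmod z \<le> R \<Longrightarrow> cmod (slice_sum c (int n) x y * z ^ n) \<le> M n"
    using slices_sum_dominated[OF assms] by blast
  then have "cmod (slices_sum c x y z) \<le> suminf M" if "\<delta> \<le> margin x" "\<delta> \<le> margin y" "cmod z \<le> R" for x y z
    unfolding slices_sum_def using that by (intro norm_suminf_le) auto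
  then show ?thesis by blast
qed

lemma slices_sum_uniform_limit:
  assumes "\<delta> > 0" "0 \<le> R" "R < 1" and S: "\<And>s. s \<in> S \<Longrightarrow> \<delta> \<le> margin (X s) \<and> \<delta> \<le> margin (Y s) \<and> cmod (Z s) \<le> R"
  shows "uniform_limit S (\<lambda>N s. \<Sum>n<N. slice_sum c (int n) (X s) (Y s) * Z s ^ n) (\<lambda>s. slices_sum c (X s) (Y s) (Z s)) sequentially"
proof -
  obtain M :: "nat \<Rightarrow> real" where M: "summable M"
    "\<And>n x y z. \<delta> \<le> margin x \<Longrightarrow> \<delta> \<le> margin y \<Longrightarrow> cmod z \<le> R \<Longrightarrow> cmod (slice_sum c (int n) x y * z ^ n) \<le> M n"
    using slices_sum_dominated[OF assms(1-3)] by blast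
  show ?thesis
    unfolding slices_sum_def using S M by (intro Weierstrass_m_test[where M = M]) auto
qed

lemma slices_sum_holomorphic1:
  assumes y: "y \<in> lens" and z: "cmod z < 1"
  shows "(\<lambda>x. slices_sum c x y z) holomorphic_on lens"
proof (rule holomorphic_uniform_sequence[OF open_lens, where f = "\<lambda>N x. \<Sum>n<N. slice_sum c (int n) x y * z ^ n"])
  have "(\<lambda>x. slice_sum c k x y) holomorphic_on lens" for k
    by (rule holomorphic_on_subset[OF slice_sum_holomorphic(1)[OF tame lens_lt1[OF y]]]) (use lens_lt1 in auto)
  then show "(\<lambda>x. \<Sum>n<N. slice_sum c (int n) x y * z ^ n) holomorphic_on lens" for N
    by (intro holomorphic_intros)
  fix x assume x: "x \<in> lens"
  obtain d where d: "d > 0" "cball x d \<subseteq> lens" "\<And>w. w \<in> cball x d \<Longrightarrow> margin x / 2 \<le> margin w"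
    using lens_neighbourhood[OF x] by blast
  have "uniform_limit (cball x d) (\<lambda>N x. \<Sum>n<N. slice_sum c (int n) x y * z ^ n) (\<lambda>x. slices_sum c x y z) sequentially"
    by (rule slices_sum_uniform_limit[where \<delta> = "min (margin x / 2) (margin y)" and R = "cmod z"])
       (use d(3) x y z in \<open>auto simp: lens_def min_le_iff_disj\<close>)
  then show "\<exists>d>0. cball x d \<subseteq> lens \<and> uniform_limit (cball x d) (\<lambda>N x. \<Sum>n<N. slice_sum c (int n) x y * z ^ n) (\<lambda>x. slices_sum c x y z) sequentially"
    using d by blast
qed

lemma slices_sum_holomorphic2:
  assumes x: "x \<in> lens" and z: "cmod z < 1"
  shows "(\<lambda>y. slices_sum c x y z) holomorphic_on lens"
proof (rule holomorphic_uniform_sequence[OF open_lens, where f = "\<lambda>N y. \<Sum>n<N. slice_sum c (int n) x y * z ^ n"])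
  have "(\<lambda>y. slice_sum c k x y) holomorphic_on lens" for k
    by (rule holomorphic_on_subset[OF slice_sum_holomorphic(2)[OF tame lens_lt1[OF x]]]) (use lens_lt1 in auto)
  then show "(\<lambda>y. \<Sum>n<N. slice_sum c (int n) x y * z ^ n) holomorphic_on lens" for N
    by (intro holomorphic_intros)
  fix y assume y: "y \<in> lens"
  obtain d where d: "d > 0" "cball y d \<subseteq> lens" "\<And>w. w \<in> cball y d \<Longrightarrow> margin y / 2 \<le> margin w"
    using lens_neighbourhood[OF y] by blast
  have "uniform_limit (cball y d) (\<lambda>N y. \<Sum>n<N. slice_sum c (int n) x y * z ^ n) (\<lambda>y. slices_sum c x y z) sequentially"
    by (rule slices_sum_uniform_limit[where \<delta> = "min (margin y / 2) (margin x)" and R = "cmod z"])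
       (use d(3) x y z in \<open>auto simp: lens_def min_le_iff_disj\<close>)
  then show "\<exists>d>0. cball y d \<subseteq> lens \<and> uniform_limit (cball y d) (\<lambda>N y. \<Sum>n<N. slice_sum c (int n) x y * z ^ n) (\<lambda>y. slices_sum c x y z) sequentially"
    using d by blast
qed

lemma slices_sum_holomorphic3:
  assumes "x \<in> lens" "y \<in> lens"
  shows "(\<lambda>z. slices_sum c x y z) holomorphic_on ball 0 1"
  by (rule power_series_holomorphic[where a = "\<lambda>n. slice_sum c (int n) x y"]) (use slices_sum_sums(2) assms in simp)

text \<open>The sum is separately holomorphic and bounded on a small polydisc about each point: the
  radius keeps the first two margins above \<delta> and the third coordinate below R, a number
  between |a_3| and 1. \<open>osgood3\<close> then gives the joint expansion.\<close>

lemma slices_sum_analytic: "analytic3_on (\<lambda>r. slices_sum c (r $ 1) (r $ 2) (r $ 3)) ext_dom"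
  unfolding analytic3_on_def
proof
  fix a assume "a \<in> ext_dom"
  then have a: "a $ 1 \<in> lens" "a $ 2 \<in> lens" "cmod (a $ 3) < 1" by (auto simp: ext_dom_def)
  obtain d1 where d1: "d1 > 0" "cball (a $ 1) d1 \<subseteq> lens" "\<And>w. w \<in> cball (a $ 1) d1 \<Longrightarrow> margin (a $ 1) / 2 \<le> margin w"
    using lens_neighbourhood[OF a(1)] by blast
  obtain d2 where d2: "d2 > 0" "cball (a $ 2) d2 \<subseteq> lens" "\<And>w. w \<in> cball (a $ 2) d2 \<Longrightarrow> margin (a $ 2) / 2 \<le> margin w"
    using lens_neighbourhood[OF a(2)] by blast
  define R where "R = (1 + cmod (a $ 3)) / 2"
  have R: "0 \<le> R" "R < 1" using a(3) by (auto simp: R_def)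
  define \<rho> where "\<rho> = min (min d1 d2) (R - cmod (a $ 3))"
  have \<rho>: "\<rho> > 0" "\<rho> \<le> d1" "\<rho> \<le> d2" using d1 d2 a(3) by (auto simp: \<rho>_def R_def)
  define \<delta> where "\<delta> = min (margin (a $ 1) / 2) (margin (a $ 2) / 2)"
  have \<delta>: "\<delta> > 0" using a by (auto simp: \<delta>_def lens_def)
  obtain M where M: "\<And>x y z. \<delta> \<le> margin x \<Longrightarrow> \<delta> \<le> margin y \<Longrightarrow> cmod z \<le> R \<Longrightarrow> cmod (slices_sum c x y z) \<le> M"
    using slices_sum_bounded[OF \<delta> R] by blast
  have b1: "x \<in> lens" "\<delta> \<le> margin x" if "x \<in> ball (a $ 1) \<rho>" for x
  proof -
    have "x \<in> cball (a $ 1) d1" using that \<rho> by simp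
    then show "x \<in> lens" "\<delta> \<le> margin x" using d1(2) d1(3)[of x] by (auto simp: \<delta>_def)
  qed
  have b2: "x \<in> lens" "\<delta> \<le> margin x" if "x \<in> ball (a $ 2) \<rho>" for x
  proof -
    have "x \<in> cball (a $ 2) d2" using that \<rho> by simp
    then show "x \<in> lens" "\<delta> \<le> margin x" using d2(2) d2(3)[of x] by (auto simp: \<delta>_def)
  qed
  have b3: "cmod z < 1" "cmod z \<le> R" if "z \<in> ball (a $ 3) \<rho>" for z
  proof -
    have "cmod (z - a $ 3) < R - cmod (a $ 3)" using that by (simp add: \<rho>_def dist_norm norm_minus_commute)
    then show "cmod z \<le> R" using norm_triangle_ineq2[of z "a $ 3"] by linarith
    then show "cmod z < 1" using R by linarith
  qed
  obtain e :: "nat \<Rightarrow> nat \<Rightarrow> nat \<Rightarrow> complex" where e: "\<And>x y z. x \<in> ball (a $ 1) \<rho> \<Longrightarrow> y \<in> ball (a $ 2) \<rho> \<Longrightarrow> z \<in> ball (a $ 3) \<rho> \<Longrightarrow>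
      ((\<lambda>(k, j, i). e k j i * (x - a $ 1) ^ i * (y - a $ 2) ^ j * (z - a $ 3) ^ k) has_sum slices_sum c x y z) UNIV"
  proof (rule osgood3[where f = "slices_sum c" and ?a1.0 = "a $ 1" and ?a2.0 = "a $ 2" and ?a3.0 = "a $ 3" and \<rho> = \<rho> and M = M])
    show "(\<lambda>x. slices_sum c x y z) holomorphic_on ball (a $ 1) \<rho>" if "y \<in> ball (a $ 2) \<rho>" "z \<in> ball (a $ 3) \<rho>" for y z
      by (rule holomorphic_on_subset[OF slices_sum_holomorphic1]) (use that b1 b2 b3 in auto)
    show "(\<lambda>y. slices_sum c x y z) holomorphic_on ball (a $ 2) \<rho>" if "x \<in> ball (a $ 1) \<rho>" "z \<in> ball (a $ 3) \<rho>" for x z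
      by (rule holomorphic_on_subset[OF slices_sum_holomorphic2]) (use that b1 b2 b3 in auto)
    show "(\<lambda>z. slices_sum c x y z) holomorphic_on ball (a $ 3) \<rho>" if "x \<in> ball (a $ 1) \<rho>" "y \<in> ball (a $ 2) \<rho>" for x y
      by (rule holomorphic_on_subset[OF slices_sum_holomorphic3]) (use that b1 b2 b3 in auto)
    show "cmod (slices_sum c x y z) \<le> M" if "x \<in> ball (a $ 1) \<rho>" "y \<in> ball (a $ 2) \<rho>" "z \<in> ball (a $ 3) \<rho>" for x y z
      using that by (intro M b1 b2 b3)
  qed (use \<rho>(1) in blast)+
  show "\<exists>\<rho>>0. \<exists>e :: nat ^ 3 \<Rightarrow> complex. \<forall>r\<in>polydisc a \<rho>. ((\<lambda>n. e n * mpow (r - a) n) has_sum slices_sum c (r $ 1) (r $ 2) (r $ 3)) UNIV"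
  proof (intro exI[of _ \<rho>] exI[of _ "\<lambda>n. e (n $ 3) (n $ 2) (n $ 1)"] conjI ballI \<rho>(1))
    fix r assume "r \<in> polydisc a \<rho>"
    then have "r $ i \<in> ball (a $ i) \<rho>" for i by (simp add: polydisc_def dist_norm norm_minus_commute)
    then have "((\<lambda>(k, j, i). e k j i * (r $ 1 - a $ 1) ^ i * (r $ 2 - a $ 2) ^ j * (r $ 3 - a $ 3) ^ k) has_sum slices_sum c (r $ 1) (r $ 2) (r $ 3)) UNIV"
      by (intro e)
    then show "((\<lambda>n. e (n $ 3) (n $ 2) (n $ 1) * mpow (r - a) n) has_sum slices_sum c (r $ 1) (r $ 2) (r $ 3)) UNIV"
      unfolding has_sum_triple_iff[symmetric] by (simp add: mpow_3 mult.assoc)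
  qed
qed

lemma slice_sum_double_series:
  assumes "cmod x < 1" "cmod y < 1"
  shows "((\<lambda>(i, j). of_real (c (vector [int i, int j, int k])) * x ^ i * y ^ j) has_sum slice_sum c (int k) x y) UNIV"
proof -
  define h :: "nat \<times> nat \<Rightarrow> int ^ 3" where "h = (\<lambda>(i, j). vector [int i, int j, int k])"
  have inj: "inj h" by (auto simp: inj_def h_def vec3_eq_iff)
  define g where "g n = slice_arr c (int k) n * arr_pow (vector [x, y, 1]) n" for n
  have "(g has_sum slice_sum c (int k) x y) UNIV" using slice_sum_zser[OF tame assms, of "int k"] by (simp add: arr_series_def g_def[abs_def])
  also have "(g has_sum slice_sum c (int k) x y) UNIV \<longleftrightarrow> (g has_sum slice_sum c (int k) x y) (range h)"
  proof (rule has_sum_cong_neutral)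
    fix n assume n: "n \<in> UNIV - range h"
    have "n $ 1 < 0 \<or> n $ 2 < 0 \<or> n $ 3 \<noteq> int k"
    proof (rule ccontr)
      assume "\<not> ?thesis"
      then have "n = h (nat (n $ 1), nat (n $ 2))" by (simp add: h_def vec3_eq_iff)
      with n show False by blast
    qed
    then show "g n = 0" by (elim disjE) (simp_all add: g_def slice_arr_def arr_pow_def forall_3)
  qed auto
  also have "\<dots> \<longleftrightarrow> ((g \<circ> h) has_sum slice_sum c (int k) x y) UNIV" by (rule has_sum_reindex[OF inj])
  also have "g \<circ> h = (\<lambda>(i, j). of_real (c (vector [int i, int j, int k])) * x ^ i * y ^ j)"
  proof
    fix p :: "nat \<times> nat"
    obtain i j where "p = (i, j)" by (cases p)
    then show "(g \<circ> h) p = (case p of (i, j) \<Rightarrow> of_real (c (vector [int i, int j, int k])) * x ^ i * y ^ j)"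
      by (simp add: g_def h_def slice_arr_def arr_pow_def forall_3 mpow_3)
  qed
  finally show ?thesis .
qed

text \<open>Summing slice by slice is only an iterated sum, so absolute convergence of the triple
  series has to be supplied. Growth of the slices at rate 2 and Cauchy estimates on discs of radius
  1/8 give |c| \<le> C 2^k 8^i 8^j, and 2/10 and 8/10 are both less than 1.\<close>

lemma slices_sum_series:
  assumes "r \<in> polydisc 0 (1 / 10)"
  shows "arr_series (\<lambda>n. of_real (c n)) r (slices_sum c (r $ 1) (r $ 2) (r $ 3))"
proof -
  define x where "x = r $ 1"
  define y where "y = r $ 2"
  define z where "z = r $ 3"
  have n: "cmod x < 1 / 10" "cmod y < 1 / 10" "cmod z < 1 / 10"
    using assms by (auto simp: polydisc_def x_def y_def z_def)
  obtain C where C: "C \<ge> 0" "\<And>n x y. 1 / 8 \<le> margin x \<Longrightarrow> 1 / 8 \<le> margin y \<Longrightarrow> cmod (slice_sum c (int n) x y) \<le> C * 2 ^ n"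
    using grow[unfolded slices_grow_def, rule_format, of "1 / 8" 2] by auto
  define t where "t k j i = of_real (c (vector [int i, int j, int k])) * x ^ i * y ^ j * z ^ k" for k j i
  have cb: "cmod (of_real (c (vector [int i, int j, int k]))) \<le> C * 2 ^ k / (1 / 8) ^ i / (1 / 8) ^ j" for i j k
  proof (rule double_series_coeff_bound[where s = "slice_sum c (int k)"])
    show "((\<lambda>(i, j). complex_of_real (c (vector [int i, int j, int k])) * x ^ i * y ^ j) has_sum slice_sum c (int k) x y) UNIV"
      if "cmod x < 1 / 8" "cmod y < 1 / 8" for x y
      using that by (intro slice_sum_double_series) auto
    show "cmod (slice_sum c (int k) x y) \<le> C * 2 ^ k" if "cmod x < 1 / 8" "cmod y < 1 / 8" for x y
      using that by (intro C margin_small) auto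
  qed simp
  have tb: "cmod (t k j i) \<le> C * ((2 * cmod z) ^ k * ((8 * cmod y) ^ j * (8 * cmod x) ^ i))" for k j i
  proof -
    have "cmod (t k j i) = cmod (complex_of_real (c (vector [int i, int j, int k]))) * (cmod x ^ i * cmod y ^ j * cmod z ^ k)"
      by (simp add: t_def norm_mult norm_power)
    also have "\<dots> \<le> C * 2 ^ k / (1 / 8) ^ i / (1 / 8) ^ j * (cmod x ^ i * cmod y ^ j * cmod z ^ k)"
      by (intro mult_right_mono cb) simp
    also have "\<dots> = C * ((2 * cmod z) ^ k * ((8 * cmod y) ^ j * (8 * cmod x) ^ i))"
      by (simp add: power_mult_distrib power_divide)
    finally show ?thesis .
  qed
  have g: "(\<lambda>i. (2 * cmod z) ^ i) summable_on UNIV" "(\<lambda>i. (8 * cmod y) ^ i) summable_on UNIV" "(\<lambda>i. (8 * cmod x) ^ i) summable_on UNIV"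
    using n geometric_has_sum[of "2 * cmod z"] geometric_has_sum[of "8 * cmod y"] geometric_has_sum[of "8 * cmod x"]
    by (auto simp: summable_on_def)
  have g2: "(\<lambda>(j, i). (8 * cmod y) ^ j * (8 * cmod x) ^ i) summable_on UNIV"
    using summable_on_times_nonneg[OF g(2,3)] by simp
  have "(\<lambda>(k, ji). (2 * cmod z) ^ k * (case ji of (j, i) \<Rightarrow> (8 * cmod y) ^ j * (8 * cmod x) ^ i)) summable_on UNIV"
    using summable_on_times_nonneg[OF g(1) g2] by auto
  then have gg: "(\<lambda>p. C * (case p of (k, j, i) \<Rightarrow> (2 * cmod z) ^ k * ((8 * cmod y) ^ j * (8 * cmod x) ^ i))) summable_on UNIV"
    by (intro summable_on_cmult_right) (simp add: case_prod_unfold)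
  have "(\<lambda>p. norm (case p of (k, j, i) \<Rightarrow> t k j i)) summable_on UNIV"
    by (rule Infinite_Sum.abs_summable_on_comparison_test'[OF gg]) (use tb in \<open>simp add: case_prod_unfold\<close>)
  then have summ: "(\<lambda>(k, j, i). t k j i) summable_on UNIV"
    by (rule abs_summable_summable)
  have "((\<lambda>(k, ji). case ji of (j, i) \<Rightarrow> t k j i) has_sum slices_sum c x y z) (UNIV \<times> UNIV)"
  proof (rule has_sum_SigmaI)
    have l: "x \<in> lens" "y \<in> lens" "cmod z < 1" using n by (auto intro: ball_subset_lens)
    show "((\<lambda>k. slice_sum c (int k) x y * z ^ k) has_sum slices_sum c x y z) UNIV"
      by (rule norm_summable_imp_has_sum[OF slices_sum_sums[OF l]])
    show "((\<lambda>ji. case (k, ji) of (k, ji) \<Rightarrow> case ji of (j, i) \<Rightarrow> t k j i) has_sum slice_sum c (int k) x y * z ^ k) UNIV" for k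
    proof -
      have "((\<lambda>(i, j). of_real (c (vector [int i, int j, int k])) * x ^ i * y ^ j) has_sum slice_sum c (int k) x y) (UNIV \<times> UNIV)"
        using slice_sum_double_series[of x y k] n by simp
      then have "((\<lambda>(j, i). of_real (c (vector [int i, int j, int k])) * x ^ i * y ^ j) has_sum slice_sum c (int k) x y) UNIV"
        by (subst (asm) has_sum_swap) simp
      then have "((\<lambda>p. (case p of (j, i) \<Rightarrow> of_real (c (vector [int i, int j, int k])) * x ^ i * y ^ j) * z ^ k) has_sum slice_sum c (int k) x y * z ^ k) UNIV"
        by (rule has_sum_cmult_left)
      then show ?thesis by (simp add: t_def case_prod_unfold)
    qed
    show "(\<lambda>(k, ji). case ji of (j, i) \<Rightarrow> t k j i) summable_on UNIV \<times> UNIV"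
      using summ by simp
  qed
  then have s: "((\<lambda>(k, j, i). t k j i) has_sum slices_sum c x y z) UNIV" by simp
  have v: "(\<chi> m. int ((vector [i, j, k] :: nat ^ 3) $ m)) = (vector [int i, int j, int k] :: int ^ 3)" for i j k
    by (simp add: vec3_eq_iff)
  have "((\<lambda>n :: nat ^ 3. of_real (c (\<chi> m. int (n $ m))) * mpow r n) has_sum slices_sum c x y z) UNIV"
    unfolding has_sum_triple_iff[symmetric] using s
    by (simp add: v mpow_3 t_def x_def y_def z_def mult.assoc)
  then show ?thesis by (simp add: arr_series_iff_nat x_def y_def z_def)
qed

end

text \<open>Multiplication by r_m and differentiation in r_m act on arrays as \<open>S m\<close> and
  \<open>D m\<close>. After this translation the coefficients at n of the two sides are those of
  \<open>eqL\<close> and \<open>eqJ\<close>, and equality of the sums follows from uniqueness of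
  limits.\<close>

lemma pde_coefficients:
  fixes a b :: "int ^ 3 \<Rightarrow> real"
  assumes nb: "neighbor \<beta> a b"
    and F: "power_series_on (\<lambda>n. of_real (a n)) 0 R F" and G: "power_series_on (\<lambda>n. of_real (b n)) 0 R G"
    and r: "r \<in> polydisc 0 R" and jkl: "{j, k, l} = {1, 2, 3 :: 3}"
  shows "r $ l * (1 - r $ l) * partial3 l (partial3 l F) r
        + (2 * of_real \<beta> - 2 * r $ l) * partial3 l F r
        - of_real \<beta> * (1 - of_real \<beta>) * F r
      = (1 - r $ j) * (1 - r $ k) * G r" (is ?thesis1)
    and "2 * r $ j * r $ k * partial3 j (partial3 k F) r
        + of_real \<beta> * r $ j * partial3 j F r
        + of_real \<beta> * r $ k * partial3 k F r
        + of_real \<beta> * r $ l * partial3 l F r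
        + (of_real \<beta>)\<^sup>2 * F r
      = (r $ l * (r $ j + r $ k) - (1 + r $ j * r $ k)) * G r" (is ?thesis2)
proof -
  interpret neighbor \<beta> a b by (rule nb)
  have ne: "j \<noteq> k" "j \<noteq> l" "k \<noteq> l"
  proof -
    have "card {j, k, l} = 3" unfolding jkl by simp
    then show "j \<noteq> k" "j \<noteq> l" "k \<noteq> l" by (auto simp: card_insert_if split: if_splits)
  qed
  define ca cb where "ca n = complex_of_real (a n)" and "cb n = complex_of_real (b n)" for n
  define D where "D m c = (\<lambda>n :: int ^ 3. (of_int (n $ m) + 1) * c (n + ev m) :: complex)" for m c
  have supp: "nonneg_supp ca" "nonneg_supp cb" using suppa suppb by (auto simp: nonneg_supp_def ca_def cb_def)
  have suppD: "nonneg_supp (D m c)" if "nonneg_supp c" for m c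
    unfolding D_def using that by (rule nonneg_supp_deriv)
  have pF: "power_series_on ca 0 R F" and pG: "power_series_on cb 0 R G" using F G by (simp_all add: ca_def[abs_def] cb_def[abs_def])
  have pD: "power_series_on (D m c) 0 R (partial3 m H)" if "power_series_on c 0 R H" for m c H
    unfolding D_def using that by (rule power_series_on_partial3(1))
  have at_r: "arr_series c r (H r)" if "power_series_on c 0 R H" for c H
    using that r by (simp add: power_series_on_def)
  have zF: "arr_series ca r (F r)" and zG: "arr_series cb r (G r)" and zD: "arr_series (D m ca) r (partial3 m F r)"
    and zDD: "arr_series (D m (D m' ca)) r (partial3 m (partial3 m' F) r)" for m m'
    using at_r pD pF pG by blast+
  define S where "S m c = (\<lambda>n :: int ^ 3. c (n - ev m) :: complex)" for m c
  have zS: "arr_series (S m c) r (r $ m * s)" if "nonneg_supp c" "arr_series c r s" for m c s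
    unfolding S_def using that by (rule arr_series_shift)
  have suppS: "nonneg_supp (S m c)" if "nonneg_supp c" for m c
    unfolding S_def using that by (rule nonneg_supp_shift)
  let ?b = "complex_of_real \<beta>"
  note supps = supp suppD suppS
  have L1: "arr_series (\<lambda>n. S l (D l (D l ca)) n - S l (S l (D l (D l ca))) n + 2 * ?b * D l ca n - 2 * S l (D l ca) n - ?b * (1 - ?b) * ca n) r
      (r $ l * partial3 l (partial3 l F) r - r $ l * (r $ l * partial3 l (partial3 l F) r) + 2 * ?b * partial3 l F r
       - 2 * (r $ l * partial3 l F r) - ?b * (1 - ?b) * F r)"
    by (intro arr_series_diff arr_series_add arr_series_cmult zS zF zD zDD supps)
  have R1: "arr_series (\<lambda>n. cb n - S j cb n - S k cb n + S j (S k cb) n) r (G r - r $ j * G r - r $ k * G r + r $ j * (r $ k * G r))"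
    by (intro arr_series_diff arr_series_add zS zG supps)
  have ax: "(axis m (1 :: int) :: int ^ 3) $ m' = (if m = m' then 1 else 0)" for m m' by (simp add: axis_def)
  have c1: "S l (D l (D l ca)) n - S l (S l (D l (D l ca))) n + 2 * ?b * D l ca n - 2 * S l (D l ca) n - ?b * (1 - ?b) * ca n
      = cb n - S j cb n - S k cb n + S j (S k cb) n" for n
  proof -
    have sh: "n - ev l + ev l = n" "n - ev l - ev l + ev l + ev l = n" "n - ev l + ev l + ev l = n + ev l"
      "n - ev k - ev j = n - ev j - ev k" by simp_all
    have "complex_of_real ((of_int (n $ l) + 1) * (of_int (n $ l) + 2 * \<beta>) * a (n + ev l)
          - (of_int (n $ l) + \<beta>) * (of_int (n $ l) + 1 - \<beta>) * a n)
        = complex_of_real (b n - b (n - ev j) - b (n - ev k) + b (n - ev j - ev k))"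
      using eqL[OF jkl, of n] by (simp only:)
    then show ?thesis
      unfolding S_def D_def sh ca_def cb_def by (simp add: ax sh algebra_simps)
  qed
  from arr_series_unique[OF L1[unfolded c1] R1] show ?thesis1
    by (simp add: algebra_simps)
  have L2: "arr_series (\<lambda>n. 2 * S j (S k (D j (D k ca))) n + ?b * S j (D j ca) n + ?b * S k (D k ca) n + ?b * S l (D l ca) n + ?b\<^sup>2 * ca n) r
      (2 * (r $ j * (r $ k * partial3 j (partial3 k F) r)) + ?b * (r $ j * partial3 j F r) + ?b * (r $ k * partial3 k F r)
       + ?b * (r $ l * partial3 l F r) + ?b\<^sup>2 * F r)"
    by (intro arr_series_diff arr_series_add arr_series_cmult zS zF zD zDD supps)
  have R2: "arr_series (\<lambda>n. S j (S l cb) n + S k (S l cb) n - cb n - S k (S j cb) n) r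
      (r $ j * (r $ l * G r) + r $ k * (r $ l * G r) - G r - r $ k * (r $ j * G r))"
    by (intro arr_series_diff arr_series_add zS zG supps)
  have c2: "2 * S j (S k (D j (D k ca))) n + ?b * S j (D j ca) n + ?b * S k (D k ca) n + ?b * S l (D l ca) n + ?b\<^sup>2 * ca n
      = S j (S l cb) n + S k (S l cb) n - cb n - S k (S j cb) n" for n
  proof -
    have sh: "n - ev m + ev m = n" "n - ev j - ev k + ev j + ev k = n"
      "n - ev j - ev l = n - ev l - ev j" "n - ev k - ev l = n - ev l - ev k" "n - ev k - ev j = n - ev j - ev k" for m
      by simp_all
    have "complex_of_real ((2 * of_int (n $ j) * of_int (n $ k) + \<beta> * of_int (n $ j) + \<beta> * of_int (n $ k)
          + \<beta> * of_int (n $ l) + \<beta>\<^sup>2) * a n)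
        = complex_of_real (b (n - ev l - ev j) + b (n - ev l - ev k) - b n - b (n - ev j - ev k))"
      using eqJ[OF jkl, of n] by (simp only:)
    then show ?thesis
      unfolding S_def D_def sh ca_def cb_def using ne by (simp add: ax sh algebra_simps)
  qed
  from arr_series_unique[OF L2[unfolded c2] R2] show ?thesis2
    by (simp add: algebra_simps)
qed

section \<open>From the given arrays to the extended functions\<close>

lemma ext0_int: "ext0 A (\<chi> i. int (n $ i)) = A n"
  by (simp add: ext0_def)

lemma neighbor_arrays_imp_neighbor:
  assumes "\<beta> > 0" "neighbor_arrays \<beta> A B"
  shows "neighbor \<beta> (ext0 A) (ext0 B)"
proof
  have "ext0 C n = 0" if "n $ i < 0" for C n i
  proof -
    have "\<not> (\<forall>i. 0 \<le> n $ i)" using that by (metis not_le)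
    then show ?thesis by (simp only: ext0_def if_False)
  qed
  then show "nonneg_supp (ext0 A)" "nonneg_supp (ext0 B)" unfolding nonneg_supp_def by blast+
  note arrays = assms(2)[unfolded neighbor_arrays_def Let_def, THEN conjunct2]
  fix n :: "int ^ 3" and j k l :: 3
  assume jkl: "{j, k, l} = {1, 2, 3}"
  show "(of_int (n $ l) + 1) * (of_int (n $ l) + 2 * \<beta>) * ext0 A (n + ev l)
          - (of_int (n $ l) + \<beta>) * (of_int (n $ l) + 1 - \<beta>) * ext0 A n
        = ext0 B n - ext0 B (n - ev j) - ext0 B (n - ev k) + ext0 B (n - ev j - ev k)"
    by (rule arrays[THEN conjunct1, rule_format, OF jkl])
  show "(2 * of_int (n $ j) * of_int (n $ k) + \<beta> * of_int (n $ j) + \<beta> * of_int (n $ k)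
          + \<beta> * of_int (n $ l) + \<beta>\<^sup>2) * ext0 A n
        = ext0 B (n - ev l - ev j) + ext0 B (n - ev l - ev k) - ext0 B n - ext0 B (n - ev j - ev k)"
    by (rule arrays[THEN conjunct2, rule_format, OF jkl])
qed (rule assms(1))

theorem theorem5p8:
  fixes \<beta> :: real and A B :: "nat ^ 3 \<Rightarrow> real"
  assumes "\<beta> > 0"
    and "neighbor_arrays \<beta> A B"
  shows "\<exists>(D :: (complex ^ 3) set) (F :: complex ^ 3 \<Rightarrow> complex) (G :: complex ^ 3 \<Rightarrow> complex).
    open D \<and> connected D \<and> polydisc 0 (1/10) \<subseteq> D \<and> half_open_cube \<subseteq> D \<and>
    analytic3_on F D \<and> analytic3_on G D \<and>
    (\<forall>r\<in>polydisc 0 (1/10).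
      ((\<lambda>n. complex_of_real (A n) * mpow r n) has_sum F r) UNIV \<and>
      ((\<lambda>n. complex_of_real (B n) * mpow r n) has_sum G r) UNIV) \<and>
    (\<forall>r\<in>D. \<forall>j k l :: 3. {j, k, l} = {1, 2, 3} \<longrightarrow>
      r $ l * (1 - r $ l) * partial3 l (partial3 l F) r
        + (2 * of_real \<beta> - 2 * r $ l) * partial3 l F r
        - of_real \<beta> * (1 - of_real \<beta>) * F r
      = (1 - r $ j) * (1 - r $ k) * G r \<and>
      2 * r $ j * r $ k * partial3 j (partial3 k F) r
        + of_real \<beta> * r $ j * partial3 j F r
        + of_real \<beta> * r $ k * partial3 k F r
        + of_real \<beta> * r $ l * partial3 l F r
        + (of_real \<beta>)\<^sup>2 * F r
      = (r $ l * (r $ j + r $ k) - (1 + r $ j * r $ k)) * G r)"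
proof -
  have nb: "neighbor \<beta> (ext0 A) (ext0 B)" by (rule neighbor_arrays_imp_neighbor[OF assms])
  interpret neighbor \<beta> "ext0 A" "ext0 B" by (rule nb)
  have ga: "slices_grow (ext0 A)" and gb: "slices_grow (ext0 B)"
    unfolding slices_grow_def using slice_growth by meson+
  define F where "F = (\<lambda>r :: complex ^ 3. slices_sum (ext0 A) (r $ 1) (r $ 2) (r $ 3))"
  define G where "G = (\<lambda>r :: complex ^ 3. slices_sum (ext0 B) (r $ 1) (r $ 2) (r $ 3))"
  have anF: "analytic3_on F ext_dom" and anG: "analytic3_on G ext_dom"
    unfolding F_def G_def by (intro slices_sum_analytic tame_a tame_b ga gb)+
  have sF: "arr_series (\<lambda>n. of_real (ext0 A n)) r (F r)" and sG: "arr_series (\<lambda>n. of_real (ext0 B n)) r (G r)"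
    if "r \<in> polydisc 0 (1/10)" for r
    unfolding F_def G_def using that by (intro slices_sum_series tame_a tame_b ga gb; assumption)+
  have pF: "power_series_on (\<lambda>n. of_real (ext0 A n)) 0 (1/10) F" and pG: "power_series_on (\<lambda>n. of_real (ext0 B n)) 0 (1/10) G"
    using sF sG by (simp_all add: power_series_on_def)
  have sep: "sep_diff F r" "sep_diff G r" "sep_diff (partial3 m F) r" "sep_diff (partial3 m (partial3 m' F)) r" if "r \<in> ext_dom" for r m m'
    by (intro analytic3_on_imp_sep_diff[OF _ that] analytic3_on_partial3 anF anG)+
  have pde: "r $ l * (1 - r $ l) * partial3 l (partial3 l F) r
        + (2 * of_real \<beta> - 2 * r $ l) * partial3 l F r
        - of_real \<beta> * (1 - of_real \<beta>) * F r
      = (1 - r $ j) * (1 - r $ k) * G r"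
    "2 * r $ j * r $ k * partial3 j (partial3 k F) r
        + of_real \<beta> * r $ j * partial3 j F r
        + of_real \<beta> * r $ k * partial3 k F r
        + of_real \<beta> * r $ l * partial3 l F r
        + (of_real \<beta>)\<^sup>2 * F r
      = (r $ l * (r $ j + r $ k) - (1 + r $ j * r $ k)) * G r"
    if r: "r \<in> ext_dom" and jkl: "{j, k, l} = {1, 2, 3}" for r j k l
  proof -
    define H1 where "H1 r = r $ l * (1 - r $ l) * partial3 l (partial3 l F) r
        + (2 * of_real \<beta> - 2 * r $ l) * partial3 l F r
        - of_real \<beta> * (1 - of_real \<beta>) * F r
        - (1 - r $ j) * (1 - r $ k) * G r" for r
    define H2 where "H2 r = 2 * r $ j * r $ k * partial3 j (partial3 k F) r
        + of_real \<beta> * r $ j * partial3 j F r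
        + of_real \<beta> * r $ k * partial3 k F r
        + of_real \<beta> * r $ l * partial3 l F r
        + (of_real \<beta>)\<^sup>2 * F r
        - (r $ l * (r $ j + r $ k) - (1 + r $ j * r $ k)) * G r" for r
    have "H1 r = 0"
    proof (rule identity_ext_dom[OF _ _ r])
      show "sep_diff H1 r" if "r \<in> ext_dom" for r
        unfolding H1_def[abs_def] by (intro sep_diff_intros sep that)
      show "H1 r = 0" if "r \<in> polydisc 0 (1/10)" for r
        unfolding H1_def using pde_coefficients(1)[OF nb pF pG that jkl] by simp
    qed
    moreover have "H2 r = 0"
    proof (rule identity_ext_dom[OF _ _ r])
      show "sep_diff H2 r" if "r \<in> ext_dom" for r
        unfolding H2_def[abs_def] by (intro sep_diff_intros sep that)
      show "H2 r = 0" if "r \<in> polydisc 0 (1/10)" for r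
        unfolding H2_def using pde_coefficients(2)[OF nb pF pG that jkl] by simp
    qed
    ultimately show "r $ l * (1 - r $ l) * partial3 l (partial3 l F) r
        + (2 * of_real \<beta> - 2 * r $ l) * partial3 l F r
        - of_real \<beta> * (1 - of_real \<beta>) * F r
      = (1 - r $ j) * (1 - r $ k) * G r"
    "2 * r $ j * r $ k * partial3 j (partial3 k F) r
        + of_real \<beta> * r $ j * partial3 j F r
        + of_real \<beta> * r $ k * partial3 k F r
        + of_real \<beta> * r $ l * partial3 l F r
        + (of_real \<beta>)\<^sup>2 * F r
      = (r $ l * (r $ j + r $ k) - (1 + r $ j * r $ k)) * G r"
      unfolding H1_def H2_def right_minus_eq by blast+
  qed
  show ?thesis
  proof (rule exI[of _ ext_dom], rule exI[of _ F], rule exI[of _ G], intro conjI open_ext_dom connected_ext_dom polydisc_subset_ext_dom cube_subset_ext_dom anF anG ballI allI impI)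
    fix r assume r: "r \<in> polydisc 0 (1/10)"
    show "((\<lambda>n. complex_of_real (A n) * mpow r n) has_sum F r) UNIV" "((\<lambda>n. complex_of_real (B n) * mpow r n) has_sum G r) UNIV"
      using sF[OF r] sG[OF r] by (simp_all add: arr_series_iff_nat ext0_int)
  qed (rule pde; assumption)+
qed

end
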